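(* Let $R$ be an SMLL net and $M_R$ its multitoken machine. All runs of $M_R$ from the initial state $\mathbf{I}_R$ terminate on a final state $\mathbf{F}_R$, and this final state is unique.
   Context: SMLL formulas: $A ::= 1 \mid \bot \mid X \mid X^\bot \mid A\otimes A \mid A ⅋ A$ (⅋ is "par"), involutive negation; positive $P ::= 1\mid P\otimes P$, negative $N ::= \bot\mid N ⅋ N$. SMLL nets: axiom, cut, $\otimes$, ⅋, one, bot links (each bot link with a box of conclusions $\bot,\Gamma$, $\bot$ its lock) and $n$-ary sync links on positive or negative formulas (in-edges: positive premisses and negative conclusions; out-edges: positive conclusions and negative premisses), with no cyclic switching path (using at most one premiss of each ⅋ and one out-edge of each sync link) at depth 0, recursively in boxes. The SIAM $M_R$: positions are pairs $(e,m)$ ($e$ an edge, $m$ the address in $\{\mathbf{l},\mathbf{r}\}^*$ of an atom occurrence in its type) and $(e,i)$, $i\in\mathbb{N}$, $e$ a box lock; INIT$(R)$/FIN$(R)$ are the negative/positive atom occurrences in conclusions of $R$, ONES$(R)$ positions on conclusions of one links, BOTBOX$(R)$ positions $(e,i)$ on locks. States are functions $\mathbf{T}:\mathrm{INIT}(R)\cup L\to\mathrm{POS}(R)$, $L\subseteq\mathrm{ONES}(R)$; initial state $\mathbf{I}_R$ = identity on INIT$(R)$; a state is final if its image is FIN$(R)\cup B$, $B\subseteq$ BOTBOX$(R)$. Transitions: tokens move up on negative and down on positive positions, pass through axioms and cuts to the dual edge, add/strip $\mathbf{l},\mathbf{r}$ at $\otimes$/⅋ links, cross a sync link all simultaneously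 only when all positions of its in-edges are occupied; a new token may be created on the conclusion of an active one link (depth 0, or depth 0 in an unlocked box); a token on a lock $(e,\varepsilon)$ becomes $(e,0)$, unlocking the box; tokens enter a box only if it is unlocked. A run is a maximal sequence of transitions from $\mathbf{I}_R$. *)

theory Defs
  imports Main "HOL-Library.Extended_Nat"
begin

section \<open>Formulas and addresses\<close>

datatype 'x formula =
    One | Bot | Atom 'x | NegAtom 'x
  | Tens "'x formula" "'x formula" | Parr "'x formula" "'x formula"

fun dual :: "'x formula \<Rightarrow> 'x formula" where
  "dual One = Bot"
| "dual Bot = One"
| "dual (Atom x) = NegAtom x"
| "dual (NegAtom x) = Atom x"
| "dual (Tens A B) = Parr (dual A) (dual B)"
| "dual (Parr A B) = Tens (dual A) (dual B)"

fun positive :: "'x formula \<Rightarrow> bool" where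
  "positive One = True"
| "positive (Tens A B) = (positive A \<and> positive B)"
| "positive _ = False"

fun negative :: "'x formula \<Rightarrow> bool" where
  "negative Bot = True"
| "negative (Parr A B) = (negative A \<and> negative B)"
| "negative _ = False"

datatype side = Lft | Rgt

type_synonym address = "side list"

fun subformula :: "'x formula \<Rightarrow> address \<Rightarrow> 'x formula option" where
  "subformula A [] = Some A"
| "subformula (Tens A B) (s # m) = (case s of Lft \<Rightarrow> subformula A m | Rgt \<Rightarrow> subformula B m)"
| "subformula (Parr A B) (s # m) = (case s of Lft \<Rightarrow> subformula A m | Rgt \<Rightarrow> subformula B m)"
| "subformula _ (s # m) = None"

text \<open>The units count as atoms: tokens also travel on occurrences of \<open>1\<close> and \<open>\<bottom>\<close>.\<close>

definition pos_address :: "'x formula \<Rightarrow> address \<Rightarrow> bool" where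
  "pos_address A m \<longleftrightarrow> subformula A m = Some One \<or> (\<exists>x. subformula A m = Some (Atom x))"

definition neg_address :: "'x formula \<Rightarrow> address \<Rightarrow> bool" where
  "neg_address A m \<longleftrightarrow> subformula A m = Some Bot \<or> (\<exists>x. subformula A m = Some (NegAtom x))"

section \<open>Structures\<close>

text \<open>
  A structure is a list of links over named edges, with a typing of the edges.  In
  \<open>TensL a b c\<close> and \<open>ParL a b c\<close> the premisses are \<open>a\<close>, \<open>b\<close> and the conclusion is \<open>c\<close>.
  \<open>SyncL ps\<close> lists the pairs (premiss, conclusion).
  \<open>BotL e ds S\<close> is a bot link together with its box: \<open>e\<close> is the lock, \<open>S\<close> the content, and
  \<open>ds\<close> pairs each conclusion of \<open>S\<close> with the conclusion of the box it is continued by.  Seen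
  from outside, the box is thus a node with conclusions \<open>e\<close> and \<open>map snd ds\<close>.
\<close>

datatype 'e link =
    AxL 'e 'e
  | CutL 'e 'e
  | TensL 'e 'e 'e
  | ParL 'e 'e 'e
  | OneL 'e
  | BotL 'e "('e \<times> 'e) list" "'e link list"
  | SyncL "('e \<times> 'e) list"

fun prems :: "'e link \<Rightarrow> 'e list" where
  "prems (CutL a b) = [a, b]"
| "prems (TensL a b c) = [a, b]"
| "prems (ParL a b c) = [a, b]"
| "prems (SyncL ps) = map fst ps"
| "prems _ = []"

fun concls :: "'e link \<Rightarrow> 'e list" where
  "concls (AxL a b) = [a, b]"
| "concls (CutL a b) = []"
| "concls (TensL a b c) = [c]"
| "concls (ParL a b c) = [c]"
| "concls (OneL e) = [e]"
| "concls (BotL e ds S) = e # map snd ds"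
| "concls (SyncL ps) = map snd ps"

definition level_prems :: "'e link list \<Rightarrow> 'e set" where
  "level_prems S = (\<Union>l\<in>set S. set (prems l))"

definition level_concls :: "'e link list \<Rightarrow> 'e set" where
  "level_concls S = (\<Union>l\<in>set S. set (concls l))"

definition conclusions :: "'e link list \<Rightarrow> 'e set" where
  "conclusions S = level_concls S - level_prems S"

fun sub_links :: "'e link \<Rightarrow> 'e link list" where
  "sub_links (BotL e ds S) = BotL e ds S # concat (map sub_links S)"
| "sub_links l = [l]"

definition all_links :: "'e link list \<Rightarrow> 'e link list" where
  "all_links S = concat (map sub_links S)"

definition levels :: "'e link list \<Rightarrow> 'e link list set" where
  "levels S = {S} \<union> {S'. \<exists>e ds. BotL e ds S' \<in> set (all_links S)}"

record ('e, 'x) smll =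
  links :: "'e link list"
  edge_type :: "'e \<Rightarrow> 'x formula"

text \<open>
  A sync link has at least one premiss: a nullary one has no edge and would give a transition
  from every state to itself.
\<close>

fun well_typed :: "('e \<Rightarrow> 'x formula) \<Rightarrow> 'e link \<Rightarrow> bool" where
  "well_typed ty (AxL a b) \<longleftrightarrow> ty b = dual (ty a)"
| "well_typed ty (CutL a b) \<longleftrightarrow> ty b = dual (ty a)"
| "well_typed ty (TensL a b c) \<longleftrightarrow> ty c = Tens (ty a) (ty b)"
| "well_typed ty (ParL a b c) \<longleftrightarrow> ty c = Parr (ty a) (ty b)"
| "well_typed ty (OneL e) \<longleftrightarrow> ty e = One"
| "well_typed ty (BotL e ds S) \<longleftrightarrow>
     ty e = Bot \<and> distinct (map fst ds) \<and> set (map fst ds) = conclusions S \<and>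
     (\<forall>(f, g)\<in>set ds. ty g = ty f)"
| "well_typed ty (SyncL ps) \<longleftrightarrow>
     ps \<noteq> [] \<and> (\<forall>(a, c)\<in>set ps. ty c = ty a \<and> (positive (ty a) \<or> negative (ty a)))"

text \<open>
  Throughout all depths, an edge is conclusion of exactly one link and premiss of at most one
  link; a link only uses as premisses edges of its own depth and its own box.
\<close>

definition smll_structure :: "('e, 'x) smll \<Rightarrow> bool" where
  "smll_structure R \<longleftrightarrow>
     distinct (concat (map concls (all_links (links R)))) \<and>
     distinct (concat (map prems (all_links (links R)))) \<and>
     (\<forall>S\<in>levels (links R). level_prems S \<subseteq> level_concls S) \<and>
     (\<forall>l\<in>set (all_links (links R)). well_typed (edge_type R) l)"

section \<open>Correctness\<close>

definition sync_out_edges :: "('e \<Rightarrow> 'x formula) \<Rightarrow> ('e \<times> 'e) list \<Rightarrow> 'e set" where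
  "sync_out_edges ty ps =
     {c. \<exists>a. (a, c) \<in> set ps \<and> positive (ty c)} \<union> {a. \<exists>c. (a, c) \<in> set ps \<and> negative (ty a)}"

definition connects :: "'e \<Rightarrow> 'e link \<Rightarrow> 'e link \<Rightarrow> bool" where
  "connects e v w \<longleftrightarrow>
     e \<in> set (concls v) \<and> e \<in> set (prems w) \<or> e \<in> set (concls w) \<and> e \<in> set (prems v)"

text \<open>
  Paths are undirected, \<open>vs\<close> being the visited nodes and \<open>es\<close> the edges used.  In a structure,
  distinct links have distinct edges, so that a node can be identified with the link itself.
\<close>

definition path :: "'e link list \<Rightarrow> 'e link list \<Rightarrow> 'e list \<Rightarrow> bool" where
  "path S vs es \<longleftrightarrow>
     length vs = Suc (length es) \<and> set vs \<subseteq> set S \<and> distinct es \<and>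
     (\<forall>i<length es. connects (es ! i) (vs ! i) (vs ! Suc i))"

definition switching_path ::
    "('e \<Rightarrow> 'x formula) \<Rightarrow> 'e link list \<Rightarrow> 'e link list \<Rightarrow> 'e list \<Rightarrow> bool" where
  "switching_path ty S vs es \<longleftrightarrow>
     path S vs es \<and>
     (\<forall>a b c. ParL a b c \<in> set S \<longrightarrow> \<not> (a \<in> set es \<and> b \<in> set es)) \<and>
     (\<forall>ps. SyncL ps \<in> set S \<longrightarrow> card (sync_out_edges ty ps \<inter> set es) \<le> 1)"

definition switching_acyclic :: "('e \<Rightarrow> 'x formula) \<Rightarrow> 'e link list \<Rightarrow> bool" where
  "switching_acyclic ty S \<longleftrightarrow>
     \<not> (\<exists>vs es. switching_path ty S vs es \<and> es \<noteq> [] \<and> hd vs = last vs)"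

definition smll_net :: "('e, 'x) smll \<Rightarrow> bool" where
  "smll_net R \<longleftrightarrow>
     smll_structure R \<and> (\<forall>S\<in>levels (links R). switching_acyclic (edge_type R) S)"

section \<open>The multitoken machine\<close>

datatype 'e position = At 'e address | Lock 'e nat

definition is_lock :: "('e, 'x) smll \<Rightarrow> 'e \<Rightarrow> bool" where
  "is_lock R e \<longleftrightarrow> (\<exists>ds S. BotL e ds S \<in> set (all_links (links R)))"

definition BOTBOX :: "('e, 'x) smll \<Rightarrow> 'e position set" where
  "BOTBOX R = {Lock e i | e i. is_lock R e}"

definition POS :: "('e, 'x) smll \<Rightarrow> 'e position set" where
  "POS R = {At e m | e m. e \<in> level_concls (all_links (links R)) \<and>
              (pos_address (edge_type R e) m \<or> neg_address (edge_type R e) m)} \<union> BOTBOX R"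

definition INIT :: "('e, 'x) smll \<Rightarrow> 'e position set" where
  "INIT R = {At e m | e m. e \<in> conclusions (links R) \<and> neg_address (edge_type R e) m}"

definition FIN :: "('e, 'x) smll \<Rightarrow> 'e position set" where
  "FIN R = {At e m | e m. e \<in> conclusions (links R) \<and> pos_address (edge_type R e) m}"

definition ONES :: "('e, 'x) smll \<Rightarrow> 'e position set" where
  "ONES R = {At e [] | e. OneL e \<in> set (all_links (links R))}"

text \<open>A token is named by the position it starts from.\<close>

type_synonym 'e state = "'e position \<Rightarrow> 'e position option"

definition is_state :: "('e, 'x) smll \<Rightarrow> 'e state \<Rightarrow> bool" where
  "is_state R T \<longleftrightarrow> (\<exists>K\<subseteq>ONES R. dom T = INIT R \<union> K) \<and> ran T \<subseteq> POS R"

definition initial_state :: "('e, 'x) smll \<Rightarrow> 'e state" where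
  "initial_state R = (\<lambda>p. if p \<in> INIT R then Some p else None)"

definition final_state :: "('e, 'x) smll \<Rightarrow> 'e state \<Rightarrow> bool" where
  "final_state R T \<longleftrightarrow> is_state R T \<and> (\<exists>B\<subseteq>BOTBOX R. ran T = FIN R \<union> B)"

definition unlocked :: "'e state \<Rightarrow> 'e \<Rightarrow> bool" where
  "unlocked T e \<longleftrightarrow> (\<exists>i. Lock e i \<in> ran T)"

definition active :: "('e, 'x) smll \<Rightarrow> 'e state \<Rightarrow> 'e link \<Rightarrow> bool" where
  "active R T l \<longleftrightarrow>
     l \<in> set (links R) \<or>
     (\<exists>e ds S. BotL e ds S \<in> set (all_links (links R)) \<and> unlocked T e \<and> l \<in> set S)"

abbreviation has_link :: "('e, 'x) smll \<Rightarrow> 'e link \<Rightarrow> bool" where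
  "has_link R l \<equiv> l \<in> set (all_links (links R))"

text \<open>Moves of a single token; the state only serves to know which boxes are unlocked.\<close>

inductive move :: "('e, 'x) smll \<Rightarrow> 'e state \<Rightarrow> 'e position \<Rightarrow> 'e position \<Rightarrow> bool"
  for R :: "('e, 'x) smll" and T :: "'e state" where
  ax1: "has_link R (AxL a b) \<Longrightarrow> neg_address (edge_type R a) m \<Longrightarrow> move R T (At a m) (At b m)"
| ax2: "has_link R (AxL a b) \<Longrightarrow> neg_address (edge_type R b) m \<Longrightarrow> move R T (At b m) (At a m)"
| cut1: "has_link R (CutL a b) \<Longrightarrow> pos_address (edge_type R a) m \<Longrightarrow> move R T (At a m) (At b m)"
| cut2: "has_link R (CutL a b) \<Longrightarrow> pos_address (edge_type R b) m \<Longrightarrow> move R T (At b m) (At a m)"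
| down_left: "has_link R (TensL a b c) \<or> has_link R (ParL a b c) \<Longrightarrow>
    pos_address (edge_type R a) m \<Longrightarrow> move R T (At a m) (At c (Lft # m))"
| down_right: "has_link R (TensL a b c) \<or> has_link R (ParL a b c) \<Longrightarrow>
    pos_address (edge_type R b) m \<Longrightarrow> move R T (At b m) (At c (Rgt # m))"
| up_left: "has_link R (TensL a b c) \<or> has_link R (ParL a b c) \<Longrightarrow>
    neg_address (edge_type R a) m \<Longrightarrow> move R T (At c (Lft # m)) (At a m)"
| up_right: "has_link R (TensL a b c) \<or> has_link R (ParL a b c) \<Longrightarrow>
    neg_address (edge_type R b) m \<Longrightarrow> move R T (At c (Rgt # m)) (At b m)"
| lock: "has_link R (BotL e ds S) \<Longrightarrow> move R T (At e []) (Lock e 0)"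
| enter: "has_link R (BotL e ds S) \<Longrightarrow> (f, g) \<in> set ds \<Longrightarrow> unlocked T e \<Longrightarrow>
    neg_address (edge_type R g) m \<Longrightarrow> move R T (At g m) (At f m)"
| leave: "has_link R (BotL e ds S) \<Longrightarrow> (f, g) \<in> set ds \<Longrightarrow>
    pos_address (edge_type R f) m \<Longrightarrow> move R T (At f m) (At g m)"

text \<open>The domain of this relation is the set of positions on the in-edges of the sync link.\<close>

definition sync_cross ::
    "('e \<Rightarrow> 'x formula) \<Rightarrow> ('e \<times> 'e) list \<Rightarrow> ('e position \<times> 'e position) set" where
  "sync_cross ty ps =
     {(At a m, At c m) | a c m. (a, c) \<in> set ps \<and> positive (ty a) \<and> pos_address (ty a) m} \<union>
     {(At c m, At a m) | a c m. (a, c) \<in> set ps \<and> negative (ty c) \<and> neg_address (ty c) m}"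

inductive transition :: "('e, 'x) smll \<Rightarrow> 'e state \<Rightarrow> 'e state \<Rightarrow> bool"
  for R :: "('e, 'x) smll" where
  token: "T t = Some p \<Longrightarrow> move R T p q \<Longrightarrow> transition R T (T(t \<mapsto> q))"
| one: "has_link R (OneL e) \<Longrightarrow> active R T (OneL e) \<Longrightarrow> At e [] \<notin> dom T \<Longrightarrow>
    transition R T (T(At e [] \<mapsto> At e []))"
| sync: "has_link R (SyncL ps) \<Longrightarrow> Domain (sync_cross (edge_type R) ps) \<subseteq> ran T \<Longrightarrow>
    \<forall>t. rel_option
      (\<lambda>p q. (p, q) \<in> sync_cross (edge_type R) ps \<or> p \<notin> Domain (sync_cross (edge_type R) ps) \<and> q = p)
      (T t) (T' t) \<Longrightarrow>
    transition R T T'"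

text \<open>
  A run consists of the states \<open>r 0, r 1, \<dots>\<close> up to index \<open>n\<close>, which is infinite if the run does
  not terminate.
\<close>

definition run :: "('e, 'x) smll \<Rightarrow> enat \<Rightarrow> (nat \<Rightarrow> 'e state) \<Rightarrow> bool" where
  "run R n r \<longleftrightarrow>
     r 0 = initial_state R \<and>
     (\<forall>i. enat i < n \<longrightarrow> transition R (r i) (r (Suc i))) \<and>
     (\<forall>k. n = enat k \<longrightarrow> \<not> (\<exists>T. transition R (r k) T))"

definition terminates_on :: "enat \<Rightarrow> (nat \<Rightarrow> 'e state) \<Rightarrow> 'e state \<Rightarrow> bool" where
  "terminates_on n r F \<longleftrightarrow> (\<exists>k. n = enat k \<and> r k = F)"

end

theory Submission
  imports Defs "HOL-Library.Multiset"
begin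

text \<open>
  Token steps form a partial injection on positions in which initial positions and one-positions have
  no predecessor, so tokens follow disjoint acyclic orbits. Hence a reachable state is determined by
  the set of positions visited so far; each transition enlarges this set, and whatever a run visits is
  visited in every reachable stuck state, because unlocking is monotone and a sync link has either
  been crossed by all its tokens or by none. This gives termination and uniqueness.

  That a stuck state is final is deadlock-freeness. In a stuck state, open the unlocked boxes and
  regard a locked box as a node whose outputs depend on its lock. If some position outside locked boxes
  were unvisited, following the causes for which it was not reached would give a cycle of
  the dependency relation on positions. Such a cycle survives cut elimination: contract axioms and
  cuts, replace a tensor facing a par by two wires, and let tensors and pars facing a
  sync node dissolve into it; an agent with the largest type can always be treated, and a
  switching cycle after a step yields one before it. Once only sync nodes remain, a dependency cycle is
  a switching cycle. Hence the opened structure has a switching cycle, and contracting the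
  excursions into boxes yields a switching cycle at a single level.
\<close>

section \<open>Alternating cycles\<close>

text \<open>The obstacle is that a dependency cycle among positions need not be a switching cycle:
  it may use an edge several times, at different addresses, and may come down both premisses of one
  par. Addresses act as stacks that recall at a tensor or par where a token came from, so the cycle
  cannot be shortened edge by edge. Cut elimination consumes these stacks: once only sync nodes are
  left, whose crossing ignores addresses, forgetting the addresses of a dependency cycle loses
  nothing. Each reduction is used in two opposite directions: dependency cycles are carried forward
  by it, switching cycles backward. For the latter the delicate case is a cycle that runs through
  the contracted wire in both senses. It needs a shortcut, which at a tensor facing a par joins the
  two premisses of the tensor; at relays and sync nodes two opposite passages cannot occur. A sync
  node may be coarser than token flow, every output depending on every input, both because a sync
  link waits for all its tokens and because this lets it absorb tensors and pars alike.\<close>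

text \<open>Each pair of a path \<open>xs\<close> crosses a node from an arrival port to a departure port, and \<open>M\<close> leads
  from a port to the other end of its wire.\<close>

definition alt_path :: "('p \<times> 'p) set \<Rightarrow> ('p \<Rightarrow> 'p) \<Rightarrow> ('p \<times> 'p) list \<Rightarrow> bool" where
  "alt_path B M xs \<longleftrightarrow>
     set xs \<subseteq> B \<and> successively (\<lambda>p q. M (snd p) = fst q) xs \<and> distinct (map fst xs @ map snd xs)"

definition alt_cycle :: "('p \<times> 'p) set \<Rightarrow> ('p \<Rightarrow> 'p) \<Rightarrow> ('p \<times> 'p) list \<Rightarrow> bool" where
  "alt_cycle B M xs \<longleftrightarrow> xs \<noteq> [] \<and> alt_path B M xs \<and> M (snd (last xs)) = fst (hd xs)"

abbreviation visited_ports :: "('p \<times> 'p) list \<Rightarrow> 'p set" where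
  "visited_ports xs \<equiv> fst ` set xs \<union> snd ` set xs"

lemma alt_path_Nil: "alt_path B M []"
  by (simp add: alt_path_def)

lemma alt_path_append:
  "alt_path B M (us @ vs) \<longleftrightarrow> alt_path B M us \<and> alt_path B M vs \<and>
     (us = [] \<or> vs = [] \<or> M (snd (last us)) = fst (hd vs)) \<and> visited_ports us \<inter> visited_ports vs = {}"
  unfolding alt_path_def by (auto simp: successively_append_iff)

lemma alt_path_Cons:
  "alt_path B M (p # xs) \<longleftrightarrow> p \<in> B \<and> fst p \<noteq> snd p \<and> fst p \<notin> visited_ports xs \<and> snd p \<notin> visited_ports xs \<and>
     alt_path B M xs \<and> (xs = [] \<or> M (snd p) = fst (hd xs))"
  unfolding alt_path_def by (auto simp: successively_Cons)

lemmas alt_simps = alt_path_Nil alt_path_append alt_path_Cons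

lemma alt_path_subset: "alt_path B M xs \<Longrightarrow> set xs \<subseteq> B"
  by (simp add: alt_path_def)

lemma alt_path_mono: "alt_path B M xs \<Longrightarrow> set xs \<subseteq> B' \<Longrightarrow> alt_path B' M xs"
  by (simp add: alt_path_def)

lemma alt_cycle_rotate:
  assumes "alt_cycle B M (us @ vs)"
  shows "alt_cycle B M (vs @ us)"
proof (cases "us = [] \<or> vs = []")
  case True
  then show ?thesis using assms by auto
next
  case False
  then show ?thesis
    using assms unfolding alt_cycle_def by (simp add: alt_path_append Int_commute)
qed

lemma alt_cycle_rotate_to:
  assumes "alt_cycle B M xs" "p \<in> set xs"
  obtains zs where "alt_cycle B M (p # zs)" "length xs = Suc (length zs)" "set xs = insert p (set zs)"
proof -
  obtain us vs where xs: "xs = us @ p # vs"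
    using assms(2) by (meson split_list)
  have "alt_cycle B M ((p # vs) @ us)"
    using alt_cycle_rotate assms(1) xs by blast
  then show ?thesis
    using that[of "vs @ us"] xs by auto
qed

lemma alt_cycle_mono:
  assumes "alt_cycle B M xs" "set xs \<subseteq> B'"
  shows "alt_cycle B' M xs"
  using assms by (simp add: alt_cycle_def alt_path_def)

text \<open>\<open>B0\<close> is what remains of \<open>B\<close> after the wire between
  \<open>c\<close> and \<open>M c\<close> is contracted. A new pair of \<open>B0\<close> expands to
  two pairs through the wire, which is legal only once per cycle, so a cycle with two new pairs has
  to be cut. If both run the same way over the wire, the stretch between them already closes through
  it. If they run in opposite ways, \<open>opp0\<close> provides a shortcut.\<close>

lemma no_alt_cycle_contract:
  assumes M: "\<And>p. M (M p) = p" "M c \<noteq> c"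
    and acyc: "\<nexists>xs. alt_cycle B M xs"
    and off0: "\<And>x y. (x, y) \<in> B0 \<Longrightarrow> x \<notin> {c, M c} \<and> y \<notin> {c, M c}"
    and new0: "\<And>x y. (x, y) \<in> B0 \<Longrightarrow> (x, y) \<notin> B \<Longrightarrow> \<exists>d\<in>{c, M c}. (x, d) \<in> B \<and> (M d, y) \<in> B"
    and opp0: "\<And>x1 y1 x2 y2 d. d \<in> {c, M c} \<Longrightarrow> (x1, y1) \<in> B0 - B \<Longrightarrow> (x2, y2) \<in> B0 - B \<Longrightarrow>
      (x1, d) \<in> B \<Longrightarrow> (M d, y1) \<in> B \<Longrightarrow> (x2, M d) \<in> B \<Longrightarrow> (d, y2) \<in> B \<Longrightarrow>
      distinct [x1, y1, x2, y2] \<Longrightarrow> (x2, y1) \<in> B \<or> (x1, y2) \<in> B"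
  shows "\<nexists>xs. alt_cycle B0 M xs"
proof -
  \<comment> \<open>The shortcut \<open>(x1, y2)\<close> may lie in \<open>B\<close> without lying
    in \<open>B0\<close>. The induction on length therefore runs over a relation that also keeps the
    pairs of \<open>B\<close> away from the wire.\<close>
  define B' where "B' = B0 \<union> {(x, y) \<in> B. x \<notin> {c, M c} \<and> y \<notin> {c, M c}}"
  have off: "x \<notin> {c, M c} \<and> y \<notin> {c, M c}" if "(x, y) \<in> B'" for x y
    using that off0 unfolding B'_def by blast
  have old: "(x, y) \<in> B'" if "(x, y) \<in> B" "x \<notin> {c, M c}" "y \<notin> {c, M c}" for x y
    using that unfolding B'_def by blast
  have new: "\<exists>d\<in>{c, M c}. (x, d) \<in> B \<and> (M d, y) \<in> B" if "(x, y) \<in> B'" "(x, y) \<notin> B" for x y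
    using that new0 unfolding B'_def by blast
  have opp: "(x2, y1) \<in> B \<or> (x1, y2) \<in> B" if "d \<in> {c, M c}" "(x1, y1) \<in> B' - B" "(x2, y2) \<in> B' - B"
      "(x1, d) \<in> B" "(M d, y1) \<in> B" "(x2, M d) \<in> B" "(d, y2) \<in> B" "distinct [x1, y1, x2, y2]" for x1 y1 x2 y2 d
    by (rule opp0[OF that(1) _ _ that(4-8)]) (use that(2,3) in \<open>auto simp: B'_def\<close>)
  have "\<exists>ys. alt_cycle B M ys" if "alt_cycle B' M xs" for xs
    using that
  proof (induction xs rule: length_induct)
    case (1 xs)
    show ?case
    proof (cases "set xs \<subseteq> B")
      case True
      then show ?thesis using 1(2) alt_cycle_mono by blast
    next
      case False
      then obtain x1 y1 where xy: "(x1, y1) \<in> set xs" "(x1, y1) \<notin> B" by auto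
      obtain zs where zs: "alt_cycle B' M ((x1, y1) # zs)" "length xs = Suc (length zs)"
        using alt_cycle_rotate_to[OF 1(2) xy(1)] by metis
      have inB: "set ((x1, y1) # zs) \<subseteq> B'"
        using zs by (simp add: alt_cycle_def alt_path_def)
      have xy': "(x1, y1) \<in> B'" using inB by auto
      obtain d where d: "d \<in> {c, M c}" "(x1, d) \<in> B" "(M d, y1) \<in> B"
        using new[OF xy' xy(2)] by blast
      have Md: "M d \<in> {c, M c}" "M d \<noteq> d"
        using d M by auto
      have offd: "x \<noteq> d" "x \<noteq> M d" "y \<noteq> d" "y \<noteq> M d" if "(x, y) \<in> B'" for x y
        using off[OF that] d(1) Md(1) by auto
      have nin: "d \<notin> visited_ports ys" "M d \<notin> visited_ports ys" if "set ys \<subseteq> B'" for ys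
        using that offd by fastforce+
      have path: "alt_path B' M zs" "set zs \<subseteq> B'" and
        xyz: "x1 \<noteq> y1" "x1 \<notin> visited_ports zs" "y1 \<notin> visited_ports zs" "zs = [] \<or> M y1 = fst (hd zs)"
        and closed: "M (snd (last ((x1, y1) # zs))) = x1"
        using zs(1) alt_path_subset[of B' M zs] by (simp_all add: alt_cycle_def alt_path_Cons)
      have xyd: "x1 \<noteq> d" "x1 \<noteq> M d" "y1 \<noteq> d" "y1 \<noteq> M d" using offd xy' by auto
      show ?thesis
      proof (cases "set zs \<subseteq> B")
        case True
        have "alt_path B M zs" using path(1) True by (rule alt_path_mono)
        then have "alt_cycle B M ((x1, d) # (M d, y1) # zs)"
          using xyz closed xyd d nin[OF path(2)] Md(2)
          by (simp add: alt_cycle_def alt_path_Cons split: if_splits)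
        then show ?thesis by blast
      next
        case False
        then have "\<exists>p\<in>set zs. p \<notin> B" by blast
        then obtain vs p ws where sp: "zs = vs @ p # ws" "p \<notin> B" "\<forall>q\<in>set vs. q \<in> B"
          using split_list_first_prop[of zs "\<lambda>p. p \<notin> B"] by blast
        obtain x2 y2 where p: "p = (x2, y2)" by (cases p)
        have vsB: "alt_path B M vs"
          using path(1) sp by (auto simp: alt_path_append intro: alt_path_mono)
        have "alt_path B' M (vs @ (x2, y2) # ws)" using path(1) sp(1) p by simp
        then have vws: "visited_ports vs \<inter> visited_ports ((x2, y2) # ws) = {}"
          "vs = [] \<or> M (snd (last vs)) = x2" "alt_path B' M ((x2, y2) # ws)"
          by (simp_all add: alt_path_append)
        have vsB': "set vs \<subseteq> B'" using path(2) sp by simp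
        have start: "vs = [] \<or> M y1 = fst (hd vs)" "vs \<noteq> [] \<or> M y1 = x2"
          using xyz(4) sp(1) p by (cases vs; simp)+
        have fresh: "x1 \<notin> visited_ports vs" "y1 \<notin> visited_ports vs" "x1 \<noteq> x2" "x1 \<noteq> y2" "y1 \<noteq> x2" "y1 \<noteq> y2"
          using xyz(2,3) sp(1) p by auto
        have p': "(x2, y2) \<in> B'" using inB sp p by auto
        obtain d2 where d2: "d2 \<in> {c, M c}" "(x2, d2) \<in> B" "(M d2, y2) \<in> B"
          using new[OF p'] sp(2) p by blast
        show ?thesis
        proof (cases "d2 = d")
          case True
          \<comment> \<open>Same sense of passage: the stretch leaves the wire at
            \<open>M d\<close>, returns to it at \<open>d\<close>, and so closes without the
            remaining pairs.\<close>
          have "alt_cycle B M ((M d, y1) # vs @ [(x2, d)])"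
            using vsB vws(1,2) d(2,3) d2(2) True nin[OF vsB'] Md offd[OF p'] xyd M(1) start fresh
            by (cases "vs = []") (simp_all add: alt_cycle_def alt_path_Cons alt_path_append alt_path_Nil)
          then show ?thesis by blast
        next
          case False
          then have d2': "d2 = M d" using d d2 M by auto
          have dist: "distinct [x1, y1, x2, y2]"
            using xyz sp(1) p vws(3) by (auto simp: alt_path_Cons)
          have "(x2, y1) \<in> B \<or> (x1, y2) \<in> B"
            using opp[OF d(1), of x1 y1 x2 y2] xy xy' p' sp(2) p d d2 d2' dist M by auto
          then show ?thesis
          proof
            assume "(x2, y1) \<in> B"
            then have "alt_cycle B M ((x2, y1) # vs)"
              using vsB vws(1,2) start fresh dist
              by (cases "vs = []") (simp_all add: alt_cycle_def alt_path_Cons)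
            then show ?thesis by blast
          next
            \<comment> \<open>Here the shortcut removes both new pairs and the stretch
              \<open>vs\<close>. The rest may contain further new pairs, whence the appeal to the
              induction hypothesis.\<close>
            assume "(x1, y2) \<in> B"
            then have "(x1, y2) \<in> B'"
              using old[of x1 y2] off[OF xy'] off[OF p'] by blast
            then have "alt_cycle B' M ((x1, y2) # ws)"
              using vws(3) xyz(2,3) sp(1) p dist closed
              by (simp add: alt_cycle_def alt_path_Cons image_Un split: if_splits)
            moreover have "length ((x1, y2) # ws) < length xs"
              using zs(2) sp by auto
            ultimately show ?thesis using 1(1) by blast
          qed
        qed
      qed
    qed
  qed
  then show ?thesis using acyc alt_cycle_mono[of B0 M _ B'] unfolding alt_cycle_def alt_path_def B'_def by blast
qed

text \<open>An excursion into the region \<open>I\<close> enters from and returns to ports of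
  \<open>G\<close>, so one pair of \<open>G\<close> can replace it, and the cycle gets shorter.
  \<open>complete\<close> puts that pair into \<open>B\<close> as well as into \<open>Bout\<close>,
  because the shortened cycle must again be a cycle of \<open>B\<close> for the induction. A cycle
  that never enters \<open>I\<close> lies wholly outside or wholly inside.\<close>

lemma alt_cycle_substitute:
  assumes cyc: "alt_cycle B M xs"
    and inside: "\<And>p. M p \<in> I \<longleftrightarrow> p \<in> I"
    and B: "\<And>x y. (x, y) \<in> B \<Longrightarrow> x \<notin> I \<Longrightarrow> y \<notin> I \<Longrightarrow> (x, y) \<in> Bout"
    and Bin: "\<And>x y. (x, y) \<in> B \<Longrightarrow> x \<in> I \<Longrightarrow> y \<in> I \<Longrightarrow> (x, y) \<in> Bin"
    and entry: "\<And>x y. (x, y) \<in> B \<Longrightarrow> x \<notin> I \<Longrightarrow> y \<in> I \<Longrightarrow> x \<in> G"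
    and exit: "\<And>x y. (x, y) \<in> B \<Longrightarrow> x \<in> I \<Longrightarrow> y \<notin> I \<Longrightarrow> y \<in> G"
    and complete: "\<And>x y. x \<in> G \<Longrightarrow> y \<in> G \<Longrightarrow> x \<noteq> y \<Longrightarrow> (x, y) \<in> B \<inter> Bout"
    and G: "G \<inter> I = {}"
  shows "\<exists>ys. alt_cycle Bout M ys \<or> alt_cycle Bin M ys"
  using cyc
proof (induction xs rule: length_induct)
  case (1 xs)
  have sub: "set xs \<subseteq> B" using 1(2) by (auto simp: alt_cycle_def alt_path_def)
  show ?case
  proof (cases "\<exists>x y. (x, y) \<in> set xs \<and> x \<notin> I \<and> y \<in> I")
    case True
    then obtain x y where xy: "(x, y) \<in> set xs" "x \<notin> I" "y \<in> I" by blast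
    obtain zs where zs: "alt_cycle B M ((x, y) # zs)" "length xs = Suc (length zs)" "set xs = insert (x, y) (set zs)"
      using alt_cycle_rotate_to[OF 1(2) xy(1)] by metis
    have "\<exists>p\<in>set zs. snd p \<notin> I"
    proof -
      have "zs \<noteq> []"
        using zs(1) xy inside[of y] by (auto simp: alt_cycle_def)
      moreover have "M (snd (last zs)) = x"
        using zs(1) calculation by (auto simp: alt_cycle_def)
      ultimately show ?thesis
        using xy(2) inside[of "snd (last zs)"] last_in_set by metis
    qed
    then obtain vs p ws where sp: "zs = vs @ p # ws" "snd p \<notin> I" "\<forall>q\<in>set vs. snd q \<in> I"
      using split_list_first_prop[of zs "\<lambda>p. snd p \<notin> I"] by blast
    obtain x2 y2 where p: "p = (x2, y2)" by (cases p)
    have "x2 \<in> I"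
    proof (cases "vs = []")
      case True
      then have "M y = x2" using zs(1) sp p by (auto simp: alt_cycle_def alt_path_def successively_Cons)
      then show ?thesis using xy(3) inside by metis
    next
      case False
      then have "M (snd (last vs)) = x2"
        using zs(1) sp p by (auto simp: alt_cycle_def alt_path_def successively_Cons successively_append_iff)
      then show ?thesis using sp(3) False inside last_in_set by metis
    qed
    have "(x, y) \<in> B" "(x2, y2) \<in> B" using sub zs(3) sp p by auto
    then have "x \<in> G" "y2 \<in> G" using entry xy exit \<open>x2 \<in> I\<close> sp p by auto
    moreover have "x \<noteq> y2" using zs(1) sp p by (auto simp: alt_cycle_def alt_path_def)
    ultimately have "(x, y2) \<in> B" using complete by blast
    then have "alt_cycle B M ((x, y2) # ws)"
      using zs(1) sp p by (auto simp: alt_cycle_def alt_path_Cons alt_path_append)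
    moreover have "length ((x, y2) # ws) < length xs" using zs(2) sp by simp
    ultimately show ?thesis using 1(1) by blast
  next
    case noentry: False
    show ?thesis
    proof (cases "\<exists>q\<in>set xs. fst q \<in> I")
      case False
      then have "set xs \<subseteq> Bout" using noentry B sub by fastforce
      then show ?thesis using alt_cycle_mono 1(2) by blast
    next
      case True
      then obtain q where q: "q \<in> set xs" "fst q \<in> I" by blast
      obtain zs where zs: "alt_cycle B M (q # zs)" "set xs = insert q (set zs)"
        using alt_cycle_rotate_to[OF 1(2) q(1)] by metis
      \<comment> \<open>The pair after the last departure out of \<open>I\<close> would start
        outside and end inside, which is an entry; if no pair follows, the cycle wraps around to
        \<open>q\<close>, which starts inside.\<close>
      have "\<forall>p\<in>set (q # zs). snd p \<in> I"
      proof (rule ccontr)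
        assume "\<not> ?thesis"
        then obtain vs p ws where sp: "q # zs = vs @ p # ws" "snd p \<notin> I" "\<forall>r\<in>set ws. \<not> snd r \<notin> I"
          using split_list_last_prop[of "q # zs" "\<lambda>p. snd p \<notin> I"] by blast
        have "fst q = M (snd p) \<or> (\<exists>r\<in>set (q # zs). M (snd p) = fst r \<and> snd r \<in> I)"
        proof (cases ws)
          case Nil
          then have "p = last (q # zs)" using sp(1) by (metis last_snoc)
          then show ?thesis using zs(1) by (simp add: alt_cycle_def)
        next
          case (Cons r rs)
          then have "M (snd p) = fst r"
            using zs(1) unfolding alt_cycle_def alt_path_def sp(1)
            by (auto simp: successively_append_iff)
          moreover have "r \<in> set (q # zs)" unfolding sp(1) Cons by simp
          moreover have "snd r \<in> I" using sp(3) Cons by auto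
          ultimately show ?thesis by blast
        qed
        then show False
        proof
          assume "fst q = M (snd p)"
          then show False using q(2) sp(2) inside by metis
        next
          assume "\<exists>r\<in>set (q # zs). M (snd p) = fst r \<and> snd r \<in> I"
          then obtain r where r: "r \<in> set xs" "M (snd p) = fst r" "snd r \<in> I"
            using zs(2) by (metis list.simps(15))
          have "fst r \<notin> I" using sp(2) r(2) inside by metis
          then show False using noentry r by (cases r) auto
        qed
      qed
      then have "set xs \<subseteq> Bin" using noentry sub Bin zs(2) by fastforce
      then show ?thesis using alt_cycle_mono 1(2) by blast
    qed
  qed
qed

text \<open>A shortest closed walk is elementary once arrivals and departures are disjoint.\<close>

lemma alt_cycle_if_cyclic:
  assumes "\<And>p. M (M p) = p"
    and cyc: "(p, p) \<in> {(x, M y) | x y. (x, y) \<in> B}\<^sup>+"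
    and disj: "fst ` B \<inter> snd ` B = {}"
  shows "\<exists>xs. alt_cycle B M xs"
proof -
  let ?S = "{(x, M y) | x y. (x, y) \<in> B}"
  define W where "W xs \<longleftrightarrow> xs \<noteq> [] \<and> set xs \<subseteq> B \<and> successively (\<lambda>p q. M (snd p) = fst q) xs" for xs :: "('a \<times> 'a) list"
  have walk: "\<exists>xs. W xs \<and> fst (hd xs) = a \<and> M (snd (last xs)) = b" if "(a, b) \<in> ?S\<^sup>+" for a b
    using that
  proof (induction rule: trancl_induct)
    case (base y)
    then obtain z where "(a, z) \<in> B" "y = M z" by auto
    then show ?case by (intro exI[of _ "[(a, z)]"]) (auto simp: W_def)
  next
    case (step y z)
    then obtain xs w where xs: "W xs" "fst (hd xs) = a" "M (snd (last xs)) = y" "(y, w) \<in> B" "z = M w" by auto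
    then have "xs \<noteq> []" by (simp add: W_def)
    then show ?case
      using xs by (intro exI[of _ "xs @ [(y, w)]"]) (simp add: W_def successively_append_iff)
  qed
  then obtain xs0 where xs0: "W xs0 \<and> M (snd (last xs0)) = fst (hd xs0)" using walk[OF cyc] by auto
  define C where "C xs \<longleftrightarrow> W xs \<and> M (snd (last xs)) = fst (hd xs)" for xs
  obtain xs where xs: "C xs" and least: "\<And>ys. C ys \<Longrightarrow> length xs \<le> length ys"
    using ex_has_least_nat[of C xs0 length] xs0 unfolding C_def by blast
  \<comment> \<open>A repeated arrival would cut out a shorter closed walk.\<close>
  have d1: "distinct (map fst xs)"
  proof (rule ccontr)
    assume "\<not> ?thesis"
    then obtain as' y bs' cs' where "map fst xs = as' @ [y] @ bs' @ [y] @ cs'"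
      using not_distinct_decomp by blast
    then obtain as zs where as: "xs = as @ zs" "map fst zs = y # bs' @ y # cs'"
      by (auto simp: map_eq_append_conv)
    then obtain u zs1 where u: "zs = u # zs1" "fst u = y" "map fst zs1 = bs' @ y # cs'"
      by (cases zs) auto
    then obtain bs zs2 where bs: "zs1 = bs @ zs2" "map fst zs2 = y # cs'"
      by (auto simp: map_eq_append_conv)
    then obtain v cs where v: "zs2 = v # cs" "fst v = y"
      by (cases zs2) auto
    have sp: "xs = as @ u # bs @ v # cs" "fst u = fst v"
      using as u bs v by auto
    have "C (u # bs)"
      using xs sp by (auto simp: C_def W_def successively_append_iff successively_Cons)
    from least[OF this] sp show False by simp
  qed
  \<comment> \<open>Up to \<open>M\<close>, the departures are the arrivals rotated by one, so they
    inherit distinctness.\<close>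
  have "map (M \<circ> snd) xs = tl (map fst xs) @ [fst (hd xs)]"
  proof -
    have "successively (\<lambda>p q. M (snd p) = fst q) ys \<Longrightarrow> ys \<noteq> [] \<Longrightarrow>
        map (M \<circ> snd) ys = tl (map fst ys) @ [M (snd (last ys))]" for ys :: "('a \<times> 'a) list"
      by (induction ys rule: induct_list012) auto
    then show ?thesis using xs by (auto simp: C_def W_def)
  qed
  moreover have "xs \<noteq> []" using xs by (auto simp: C_def W_def)
  moreover have "distinct (tl (map fst xs) @ [fst (hd xs)])"
    using d1 \<open>xs \<noteq> []\<close> by (cases xs) auto
  ultimately have "distinct (map M (map snd xs))"
    by simp
  then have d2: "distinct (map snd xs)"
    by (rule distinct_map[THEN iffD1, THEN conjunct1])
  have "set xs \<subseteq> B" using xs by (simp add: C_def W_def)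
  then have "set (map fst xs) \<inter> set (map snd xs) = {}"
    using disj by fastforce
  then show ?thesis
    using xs d1 d2 by (intro exI[of _ xs]) (auto simp: alt_cycle_def alt_path_def C_def W_def)
qed

section \<open>Wired nodes\<close>

text \<open>\<open>Bin k c a b\<close> has the conclusion \<open>c\<close> and the premisses \<open>a\<close>, \<open>b\<close>; it is a tensor if \<open>k\<close> holds,
  and a par otherwise. \<open>Sync js os\<close> is only crossed from an input to an output, so cycles are directed.\<close>

datatype 'p node = Relay 'p 'p | Bin bool 'p 'p 'p | Sync "'p list" "'p list"

fun ports :: "'p node \<Rightarrow> 'p list" where
  "ports (Relay r s) = [r, s]"
| "ports (Bin k c a b) = [c, a, b]"
| "ports (Sync js os) = js @ os"

fun blue :: "'p node \<Rightarrow> ('p \<times> 'p) set" where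
  "blue (Relay r s) = {(r, s), (s, r)}"
| "blue (Bin k c a b) = {(a, c), (c, a), (b, c), (c, b)} \<union> (if k then {(a, b), (b, a)} else {})"
| "blue (Sync js os) = set js \<times> set os"

text \<open>An address is a stack: \<open>Bin\<close> pushes a side towards the conclusion and pops
  it towards a premiss. \<open>Sync\<close> leaves the addresses unrelated, since an output atom
  waits for every atom of every input.\<close>

fun pass :: "'p node \<Rightarrow> 'p \<times> address \<Rightarrow> 'p \<times> address \<Rightarrow> bool" where
  "pass (Relay r s) p q \<longleftrightarrow> (\<exists>m. p = (r, m) \<and> q = (s, m) \<or> p = (s, m) \<and> q = (r, m))"
| "pass (Bin k c a b) p q \<longleftrightarrow>
     (\<exists>m. p = (a, m) \<and> q = (c, Lft # m) \<or> p = (b, m) \<and> q = (c, Rgt # m) \<or>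
          p = (c, Lft # m) \<and> q = (a, m) \<or> p = (c, Rgt # m) \<and> q = (b, m))"
| "pass (Sync js os) p q \<longleftrightarrow> fst p \<in> set js \<and> fst q \<in> set os"

text \<open>Each end of a wire bears its own type, and the two are dual. \<open>Bin\<close> sits at
  the upper end of its conclusion but at the lower ends of its premisses, whence the
  \<open>dual\<close> in its typing.\<close>

fun node_typed :: "('p \<Rightarrow> 'x formula) \<Rightarrow> 'p node \<Rightarrow> bool" where
  "node_typed ty (Relay r s) \<longleftrightarrow> ty s = dual (ty r)"
| "node_typed ty (Bin k c a b) \<longleftrightarrow>
     ty c = (if k then Tens (dual (ty a)) (dual (ty b)) else Parr (dual (ty a)) (dual (ty b)))"
| "node_typed ty (Sync js os) \<longleftrightarrow> True"

definition Blue :: "'p node list \<Rightarrow> ('p \<times> 'p) set" where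
  "Blue N = (\<Union>n\<in>set N. blue n)"

definition Pass :: "'p node list \<Rightarrow> ('p \<times> address) \<Rightarrow> ('p \<times> address) \<Rightarrow> bool" where
  "Pass N p q \<longleftrightarrow> (\<exists>n\<in>set N. pass n p q)"

text \<open>A step crosses one node and then one wire, and so leads from an arrival to the next
  arrival.\<close>

definition steps :: "('p \<Rightarrow> 'p) \<Rightarrow> (('p \<times> address) \<Rightarrow> ('p \<times> address) \<Rightarrow> bool) \<Rightarrow> (('p \<times> address) \<times> ('p \<times> address)) set" where
  "steps M P = {(p, (M y, m)) | p y m. P p (y, m)}"

lemma dual_dual [simp]: "dual (dual A) = A"
  by (induction A) auto

lemma size_dual [simp]: "size (dual A) = size A"
  by (induction A) auto

lemma Blue_Cons: "Blue (n # N) = blue n \<union> Blue N"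
  by (simp add: Blue_def)

lemma Pass_Cons: "Pass (n # N) p q \<longleftrightarrow> pass n p q \<or> Pass N p q"
  by (simp add: Pass_def)

lemma blue_ports: "(x, y) \<in> blue n \<Longrightarrow> x \<in> set (ports n) \<and> y \<in> set (ports n)"
  by (cases n) (auto split: if_splits)

lemma pass_blue: "pass n (x, m) (y, m') \<Longrightarrow> (x, y) \<in> blue n"
  by (cases n) auto

abbreviation all_ports :: "'p node list \<Rightarrow> 'p list" where
  "all_ports N \<equiv> concat (map ports N)"

lemma Blue_ports: "(x, y) \<in> Blue N \<Longrightarrow> x \<in> set (all_ports N) \<and> y \<in> set (all_ports N)"
  unfolding Blue_def by (auto dest!: blue_ports)

lemma Pass_Blue: "Pass N (x, m) (y, m') \<Longrightarrow> (x, y) \<in> Blue N"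
  unfolding Blue_def Pass_def by (blast dest: pass_blue)

lemma steps_iff:
  assumes "\<And>p. M (M p) = p"
  shows "(p, (z, m)) \<in> steps M P \<longleftrightarrow> P p (M z, m)"
proof
  assume "(p, (z, m)) \<in> steps M P"
  then obtain y where "z = M y" "P p (y, m)" unfolding steps_def by blast
  then show "P p (M z, m)" using assms by simp
next
  assume "P p (M z, m)"
  moreover have "z = M (M z)" using assms by simp
  ultimately show "(p, (z, m)) \<in> steps M P" unfolding steps_def by blast
qed

text \<open>Contracting the wire between \<open>c\<close> and \<open>M c\<close>: a cycle does not stay on that wire, so it suffices
  to follow its visits elsewhere.\<close>

lemma acyclic_steps_contract:
  assumes M: "\<And>p. M (M p) = p"
    and acyc: "acyclic (steps M P')"
    and keep: "\<And>x m y m'. P (x, m) (y, m') \<Longrightarrow> x \<notin> {c, M c} \<Longrightarrow> y \<notin> {c, M c} \<Longrightarrow> P' (x, m) (y, m')"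
    and through: "\<And>x m d m1 y m2. d \<in> {c, M c} \<Longrightarrow> P (x, m) (d, m1) \<Longrightarrow> P (M d, m1) (y, m2) \<Longrightarrow>
       x \<notin> {c, M c} \<and> y \<notin> {c, M c} \<and> P' (x, m) (y, m2)"
  shows "acyclic (steps M P)"
proof (rule ccontr)
  let ?S = "steps M P" and ?S' = "steps M P'"
  define G where "G = {p :: 'a \<times> address. fst p \<notin> {c, M c}}"
  have GI: "(x, m) \<in> G \<longleftrightarrow> x \<notin> {c, M c}" for x m by (simp add: G_def)
  have Mc: "M y \<in> {c, M c} \<longleftrightarrow> y \<in> {c, M c}" for y
    using M[of y] M[of c] by (metis insert_iff singletonD)
  note st = steps_iff[of M, OF M]
  have direct: "(p, q) \<in> ?S'" if "(p, q) \<in> ?S" "p \<in> G" "q \<in> G" for p q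
  proof -
    obtain x m y m' where pq: "p = (x, m)" "q = (y, m')" by (cases p, cases q)
    have "P' (x, m) (M y, m')"
      using keep[of x m "M y" m'] that Mc[of y] unfolding pq st GI by blast
    then show ?thesis by (simp add: pq st)
  qed
  have two: "p \<in> G \<and> r \<in> G \<and> (p, r) \<in> ?S'" if "(p, q) \<in> ?S" "(q, r) \<in> ?S" "q \<notin> G" for p q r
  proof -
    obtain x m d m1 y m2 where pqr: "p = (x, m)" "q = (d, m1)" "r = (y, m2)" by (cases p, cases q, cases r)
    have "d \<in> {c, M c}" using that(3) by (simp only: pqr GI not_not)
    then have d: "M d \<in> {c, M c}" by (simp only: Mc)
    have "P (x, m) (M d, m1)" "P (M (M d), m1) (M y, m2)"
      using that(1,2) by (simp_all only: pqr st M)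
    then have "x \<notin> {c, M c} \<and> M y \<notin> {c, M c} \<and> P' (x, m) (M y, m2)"
      by (rule through[OF d])
    then show ?thesis unfolding pqr GI st Mc .
  qed
  \<comment> \<open>The invariant covers a walk that currently sits on the wire: all but its last
    step has been translated, and that step waits to be merged with the next one.\<close>
  have trans: "(q \<in> G \<longrightarrow> (p, q) \<in> ?S'\<^sup>+) \<and> (q \<notin> G \<longrightarrow> (\<exists>r\<in>G. (p, r) \<in> ?S'\<^sup>* \<and> (r, q) \<in> ?S))"
    if "(p, q) \<in> ?S\<^sup>+" "p \<in> G" for p q
    using that(1)
  proof (induction rule: trancl_induct)
    case (base q)
    then show ?case using direct that(2) by blast
  next
    case (step q r)
    show ?case
    proof (cases "q \<in> G")
      case True
      then have pq: "(p, q) \<in> ?S'\<^sup>+" using step(3) by blast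
      then have "(p, q) \<in> ?S'\<^sup>*" by (rule trancl_into_rtrancl)
      moreover have "(p, r) \<in> ?S'\<^sup>+" if "r \<in> G"
        using pq direct[OF step(2) \<open>q \<in> G\<close> that] by (rule trancl_into_trancl)
      ultimately show ?thesis using True step(2) by blast
    next
      case False
      then obtain s where s: "(p, s) \<in> ?S'\<^sup>*" "(s, q) \<in> ?S" using step(3) by blast
      then have "r \<in> G" "(s, r) \<in> ?S'" using two[OF s(2) step(2) False] by blast+
      then show ?thesis using rtrancl_into_trancl1[OF s(1)] by blast
    qed
  qed
  assume "\<not> acyclic ?S"
  then obtain p where p: "(p, p) \<in> ?S\<^sup>+" unfolding acyclic_def by blast
  have "\<exists>p\<in>G. (p, p) \<in> ?S\<^sup>+"
  proof (cases "p \<in> G")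
    case False
    obtain q where q: "(p, q) \<in> ?S" "(q, p) \<in> ?S\<^sup>*" using p by (meson tranclD)
    obtain r where "(r, p) \<in> ?S" using p by (meson tranclE)
    then have "q \<in> G" using two q(1) False by blast
    moreover have "(q, q) \<in> ?S\<^sup>+" by (rule rtrancl_into_trancl1[OF q(2,1)])
    ultimately show ?thesis by blast
  qed (use p in blast)
  then obtain p where "p \<in> G" "(p, p) \<in> ?S\<^sup>+" by blast
  then have "(p, p) \<in> ?S'\<^sup>+" using trans by blast
  then show False using acyc unfolding acyclic_def by blast
qed

text \<open>Every port is wired to a partner, also when no node owns the partner; this is how the
  conclusions of a net appear as free ends.\<close>

locale wiring =
  fixes M :: "'p \<Rightarrow> 'p" and ty :: "'p \<Rightarrow> 'x formula"
  assumes MM [simp]: "M (M p) = p" and M_neq [simp]: "M p \<noteq> p" and ty_M [simp]: "ty (M p) = dual (ty p)"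
begin

definition net :: "'p node list \<Rightarrow> bool" where
  "net N \<longleftrightarrow> distinct (all_ports N) \<and> (\<forall>n\<in>set N. node_typed ty n) \<and> \<not> (\<exists>xs. alt_cycle (Blue N) M xs)"

lemma net_perm:
  assumes "mset N = mset N'" "net N"
  shows "net N'"
proof -
  have "mset (all_ports N) = mset (all_ports N')"
    by (simp only: mset_concat sum_mset_sum_list[symmetric] mset_map assms(1))
  then have "distinct (all_ports N) = distinct (all_ports N')" by (rule mset_eq_imp_distinct_iff)
  moreover have "Blue N = Blue N'" "set N = set N'"
    unfolding Blue_def mset_eq_setD[OF assms(1)] by (rule refl)+
  ultimately show ?thesis using assms(2) unfolding net_def by simp
qed

lemma Pass_perm: "mset N = mset N' \<Longrightarrow> Pass N = Pass N'"
  by (drule mset_eq_setD) (simp add: Pass_def fun_eq_iff)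

end

section \<open>Cut elimination\<close>

lemma ports_map_node: "ports (map_node f n) = map f (ports n)"
  by (cases n) auto

lemma all_ports_map_node: "all_ports (map (map_node f) N) = map f (all_ports N)"
  by (induction N) (auto simp: ports_map_node)

lemma blue_map_node: "blue (map_node f n) = map_prod f f ` blue n"
  by (cases n) auto

lemma Blue_map_node: "Blue (map (map_node f) N) = map_prod f f ` Blue N"
  unfolding Blue_def by (auto simp: blue_map_node)

lemma pass_map_node: "pass n (x, m) (y, m') \<Longrightarrow> pass (map_node f n) (f x, m) (f y, m')"
  by (cases n) auto

lemma Pass_map_node: "Pass N (x, m) (y, m') \<Longrightarrow> Pass (map (map_node f) N) (f x, m) (f y, m')"
  unfolding Pass_def using pass_map_node by fastforce

lemma node_typed_map_node: "(\<And>p. ty (f p) = ty p) \<Longrightarrow> node_typed ty (map_node f n) = node_typed ty n"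
  by (cases n) auto

lemma blue_irrefl: "distinct (ports n) \<Longrightarrow> (x, x) \<notin> blue n"
  by (cases n) auto

lemma Blue_irrefl: "distinct (all_ports N) \<Longrightarrow> (x, x) \<notin> Blue N"
  by (induction N) (auto simp: Blue_Cons blue_irrefl, auto simp: Blue_def)

lemma trancl_image:
  assumes "(p, q) \<in> R\<^sup>+" "\<And>p q. (p, q) \<in> R \<Longrightarrow> (f p, f q) \<in> S"
  shows "(f p, f q) \<in> S\<^sup>+"
  using assms(1) by (induction rule: trancl_induct) (auto intro: assms(2) trancl_into_trancl)

text \<open>The numbers make every reduction decrease the sum: an active pair, of weight 4, turns
  into two relays of weight 1, and a sync node, of weight 0, may grow for free when it absorbs a
  binary node.\<close>

fun weight :: "'p node \<Rightarrow> nat" where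
  "weight (Relay r s) = 1"
| "weight (Bin k c a b) = 2"
| "weight (Sync js os) = 0"

lemma weight_map_node: "weight (map_node f n) = weight n"
  by (cases n) auto

context wiring begin

lemma net_no_cycle: "net N \<Longrightarrow> \<not> alt_cycle (Blue N) M xs"
  by (auto simp: net_def)

text \<open>Renaming \<open>M r\<close> to \<open>s\<close> in the neighbouring node attaches that
  node to the wire of \<open>s\<close> and bypasses the relay. The types agree, as \<open>s\<close>
  and \<open>M r\<close> both carry the dual of the type of \<open>r\<close>.\<close>

lemma contract_relay:
  assumes net: "net (Relay r s # N)"
  defines "f \<equiv> \<lambda>p. if p = M r then s else p"
  defines "N' \<equiv> map (map_node f) N"
  assumes acyc: "net N' \<Longrightarrow> acyclic (steps M (Pass N'))"
  shows "acyclic (steps M (Pass (Relay r s # N)))"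
proof -
  let ?u = "M r" and ?N = "Relay r s # N"
  have ports: "r \<noteq> s" "r \<notin> set (all_ports N)" "s \<notin> set (all_ports N)" "distinct (all_ports N)"
    using net by (auto simp: net_def)
  \<comment> \<open>A relay wired to itself would be a cycle of length one.\<close>
  have us: "?u \<noteq> s"
  proof
    assume "?u = s"
    then have "M s = r" by (metis MM)
    then have "alt_cycle (Blue ?N) M [(r, s)]"
      using ports(1) by (simp add: alt_cycle_def alt_simps Blue_Cons)
    then show False using net_no_cycle net by blast
  qed
  have tyf: "ty (f p) = ty p" for p
    using net by (auto simp: net_def f_def)
  have fports: "f p \<notin> {r, ?u}" if "p \<in> set (all_ports N)" for p
    using that ports us M_neq[of r] by (auto simp: f_def)
  have BN: "Blue ?N = {(r, s), (s, r)} \<union> Blue N"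
    by (simp add: Blue_Cons)
  have BN': "Blue N' = map_prod f f ` Blue N"
    by (simp add: N'_def Blue_map_node)
  have off: "x \<notin> {r, ?u} \<and> y \<notin> {r, ?u}" if xy: "(x, y) \<in> Blue N'" for x y
  proof -
    obtain a b where ab: "(a, b) \<in> Blue N" "x = f a" "y = f b"
      using xy unfolding BN' by auto
    then show ?thesis
      using fports[OF Blue_ports[OF ab(1), THEN conjunct1]] fports[OF Blue_ports[OF ab(1), THEN conjunct2]]
      by (simp only: simp_thms)
  qed
  have at_r: "(x, r) \<in> Blue ?N \<Longrightarrow> x = s" "(r, x) \<in> Blue ?N \<Longrightarrow> x = s" for x
    using ports Blue_ports[of x r N] Blue_ports[of r x N] unfolding BN by auto
  have "net N'"
    unfolding net_def
  proof (intro conjI)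
    have "inj_on f (set (all_ports N))"
      using ports(3) by (auto simp: inj_on_def f_def)
    then show "distinct (all_ports N')"
      unfolding N'_def all_ports_map_node by (simp only: distinct_map ports(4) simp_thms)
    show "\<forall>n\<in>set N'. node_typed ty n"
      using net by (auto simp: net_def N'_def node_typed_map_node[where ty = ty, OF tyf])
    show "\<nexists>xs. alt_cycle (Blue N') M xs"
    proof (rule no_alt_cycle_contract[where B = "Blue ?N" and c = r, OF MM M_neq])
      show "\<nexists>xs. alt_cycle (Blue ?N) M xs" using net by (simp add: net_def)
    next
      fix x y assume "(x, y) \<in> Blue N'" then show "x \<notin> {r, ?u} \<and> y \<notin> {r, ?u}" by (rule off)
    next
      fix x y assume "(x, y) \<in> Blue N'" "(x, y) \<notin> Blue ?N"
      then obtain a b where ab: "(a, b) \<in> Blue N" "x = f a" "y = f b" and "(x, y) \<notin> Blue N"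
        unfolding BN' BN by auto
      then have "a = ?u \<or> b = ?u" by (auto simp: f_def split: if_splits)
      moreover have "a \<noteq> b" using ab(1) Blue_irrefl[OF ports(4)] by blast
      ultimately consider "a = ?u" "b \<noteq> ?u" | "b = ?u" "a \<noteq> ?u" by blast
      then show "\<exists>d\<in>{r, ?u}. (x, d) \<in> Blue ?N \<and> (M d, y) \<in> Blue ?N"
      proof cases
        case 1
        then have "(x, r) \<in> Blue ?N" "(M r, y) \<in> Blue ?N"
          using ab us unfolding BN by (auto simp: f_def)
        then show ?thesis by blast
      next
        case 2
        then have "(x, ?u) \<in> Blue ?N" "(M ?u, y) \<in> Blue ?N"
          using ab us unfolding BN by (auto simp: f_def)
        then show ?thesis by blast
      qed
    next
      fix x1 y1 x2 y2 d
      assume "d \<in> {r, ?u}" "(x1, d) \<in> Blue ?N" "(M d, y1) \<in> Blue ?N"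
        "(x2, M d) \<in> Blue ?N" "(d, y2) \<in> Blue ?N" "distinct [x1, y1, x2, y2]"
      \<comment> \<open>Only \<open>s\<close> is paired with \<open>r\<close>, so two opposite
        passages through the wire would use \<open>s\<close> twice.\<close>
      then have "x1 = s \<and> y2 = s \<or> y1 = s \<and> x2 = s"
        using at_r(1)[of x1] at_r(2)[of y2] at_r(2)[of y1] at_r(1)[of x2] by (elim insertE) simp_all
      then have False using \<open>distinct [x1, y1, x2, y2]\<close> by auto
      then show "(x2, y1) \<in> Blue ?N \<or> (x1, y2) \<in> Blue ?N" ..
    qed
  qed
  then have "acyclic (steps M (Pass N'))" by (rule acyc)
  moreover have fid: "f p = p" if "p \<noteq> ?u" for p using that by (simp add: f_def)
  have fu: "f ?u = s" by (simp add: f_def)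
  have passN: "Pass N (x, m) (y, m')" if "Pass ?N (x, m) (y, m')" "x \<noteq> r" "y \<noteq> r" for x m y m'
    using that by (auto simp: Pass_Cons)
  have pass_r: "Pass ?N (x, m) (r, m') \<Longrightarrow> x = s \<and> m = m'"
    "Pass ?N (r, m) (x, m') \<Longrightarrow> x = s \<and> m = m'" for x m m'
    using ports by (auto simp: Pass_Cons dest!: Pass_Blue Blue_ports)
  have pass': "Pass N' (f x, m) (f y, m')" if "Pass N (x, m) (y, m')" for x m y m'
    using Pass_map_node[OF that] by (simp add: N'_def)
  have inN: "x \<in> set (all_ports N) \<and> y \<in> set (all_ports N) \<and> x \<noteq> y" if "Pass N (x, m) (y, m')" for x m y m'
    using Blue_ports[OF Pass_Blue[OF that]] Blue_irrefl[OF ports(4)] Pass_Blue[OF that] by blast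
  show ?thesis
  proof (rule acyclic_steps_contract[where c = r, OF _ \<open>acyclic (steps M (Pass N'))\<close>])
    fix x m y m'
    assume a: "Pass ?N (x, m) (y, m')" "x \<notin> {r, ?u}" "y \<notin> {r, ?u}"
    then have "Pass N (x, m) (y, m')" using passN by blast
    from pass'[OF this] show "Pass N' (x, m) (y, m')" using a fid by simp
  next
    fix x m d m1 y m2
    assume a: "d \<in> {r, ?u}" "Pass ?N (x, m) (d, m1)" "Pass ?N (M d, m1) (y, m2)"
    then consider "d = r" | "d = ?u" by blast
    then show "x \<notin> {r, ?u} \<and> y \<notin> {r, ?u} \<and> Pass N' (x, m) (y, m2)"
    proof cases
      case 1
      then have x: "x = s" "m = m1" using a(2) pass_r by blast+
      have "y \<noteq> r"
      proof
        assume "y = r"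
        then have "?u = s" using a(3) 1 pass_r(1) by blast
        then show False using us by blast
      qed
      then have p: "Pass N (?u, m1) (y, m2)" using a(3) 1 passN M_neq[of r] by blast
      then show ?thesis using pass'[OF p] inN[OF p] fid[of y] fu x us ports(1,2) by auto
    next
      case 2
      then have y: "y = s" "m2 = m1" using a(3) pass_r(2)[of m1 y m2] by simp_all
      have "x \<noteq> r"
      proof
        assume "x = r"
        then have "?u = s" using a(2) 2 pass_r(2) by blast
        then show False using us by blast
      qed
      then have p: "Pass N (x, m) (?u, m1)" using a(2) 2 passN M_neq[of r] by blast
      then show ?thesis using pass'[OF p] inN[OF p] fid[of x] fu y us ports(1,2) by auto
    qed
  qed simp
qed

text \<open>No node owns \<open>M c\<close>, so a walk that leaves by \<open>c\<close> ends there
  and none arrives by it. Since tokens pass the node only from or to \<open>c\<close>, it takes part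
  in no dependency cycle.\<close>

lemma drop_bin:
  assumes net: "net (Bin k c a b # N)" and free: "M c \<notin> set (all_ports (Bin k c a b # N))"
    and acyc: "net N \<Longrightarrow> acyclic (steps M (Pass N))"
  shows "acyclic (steps M (Pass (Bin k c a b # N)))"
proof -
  let ?N = "Bin k c a b # N"
  have "alt_cycle (Blue N) M xs \<Longrightarrow> alt_cycle (Blue ?N) M xs" for xs
    by (rule alt_cycle_mono) (auto simp: alt_cycle_def alt_path_def Blue_Cons)
  then have "net N" using net by (auto simp: net_def)
  then have ac: "acyclic (steps M (Pass N))" by (rule acyc)
  have no: "\<not> Pass ?N (x, m) (M c, m')" "\<not> Pass ?N (M c, m) (x, m')" for x m m'
    using free Pass_Blue Blue_ports by metis+
  show ?thesis
  proof (rule acyclic_steps_contract[where c = c, OF _ ac])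
    fix x m y m' assume "Pass ?N (x, m) (y, m')" "x \<notin> {c, M c}" "y \<notin> {c, M c}"
    then show "Pass N (x, m) (y, m')" by (auto simp: Pass_Cons)
  next
    fix x m d m1 y m2 assume "d \<in> {c, M c}" "Pass ?N (x, m) (d, m1)" "Pass ?N (M d, m1) (y, m2)"
    then show "x \<notin> {c, M c} \<and> y \<notin> {c, M c} \<and> Pass N (x, m) (y, m2)" using no by auto
  qed simp
qed

text \<open>A side pushed at one node is popped at the other, so the dependencies between matching
  premisses survive as relays. For switching cycles, two opposite passages through the wire touch
  both premisses of the tensor, and the pair \<open>(a, b)\<close> or \<open>(b, a)\<close> is the
  required shortcut.\<close>

lemma reduce_active_pair:
  assumes net: "net (Bin True c a b # Bin False (M c) a' b' # N)"
  defines "N' \<equiv> Relay a a' # Relay b b' # N"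
  assumes acyc: "net N' \<Longrightarrow> acyclic (steps M (Pass N'))"
  shows "acyclic (steps M (Pass (Bin True c a b # Bin False (M c) a' b' # N)))"
proof -
  let ?N = "Bin True c a b # Bin False (M c) a' b' # N"
  let ?d = "M c"
  have dist: "distinct ([c, a, b, ?d, a', b'] @ all_ports N)"
    using net by (simp add: net_def)
  have BN: "Blue ?N = {(a, c), (c, a), (b, c), (c, b), (a, b), (b, a), (a', ?d), (?d, a'), (b', ?d), (?d, b')} \<union> Blue N"
    by (auto simp: Blue_Cons)
  have BN': "Blue N' = {(a, a'), (a', a), (b, b'), (b', b)} \<union> Blue N"
    by (auto simp: N'_def Blue_Cons)
  have off: "x \<notin> {c, ?d} \<and> y \<notin> {c, ?d}" if "(x, y) \<in> Blue N" for x y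
    using Blue_ports[OF that] dist by auto
  have at_c: "(x, c) \<in> Blue ?N \<Longrightarrow> x \<in> {a, b}" "(c, x) \<in> Blue ?N \<Longrightarrow> x \<in> {a, b}"
    "(x, ?d) \<in> Blue ?N \<Longrightarrow> x \<in> {a', b'}" "(?d, x) \<in> Blue ?N \<Longrightarrow> x \<in> {a', b'}" for x
    unfolding BN using dist off[of x c] off[of c x] off[of x ?d] off[of ?d x] by auto
  have "net N'"
    unfolding net_def
  proof (intro conjI)
    show "distinct (all_ports N')" using dist by (auto simp: N'_def)
    show "\<forall>n\<in>set N'. node_typed ty n" using net by (auto simp: net_def N'_def)
    show "\<nexists>xs. alt_cycle (Blue N') M xs"
    proof (rule no_alt_cycle_contract[where B = "Blue ?N" and c = c, OF MM M_neq])
      show "\<nexists>xs. alt_cycle (Blue ?N) M xs" using net by (simp add: net_def)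
    next
      fix x y assume "(x, y) \<in> Blue N'"
      then show "x \<notin> {c, ?d} \<and> y \<notin> {c, ?d}"
        using dist off[of x y] unfolding BN' by auto
    next
      fix x y assume "(x, y) \<in> Blue N'" "(x, y) \<notin> Blue ?N"
      then consider "x = a \<and> y = a' \<or> x = b \<and> y = b'" | "x = a' \<and> y = a \<or> x = b' \<and> y = b"
        unfolding BN BN' by auto
      then show "\<exists>d\<in>{c, ?d}. (x, d) \<in> Blue ?N \<and> (M d, y) \<in> Blue ?N"
      proof cases
        case 1
        then have "(x, c) \<in> Blue ?N \<and> (M c, y) \<in> Blue ?N" unfolding BN by auto
        then show ?thesis by blast
      next
        case 2
        then have "(x, ?d) \<in> Blue ?N \<and> (M ?d, y) \<in> Blue ?N" unfolding BN by auto
        then show ?thesis by blast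
      qed
    next
      fix x1 y1 x2 y2 d
      assume h: "d \<in> {c, ?d}" "(x1, y1) \<in> Blue N' - Blue ?N" "(x2, y2) \<in> Blue N' - Blue ?N"
        "(x1, d) \<in> Blue ?N" "(M d, y1) \<in> Blue ?N" "(x2, M d) \<in> Blue ?N" "(d, y2) \<in> Blue ?N"
        "distinct [x1, y1, x2, y2]"
      have ab: "(a, b) \<in> Blue ?N" "(b, a) \<in> Blue ?N" unfolding BN by auto
      from h(1) consider "d = c" | "d = ?d" by blast
      then show "(x2, y1) \<in> Blue ?N \<or> (x1, y2) \<in> Blue ?N"
      proof cases
        case 1
        then have "x1 \<in> {a, b}" "y2 \<in> {a, b}" using at_c(1)[of x1] at_c(2)[of y2] h(4,7) by simp_all
        moreover have "x1 \<noteq> y2" using h(8) by simp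
        ultimately show ?thesis using ab by blast
      next
        case 2
        then have "y1 \<in> {a, b}" "x2 \<in> {a, b}" using at_c(2)[of y1] at_c(1)[of x2] h(5,6) by simp_all
        moreover have "x2 \<noteq> y1" using h(8) by auto
        ultimately show ?thesis using ab by blast
      qed
    qed
  qed
  then have ac: "acyclic (steps M (Pass N'))" by (rule acyc)
  have offP: "x \<notin> {c, ?d} \<and> y \<notin> {c, ?d}" if "Pass N (x, m) (y, m')" for x m y m'
    using off[OF Pass_Blue[OF that]] .
  have noN: "\<not> Pass N (c, m) z" "\<not> Pass N z (c, m)" "\<not> Pass N (?d, m) z" "\<not> Pass N z (?d, m)" for m z
    using offP[of c m "fst z" "snd z"] offP[of "fst z" "snd z" c m] offP[of ?d m "fst z" "snd z"]
      offP[of "fst z" "snd z" ?d m] by auto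
  have neq: "c \<noteq> a" "c \<noteq> b" "c \<noteq> ?d" "c \<noteq> a'" "c \<noteq> b'" "?d \<noteq> a" "?d \<noteq> b" "?d \<noteq> c" "?d \<noteq> a'" "?d \<noteq> b'"
    using dist by auto
  \<comment> \<open>Relates an address on the wire to the premiss port that its first side
    selects.\<close>
  define via where "via m1 z u v \<longleftrightarrow>
    (\<exists>m. m1 = Lft # m \<and> z = (u, m) \<or> m1 = Rgt # m \<and> z = (v, m))"
    for m1 :: address and z :: "'p \<times> address" and u v :: 'p
  have c_in: "Pass ?N (c, m1) z \<Longrightarrow> via m1 z a b" "Pass ?N z (c, m1) \<Longrightarrow> via m1 z a b"
    and d_in: "Pass ?N (?d, m1) z \<Longrightarrow> via m1 z a' b'" "Pass ?N z (?d, m1) \<Longrightarrow> via m1 z a' b'" for m1 z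
    using neq neq[symmetric] noN by (auto simp: Pass_Cons via_def)
  show ?thesis
  proof (rule acyclic_steps_contract[where c = c, OF _ ac])
    fix x m y m' assume "Pass ?N (x, m) (y, m')" "x \<notin> {c, ?d}" "y \<notin> {c, ?d}"
    then show "Pass N' (x, m) (y, m')" by (auto simp: Pass_Cons N'_def)
  next
    fix x m d m1 y m2
    assume h: "d \<in> {c, ?d}" "Pass ?N (x, m) (d, m1)" "Pass ?N (M d, m1) (y, m2)"
    then consider "via m1 (x, m) a b" "via m1 (y, m2) a' b'"
      | "via m1 (x, m) a' b'" "via m1 (y, m2) a b"
      using c_in(2)[of "(x, m)" m1] d_in(1)[of m1 "(y, m2)"] d_in(2)[of "(x, m)" m1] c_in(1)[of m1 "(y, m2)"] MM[of c]
      by (elim insertE emptyE) simp_all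
    then have "x \<noteq> c \<and> x \<noteq> ?d \<and> y \<noteq> c \<and> y \<noteq> ?d \<and> Pass N' (x, m) (y, m2)"
      by cases (use neq in \<open>auto simp: via_def N'_def Pass_Cons\<close>)
    then show "x \<notin> {c, ?d} \<and> y \<notin> {c, ?d} \<and> Pass N' (x, m) (y, m2)" by simp
  qed simp
qed

text \<open>The premisses take the place of \<open>M c\<close> among the inputs or the outputs;
  losing the side costs nothing, as \<open>Sync\<close> ignores addresses. \<open>M c\<close> is
  only an input or only an output, so the wire is crossed in one sense and no shortcut is called
  for. Hence tensors and pars are treated alike.\<close>

lemma expand_sync:
  assumes net: "net (Bin k c a b # Sync js os # N)" and c: "M c \<in> set js \<union> set os"
  defines "expand \<equiv> \<lambda>ps. if M c \<in> set ps then a # b # removeAll (M c) ps else ps"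
  defines "N' \<equiv> Sync (expand js) (expand os) # N"
  assumes acyc: "net N' \<Longrightarrow> acyclic (steps M (Pass N'))"
  shows "acyclic (steps M (Pass (Bin k c a b # Sync js os # N)))"
proof -
  let ?N = "Bin k c a b # Sync js os # N" and ?d = "M c"
  have dist: "distinct ([c, a, b] @ js @ os @ all_ports N)"
    using net by (simp add: net_def)
  have BN: "Blue ?N = {(a, c), (c, a), (b, c), (c, b)} \<union> (if k then {(a, b), (b, a)} else {}) \<union> set js \<times> set os \<union> Blue N"
    by (auto simp: Blue_Cons)
  have BN': "Blue N' = set (expand js) \<times> set (expand os) \<union> Blue N"
    by (auto simp: N'_def Blue_Cons)
  have expand: "set (expand ps) = set ps - {?d} \<union> (if ?d \<in> set ps then {a, b} else {})" for ps
    by (auto simp: expand_def)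
  have off: "x \<notin> {c, ?d} \<and> y \<notin> {c, ?d}" if "(x, y) \<in> Blue N" for x y
    using Blue_ports[OF that] dist c by auto
  have fresh: "c \<notin> set js" "c \<notin> set os" "c \<noteq> ?d" "c \<noteq> a" "c \<noteq> b" "?d \<noteq> a" "?d \<noteq> b"
    and one: "?d \<notin> set js \<or> ?d \<notin> set os" using dist c by auto
  have at: "(x, c) \<in> Blue ?N \<Longrightarrow> x \<in> {a, b}" "(c, x) \<in> Blue ?N \<Longrightarrow> x \<in> {a, b}"
    "(x, ?d) \<in> Blue ?N \<Longrightarrow> x \<in> set js \<and> ?d \<in> set os" "(?d, x) \<in> Blue ?N \<Longrightarrow> x \<in> set os \<and> ?d \<in> set js" for x
    unfolding BN using fresh off[of x c] off[of c x] off[of x ?d] off[of ?d x] by (auto split: if_splits)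
  have "net N'"
    unfolding net_def
  proof (intro conjI)
    show "distinct (all_ports N')" using dist by (auto simp: N'_def expand_def distinct_removeAll)
    show "\<forall>n\<in>set N'. node_typed ty n" using net by (auto simp: net_def N'_def)
    show "\<nexists>xs. alt_cycle (Blue N') M xs"
    proof (rule no_alt_cycle_contract[where B = "Blue ?N" and c = c, OF MM M_neq])
      show "\<nexists>xs. alt_cycle (Blue ?N) M xs" using net by (simp add: net_def)
    next
      fix x y assume "(x, y) \<in> Blue N'"
      then show "x \<notin> {c, ?d} \<and> y \<notin> {c, ?d}"
        using fresh off[of x y] unfolding BN' expand by (auto split: if_splits)
    next
      fix x y assume "(x, y) \<in> Blue N'" "(x, y) \<notin> Blue ?N"
      then consider "?d \<in> set js" "x \<in> {a, b}" "y \<in> set os" | "?d \<in> set os" "x \<in> set js" "y \<in> {a, b}"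
        using one unfolding BN BN' expand by (auto split: if_splits)
      then show "\<exists>d\<in>{c, ?d}. (x, d) \<in> Blue ?N \<and> (M d, y) \<in> Blue ?N"
        by cases (auto simp: BN)
    next
      fix x1 y1 x2 y2 d
      assume "d \<in> {c, ?d}" "(x1, d) \<in> Blue ?N" "(M d, y1) \<in> Blue ?N" "(x2, M d) \<in> Blue ?N" "(d, y2) \<in> Blue ?N"
      then have "?d \<in> set js \<and> ?d \<in> set os"
        using at(3)[of x1] at(3)[of x2] at(4)[of y1] at(4)[of y2] by (elim insertE) simp_all
      then show "(x2, y1) \<in> Blue ?N \<or> (x1, y2) \<in> Blue ?N" using one by blast
    qed
  qed
  then have ac: "acyclic (steps M (Pass N'))" by (rule acyc)
  show ?thesis
  proof (rule acyclic_steps_contract[where c = c, OF _ ac])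
    fix x m y m' assume "Pass ?N (x, m) (y, m')" "x \<notin> {c, ?d}" "y \<notin> {c, ?d}"
    then show "Pass N' (x, m) (y, m')" by (auto simp: Pass_Cons N'_def expand)
  next
    fix x m d m1 y m2
    assume h: "d \<in> {c, ?d}" "Pass ?N (x, m) (d, m1)" "Pass ?N (M d, m1) (y, m2)"
    have "x \<in> {a, b} \<and> y \<in> set os \<and> ?d \<in> set js \<or> x \<in> set js \<and> ?d \<in> set os \<and> y \<in> {a, b}"
      using h(1) at(1,3)[of x] at(2,4)[of y] Pass_Blue[OF h(2)] Pass_Blue[OF h(3)] by (elim insertE) simp_all
    then show "x \<notin> {c, ?d} \<and> y \<notin> {c, ?d} \<and> Pass N' (x, m) (y, m2)"
      using fresh one by (auto simp: N'_def Pass_Cons expand)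
  qed simp
qed

text \<open>With addresses forgotten, a dependency cycle is a closed walk on ports. It arrives at
  inputs and departs from outputs of sync nodes, which are disjoint sets of ports, so it yields an
  alternating cycle.\<close>

lemma acyclic_if_syncs:
  assumes net: "net N" and syncs: "\<And>n. n \<in> set N \<Longrightarrow> \<exists>js os. n = Sync js os"
  shows "acyclic (steps M (Pass N))"
proof (rule ccontr)
  assume "\<not> ?thesis"
  then obtain p where "(p, p) \<in> (steps M (Pass N))\<^sup>+" unfolding acyclic_def by blast
  then have cyc: "(fst p, fst p) \<in> {(x, M y) | x y. (x, y) \<in> Blue N}\<^sup>+"
  proof (rule trancl_image[where f = fst])
    fix p q assume "(p, q) \<in> steps M (Pass N)"
    then obtain y m where "q = (M y, m)" "Pass N p (y, m)" unfolding steps_def by blast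
    then show "(fst p, fst q) \<in> {(x, M y) | x y. (x, y) \<in> Blue N}"
      using Pass_Blue[of N "fst p" "snd p" y m] by auto
  qed
  have disj: "fst ` Blue N \<inter> snd ` Blue N = {}"
  proof -
    have "distinct (all_ports N)" using net by (simp add: net_def)
    then show ?thesis using syncs
    proof (induction N)
      case (Cons n N)
      obtain js os where n: "n = Sync js os" using Cons.prems(2)[of n] by auto
      have IH: "fst ` Blue N \<inter> snd ` Blue N = {}" using Cons by auto
      have "x \<in> set (all_ports N)" if "x \<in> fst ` Blue N \<or> x \<in> snd ` Blue N" for x
        using that Blue_ports by fastforce
      then have in_ports: "fst ` Blue N \<union> snd ` Blue N \<subseteq> set (all_ports N)" by blast
      have fresh: "(set js \<union> set os) \<inter> set (all_ports N) = {}" "set js \<inter> set os = {}"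
        using Cons.prems(1) n by auto
      have grow: "fst ` Blue (n # N) \<subseteq> set js \<union> fst ` Blue N" "snd ` Blue (n # N) \<subseteq> set os \<union> snd ` Blue N"
        unfolding Blue_Cons n by auto
      have "A \<inter> B = {}" if "F \<union> S \<subseteq> P" "(J \<union> L) \<inter> P = {}" "J \<inter> L = {}" "A \<subseteq> J \<union> F" "B \<subseteq> L \<union> S" "F \<inter> S = {}"
        for A B F S J L P :: "'p set" using that by blast
      from this[OF in_ports fresh grow IH] show ?case .
    qed (simp add: Blue_def)
  qed
  show False
    using alt_cycle_if_cyclic[OF MM cyc disj] net by (simp add: net_def)
qed

lemma split_node:
  assumes "n \<in> set N" "net N" "\<And>N'. mset N = mset (n # N') \<Longrightarrow> net (n # N') \<Longrightarrow> acyclic (steps M (Pass (n # N')))"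
  shows "acyclic (steps M (Pass N))"
proof -
  have "mset N = mset (n # remove1 n N)" using assms(1) by simp
  then show ?thesis using assms(3) net_perm[OF _ assms(2)] Pass_perm by metis
qed

text \<open>Relays are contracted before anything else, so that the conclusion of a binary node is
  wired to a free end, another binary node or a sync node; one reduction is available for each
  case.\<close>

theorem acyclic_steps_net: "net N \<Longrightarrow> acyclic (steps M (Pass N))"
proof (induction "sum_list (map weight N)" arbitrary: N rule: less_induct)
  case less
  define W where "W N = sum_list (map weight N)" for N :: "'p node list"
  have Wm: "W N = W N'" if "mset N = mset N'" for N N' :: "'p node list"
    unfolding W_def by (simp only: sum_mset_sum_list[symmetric] mset_map that)
  have IH: "acyclic (steps M (Pass N'))" if "net N'" "W N' < W N" for N'
    using less(1) that unfolding W_def by blast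
  show ?case
  proof (cases "\<exists>r s. Relay r s \<in> set N")
    case True
    then obtain r s where rs: "Relay r s \<in> set N" by blast
    show ?thesis
    proof (rule split_node[OF rs less(2)])
      fix N' assume N': "mset N = mset (Relay r s # N')" "net (Relay r s # N')"
      show "acyclic (steps M (Pass (Relay r s # N')))"
        by (rule contract_relay[OF N'(2)], erule IH) (simp only: Wm[OF N'(1)], simp add: W_def comp_def weight_map_node)
    qed
  next
    case norelay: False
    show ?thesis
    proof (cases "\<exists>k c a b. Bin k c a b \<in> set N")
      case False
      have "\<exists>js os. n = Sync js os" if "n \<in> set N" for n
        by (cases n) (use that False norelay in blast)+
      then show ?thesis by (rule acyclic_if_syncs[OF less(2)])
    next
      case True
      \<comment> \<open>\<open>P\<close> marks the conclusions of binary nodes. One of maximal size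
        is never wired to a premiss: the types at the two ends of a wire have equal size, and a
        premiss is smaller than the conclusion of its node, hence smaller than the maximum.\<close>
      define P where "P p \<longleftrightarrow> (\<exists>k a b. Bin k p a b \<in> set N)" for p
      have "finite {p. P p}"
        by (rule finite_subset[of _ "set (all_ports N)"]) (force simp: P_def)+
      then have fin: "finite ((\<lambda>p. size (ty p)) ` {p. P p})" by (rule finite_imageI)
      moreover have "(\<lambda>p. size (ty p)) ` {p. P p} \<noteq> {}" using True by (auto simp: P_def)
      ultimately have "Max ((\<lambda>p. size (ty p)) ` {p. P p}) \<in> (\<lambda>p. size (ty p)) ` {p. P p}" by (rule Max_in)
      then obtain c where c1: "P c" "Max ((\<lambda>p. size (ty p)) ` {p. P p}) = size (ty c)" by blast
      have c: "P c" "\<And>p. P p \<Longrightarrow> size (ty p) \<le> size (ty c)"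
        using c1 Max_ge[OF fin] by auto
      obtain k a b where n: "Bin k c a b \<in> set N" using c(1) by (auto simp: P_def)
      show ?thesis
      proof (rule split_node[OF n less(2)])
        fix N1 assume N1: "mset N = mset (Bin k c a b # N1)" "net (Bin k c a b # N1)"
        have setN: "set N = set (Bin k c a b # N1)" using N1(1) by (rule mset_eq_setD)
        have typed: "node_typed ty n" if "n \<in> set N" for n using less(2) that by (simp add: net_def)
        have big: "size (ty p) < size (ty c')" if "Bin k' c' p q \<in> set N \<or> Bin k' c' q p \<in> set N" for k' c' p q
          using that typed[of "Bin k' c' p q"] typed[of "Bin k' c' q p"] by (auto split: if_splits)
        have szM: "size (ty (M c)) = size (ty c)" by simp
        show "acyclic (steps M (Pass (Bin k c a b # N1)))"
        proof (cases "M c \<in> set (all_ports N1)")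
          case False
          have "M c \<noteq> c" "M c \<noteq> a" "M c \<noteq> b" using M_neq big[of k c a b] big[of k c b a] n szM by auto
          then have "M c \<notin> set (all_ports (Bin k c a b # N1))" using False by simp
          then show ?thesis
            by (rule drop_bin[OF N1(2)], elim IH) (simp only: Wm[OF N1(1)], simp add: W_def)
        next
          case True
          then obtain n2 where n2: "n2 \<in> set N1" "M c \<in> set (ports n2)" by auto
          define N2 where "N2 = remove1 n2 N1"
          have m2: "mset (Bin k c a b # N1) = mset (Bin k c a b # n2 # N2)"
            using n2(1) by (simp add: N2_def)
          have net2: "net (Bin k c a b # n2 # N2)" by (rule net_perm[OF m2 N1(2)])
          have WN: "W N = W (Bin k c a b # n2 # N2)" using Wm N1(1) m2 by metis
          have inN: "n2 \<in> set N" using n2(1) setN by simp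
          have "acyclic (steps M (Pass (Bin k c a b # n2 # N2)))"
          proof (cases n2)
            case (Relay r s)
            then show ?thesis using norelay inN by blast
          next
            case (Bin k' c' a' b')
            have "size (ty c') \<le> size (ty c)" using c(2) inN Bin by (auto simp: P_def)
            then have "M c \<noteq> a'" "M c \<noteq> b'"
              using big[of k' c' a' b'] big[of k' c' b' a'] inN Bin szM by auto
            then have c': "c' = M c" using n2(2) Bin by auto
            have ty2: "ty (M c) = dual (ty c)" by simp
            \<comment> \<open>The types at the two ends are dual, so one node is a tensor and the
              other a par.\<close>
            have k': "k' = (\<not> k)"
              using typed[OF n] typed[OF inN] ty2 unfolding Bin c' by (cases k; cases k') auto
            show ?thesis
            proof (cases k)
              case True
              have nn: "Bin k c a b # n2 # N2 = Bin True c a b # Bin False (M c) a' b' # N2"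
                using True k' Bin c' by simp
              show ?thesis
                unfolding nn
                by (rule reduce_active_pair[OF net2[unfolded nn]], erule IH) (simp only: WN nn, simp add: W_def)
            next
              case False
              let ?N = "Bin True (M c) a' b' # Bin False (M (M c)) a b # N2"
              have m: "mset (Bin k c a b # n2 # N2) = mset ?N"
                using False k' Bin c' by simp
              have "acyclic (steps M (Pass ?N))"
                by (rule reduce_active_pair[OF net_perm[OF m net2]], erule IH) (simp only: WN Wm[OF m], simp add: W_def)
              then show ?thesis unfolding Pass_perm[OF m] .
            qed
          next
            case (Sync js os)
            then have "M c \<in> set js \<union> set os" using n2(2) by auto
            then show ?thesis
              unfolding Sync
              by (rule expand_sync[OF net2[unfolded Sync]], elim IH) (simp only: WN Sync, simp add: W_def)
          qed
          then show ?thesis unfolding Pass_perm[OF m2] .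
        qed
      qed
    qed
  qed
qed

end

section \<open>Switching paths as alternating cycles\<close>

lemma alt_cycle_next:
  assumes "alt_cycle B M xs" "p \<in> set xs"
  shows "\<exists>q\<in>set xs. M (snd p) = fst q"
proof -
  obtain zs where zs: "alt_cycle B M (p # zs)" "set xs = insert p (set zs)"
    using alt_cycle_rotate_to[OF assms] by metis
  show ?thesis
  proof (cases zs)
    case Nil
    then have "M (snd p) = fst p" using zs(1) by (simp add: alt_cycle_def)
    then show ?thesis using zs(2) by blast
  next
    case (Cons q ws)
    then have "M (snd p) = fst q" using zs(1) by (simp add: alt_cycle_def alt_path_Cons)
    then show ?thesis using zs(2) Cons by auto
  qed
qed

lemma alt_path_unique:
  assumes "alt_path B M xs" "p \<in> set xs" "q \<in> set xs" "z \<in> {fst p, snd p}" "z \<in> {fst q, snd q}"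
  shows "p = q"
proof (rule ccontr)
  assume neq: "p \<noteq> q"
  obtain us vs where xs: "xs = us @ p # vs" using assms(2) by (meson split_list)
  then have "q \<in> set us \<or> q \<in> set vs" using assms(3) neq by auto
  then have "z \<in> visited_ports us \<or> z \<in> visited_ports vs" using assms(5) by auto
  moreover have "visited_ports us \<inter> {fst p, snd p} = {}" "visited_ports vs \<inter> {fst p, snd p} = {}"
    using assms(1) unfolding xs alt_path_append alt_path_Cons by auto
  ultimately show False using assms(4) by (metis disjoint_iff)
qed

lemma alt_path_neq:
  assumes "alt_path B M xs" "p \<in> set xs"
  shows "fst p \<noteq> snd p"
proof -
  have "fst ` set xs \<inter> snd ` set xs = {}" using assms(1) by (simp add: alt_path_def)
  moreover have "fst p \<in> fst ` set xs" "snd p \<in> snd ` set xs" using assms(2) by simp_all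
  ultimately show ?thesis by (metis disjoint_iff)
qed

lemma alt_cycle_nth:
  assumes "alt_cycle B M xs" "i < length xs"
  shows "M (snd (xs ! i)) = fst ((xs @ [hd xs]) ! Suc i)"
proof (cases "Suc i < length xs")
  case True
  have "successively (\<lambda>p q. M (snd p) = fst q) xs"
    using assms(1) unfolding alt_cycle_def alt_path_def by blast
  then have "M (snd (xs ! i)) = fst (xs ! Suc i)"
    by (rule successively_nth[OF _ True])
  moreover have "(xs @ [hd xs]) ! Suc i = xs ! Suc i" using True by (simp add: nth_append)
  ultimately show ?thesis by (simp only:)
next
  case False
  then have i: "Suc i = length xs" using assms(2) by simp
  have "xs \<noteq> []" "M (snd (last xs)) = fst (hd xs)" using assms(1) unfolding alt_cycle_def by blast+
  moreover have "last xs = xs ! i" using last_conv_nth[OF \<open>xs \<noteq> []\<close>] unfolding i[symmetric] by simp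
  moreover have "(xs @ [hd xs]) ! Suc i = hd xs" unfolding i by (rule nth_append_length)
  ultimately show ?thesis by (simp only:)
qed

text \<open>An edge has two ends: \<open>(e, True)\<close> at the link it is a conclusion of, and \<open>(e, False)\<close> at the
  link (or box border) below it.\<close>

type_synonym 'e port = "'e \<times> bool"

definition flip :: "'e port \<Rightarrow> 'e port" where
  "flip p = (fst p, \<not> snd p)"

definition port_type :: "('e \<Rightarrow> 'x formula) \<Rightarrow> 'e port \<Rightarrow> 'x formula" where
  "port_type ty p = (if snd p then ty (fst p) else dual (ty (fst p)))"

lemma flip_simps [simp]: "flip (e, b) = (e, \<not> b)" "fst (flip p) = fst p" "flip (flip p) = p"
  by (auto simp: flip_def)

lemma flip_neq [simp]: "flip p \<noteq> p"
  by (cases p) auto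

lemma port_type_simps [simp]: "port_type ty (e, True) = ty e" "port_type ty (e, False) = dual (ty e)"
  by (auto simp: port_type_def)

interpretation wiring flip "port_type ty" for ty :: "'e \<Rightarrow> 'x formula"
  by unfold_locales (auto simp: port_type_def)

text \<open>Positive tokens go down and arrive at the lower end of the premiss; negative ones go up
  and arrive at the upper end of the conclusion. The polarity is read off the premiss, whose type
  the conclusion shares.\<close>

definition sync_ins :: "('e \<Rightarrow> 'x formula) \<Rightarrow> ('e \<times> 'e) list \<Rightarrow> 'e port list" where
  "sync_ins ty ps = map (\<lambda>(a, c). if positive (ty a) then (a, False) else (c, True)) ps"

definition sync_outs :: "('e \<Rightarrow> 'x formula) \<Rightarrow> ('e \<times> 'e) list \<Rightarrow> 'e port list" where
  "sync_outs ty ps = map (\<lambda>(a, c). if positive (ty a) then (c, True) else (a, False)) ps"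

text \<open>Unlocked boxes are opened; a locked box only lets its other conclusions depend on its lock.\<close>

fun flat :: "('e \<Rightarrow> bool) \<Rightarrow> ('e \<Rightarrow> 'x formula) \<Rightarrow> 'e link \<Rightarrow> 'e port node list" where
  "flat U ty (AxL a b) = [Relay (a, True) (b, True)]"
| "flat U ty (CutL a b) = [Relay (a, False) (b, False)]"
| "flat U ty (TensL a b c) = [Bin True (c, True) (a, False) (b, False)]"
| "flat U ty (ParL a b c) = [Bin False (c, True) (a, False) (b, False)]"
| "flat U ty (OneL e) = [Sync [] [(e, True)]]"
| "flat U ty (BotL e ds S) =
     (if U e then Sync [(e, True)] [] # map (\<lambda>(f, g). Relay (g, True) (f, False)) ds @ concat (map (flat U ty) S)
      else [Sync [(e, True)] (map (\<lambda>(f, g). (g, True)) ds)])"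
| "flat U ty (SyncL ps) = [Sync (sync_ins ty ps) (sync_outs ty ps)]"

abbreviation flats :: "('e \<Rightarrow> bool) \<Rightarrow> ('e \<Rightarrow> 'x formula) \<Rightarrow> 'e link list \<Rightarrow> 'e port node list" where
  "flats U ty S \<equiv> concat (map (flat U ty) S)"

text \<open>Seen from its own level, a box joins any two of its conclusions, as a switching path
  may. This contains what a locked box does in \<open>flat\<close>, and it supplies the pairs that
  replace excursions into an opened box.\<close>

fun level_blue :: "('e \<Rightarrow> 'x formula) \<Rightarrow> 'e link \<Rightarrow> ('e port \<times> 'e port) set" where
  "level_blue ty (BotL e ds S) =
     {((a, True), (b, True)) | a b. a \<in> set (e # map snd ds) \<and> b \<in> set (e # map snd ds) \<and> a \<noteq> b}"
| "level_blue ty l = Blue (flat (\<lambda>_. False) ty l)"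

definition link_ports :: "'e link \<Rightarrow> 'e port set" where
  "link_ports l = (\<lambda>e. (e, True)) ` set (concls l) \<union> (\<lambda>e. (e, False)) ` set (prems l)"

lemma link_ports_iff: "(e, b) \<in> link_ports l \<longleftrightarrow> (if b then e \<in> set (concls l) else e \<in> set (prems l))"
  by (auto simp: link_ports_def)

lemma sync_ports:
  "set (sync_ins ty ps) \<subseteq> link_ports (SyncL ps)" "set (sync_outs ty ps) \<subseteq> link_ports (SyncL ps)"
proof -
  have "a \<in> fst ` set ps \<and> c \<in> snd ` set ps" if "(a, c) \<in> set ps" for a c
    using that by (auto intro: rev_image_eqI)
  then show "set (sync_ins ty ps) \<subseteq> link_ports (SyncL ps)" "set (sync_outs ty ps) \<subseteq> link_ports (SyncL ps)"
    unfolding sync_ins_def sync_outs_def by (auto simp: link_ports_iff)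
qed

lemma level_blue_ports:
  assumes "(x, y) \<in> level_blue ty l"
  shows "x \<in> link_ports l \<and> y \<in> link_ports l"
proof (cases l)
  case (SyncL ps)
  have "x \<in> set (sync_ins ty ps)" "y \<in> set (sync_outs ty ps)"
    using assms unfolding SyncL by (auto simp: Blue_def)
  then show ?thesis using sync_ports[where ty = ty and ps = ps] unfolding SyncL by blast
next
  case (BotL e ds S)
  then obtain a b where ab: "x = (a, True)" "y = (b, True)" "a \<in> set (concls l)" "b \<in> set (concls l)"
    using assms unfolding BotL level_blue.simps concls.simps by blast
  then show ?thesis unfolding ab(1,2) link_ports_iff by simp
qed (use assms in \<open>auto simp: link_ports_iff Blue_def\<close>)

lemma positive_not_negative: "positive A \<Longrightarrow> \<not> negative A"
  by (induction A) auto

text \<open>A shortest cycle crosses each sync link only once, so it is a switching path.\<close>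

lemma no_alt_cycle_level:
  fixes ty :: "'e \<Rightarrow> 'x formula"
  assumes acyc: "switching_acyclic ty S"
    and uniq: "\<And>l l' e. l \<in> set S \<Longrightarrow> l' \<in> set S \<Longrightarrow> e \<in> link_ports l \<Longrightarrow> e \<in> link_ports l' \<Longrightarrow> l = l'"
    and dist: "\<And>l. l \<in> set S \<Longrightarrow> distinct (prems l)"
    and typed: "\<And>l. l \<in> set S \<Longrightarrow> well_typed ty l"
  shows "\<not> (\<exists>xs. alt_cycle (\<Union>l\<in>set S. level_blue ty l) flip xs)"
proof
  let ?B = "\<Union>l\<in>set S. level_blue ty l"
  assume "\<exists>xs. alt_cycle ?B flip xs"
  then obtain xs where cyc: "alt_cycle ?B flip xs"
    and least: "\<And>ys. alt_cycle ?B flip ys \<Longrightarrow> length xs \<le> length ys"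
    using ex_has_least_nat[of "alt_cycle ?B flip" _ length] by blast
  have path: "alt_path ?B flip xs" and ne: "xs \<noteq> []" using cyc by (auto simp: alt_cycle_def)
  have sub: "set xs \<subseteq> ?B" using path by (rule alt_path_subset)
  define L where "L p = (SOME l. l \<in> set S \<and> p \<in> level_blue ty l)" for p
  have L: "L p \<in> set S \<and> p \<in> level_blue ty (L p)" if "p \<in> set xs" for p
  proof -
    have "\<exists>l. l \<in> set S \<and> p \<in> level_blue ty l" using sub that by blast
    then show ?thesis unfolding L_def by (rule someI_ex)
  qed
  have L_ports: "fst p \<in> link_ports (L p)" "snd p \<in> link_ports (L p)" if "p \<in> set xs" for p
    using level_blue_ports[of "fst p" "snd p"] L[OF that] by auto
  have L_eq: "L p = l" if "p \<in> set xs" "l \<in> set S" "z \<in> link_ports l" "z \<in> {fst p, snd p}" for p l z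
    using uniq[of "L p" l z] L[OF that(1)] L_ports[OF that(1)] that by auto
  \<comment> \<open>The cycle as a closed path: each pair contributes the edge by which it departs,
    and the first link is repeated at the end.\<close>
  define es where "es = map (fst \<circ> snd) xs"
  define vs where "vs = map L xs @ [L (hd xs)]"
  have vs: "vs = map L (xs @ [hd xs])" by (simp add: vs_def)
  have visited: "(e, b) \<in> visited_ports xs" if e: "e \<in> set es" for e b
  proof -
    obtain p where p: "p \<in> set xs" "fst (snd p) = e" using e unfolding es_def set_map comp_def by blast
    obtain q where q: "q \<in> set xs" "flip (snd p) = fst q" using alt_cycle_next[OF cyc p(1)] by blast
    have "(e, b) = snd p \<or> (e, b) = flip (snd p)" using p(2) by (cases "snd p") auto
    then show ?thesis using p(1) q by (metis Un_iff image_eqI)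
  qed
  have "path S vs es"
    unfolding path_def
  proof (intro conjI allI impI)
    show "length vs = Suc (length es)" by (simp add: vs_def es_def)
    show "set vs \<subseteq> set S" using L ne by (auto simp: vs_def)
    \<comment> \<open>A port is visited once. If an edge were left from both ends, the second
      departure would be the arrival that follows the first.\<close>
    show "distinct es"
      unfolding es_def distinct_map
    proof
      show "distinct xs" using path by (simp add: alt_path_def distinct_map)
      show "inj_on (fst \<circ> snd) (set xs)"
      proof (rule inj_onI, rule ccontr)
        fix p q assume pq: "p \<in> set xs" "q \<in> set xs" "(fst \<circ> snd) p = (fst \<circ> snd) q" "p \<noteq> q"
        obtain r where r: "r \<in> set xs" "flip (snd p) = fst r" using alt_cycle_next[OF cyc pq(1)] by blast
        have "snd q = snd p \<or> snd q = flip (snd p)"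
          using pq(3) by (cases "snd p"; cases "snd q") auto
        then show False
        proof
          assume "snd q = snd p"
          then show False using alt_path_unique[OF path pq(1,2), of "snd p"] pq(4) by simp
        next
          assume "snd q = flip (snd p)"
          then have "q = r" using alt_path_unique[OF path pq(2) r(1), of "snd q"] r(2) by simp
          then show False using alt_path_neq[OF path r(1)] r(2) \<open>snd q = flip (snd p)\<close> by simp
        qed
      qed
    qed
    fix i assume i: "i < length es"
    then have ix: "i < length xs" by (simp add: es_def)
    let ?p = "xs ! i" and ?q = "(xs @ [hd xs]) ! Suc i"
    have q: "?q \<in> set xs"
      using ix ne by (metis Suc_less_eq append_Nil2 hd_in_set length_append_singleton nth_append nth_mem in_set_conv_nth less_antisym nth_append_length)
    have v: "vs ! i = L ?p" "vs ! Suc i = L ?q"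
      using ix unfolding vs by (simp_all add: nth_append)
    obtain e b where eb: "snd ?p = (e, b)" by (cases "snd ?p")
    have "fst ?q = (e, \<not> b)" using alt_cycle_nth[OF cyc ix] eb by simp
    then have "(e, b) \<in> link_ports (L ?p)" "(e, \<not> b) \<in> link_ports (L ?q)"
      using L_ports(2)[of ?p] L_ports(1)[OF q] eb ix by auto
    moreover have "es ! i = e" using ix eb by (simp add: es_def)
    ultimately show "connects (es ! i) (vs ! i) (vs ! Suc i)"
      unfolding v connects_def link_ports_iff by (cases b) auto
  qed
  moreover have "\<not> (a \<in> set es \<and> b \<in> set es)" if l: "ParL a b c \<in> set S" for a b c
  proof
    assume ab: "a \<in> set es \<and> b \<in> set es"
    have "a \<noteq> b" using dist[OF l] by simp
    \<comment> \<open>At a par, a premiss is paired only with the conclusion. Two premisses would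
      both need the upper end of \<open>c\<close>, which is visited at most once.\<close>
    have "\<exists>p\<in>set xs. {fst p, snd p} = {(d, False), (c, True)}" if d: "d = a \<or> d = b" for d
    proof -
      have "(d, False) \<in> visited_ports xs" using visited ab d by blast
      then obtain p where p: "p \<in> set xs" "(d, False) \<in> {fst p, snd p}" by auto
      have "L p = ParL a b c"
        using L_eq[OF p(1) l _ p(2)] d by (auto simp: link_ports_iff)
      then have "p \<in> level_blue ty (ParL a b c)" using L[OF p(1)] by metis
      then have "{fst p, snd p} = {(d, False), (c, True)}"
        using p(2) d by (auto simp: Blue_def)
      then show ?thesis using p(1) by blast
    qed
    then obtain p q where pq: "p \<in> set xs" "{fst p, snd p} = {(a, False), (c, True)}"
      "q \<in> set xs" "{fst q, snd q} = {(b, False), (c, True)}" by metis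
    then have "p = q" using alt_path_unique[OF path pq(1,3), of "(c, True)"] by simp
    then show False using pq(2,4) \<open>a \<noteq> b\<close> by (simp add: doubleton_eq_iff)
  qed
  moreover have "card (sync_out_edges ty ps \<inter> set es) \<le> 1" if l: "SyncL ps \<in> set S" for ps
  proof -
    have ps: "ty c = ty a" "positive (ty a) \<or> negative (ty a)" if "(a, c) \<in> set ps" for a c
      using typed[OF l] that by auto
    \<comment> \<open>At the link, the port of an out-edge is an output and not an input, so the
      cycle meets it only as a departure.\<close>
    have outs: "\<exists>p\<in>set xs. fst (snd p) = d \<and> p \<in> set (sync_ins ty ps) \<times> set (sync_outs ty ps)"
      if d: "d \<in> sync_out_edges ty ps" "d \<in> set es" for d
    proof -
      obtain b where b: "(d, b) \<in> set (sync_outs ty ps)" "(d, b) \<notin> set (sync_ins ty ps)" "(d, b) \<in> link_ports (SyncL ps)"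
      proof -
        from d(1) consider a where "(a, d) \<in> set ps" "positive (ty d)" | c where "(d, c) \<in> set ps" "negative (ty d)"
          by (auto simp: sync_out_edges_def)
        then show ?thesis
        proof cases
          case 1
          have "(d, True) \<in> set (sync_outs ty ps)"
            using 1 ps[OF 1(1)] unfolding sync_outs_def by force
          moreover have "(d, True) \<notin> set (sync_ins ty ps)"
            using 1(2) ps unfolding sync_ins_def by (auto split: if_splits)
          moreover have "(d, True) \<in> link_ports (SyncL ps)"
            using 1(1) by (force simp: link_ports_iff)
          ultimately show ?thesis by (rule that)
        next
          case 2
          then have np: "\<not> positive (ty d)" using positive_not_negative by blast
          have "(d, False) \<in> set (sync_outs ty ps)"
            using 2(1) np unfolding sync_outs_def by force
          moreover have "(d, False) \<notin> set (sync_ins ty ps)"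
            using np unfolding sync_ins_def by (auto split: if_splits)
          moreover have "(d, False) \<in> link_ports (SyncL ps)"
            using 2(1) by (force simp: link_ports_iff)
          ultimately show ?thesis by (rule that)
        qed
      qed
      have "(d, b) \<in> visited_ports xs" using visited d(2) by blast
      then obtain p where p: "p \<in> set xs" "(d, b) \<in> {fst p, snd p}" by auto
      have "L p = SyncL ps" by (rule L_eq[OF p(1) l b(3) p(2)])
      then have "p \<in> level_blue ty (SyncL ps)" using L[OF p(1)] by metis
      then have pp: "p \<in> set (sync_ins ty ps) \<times> set (sync_outs ty ps)" by (simp add: Blue_def)
      then have "snd p = (d, b)" using p(2) b(2) by auto
      then show ?thesis using p(1) pp by (intro bexI[of _ p]) simp_all
    qed
    have "d1 = d2" if d1: "d1 \<in> sync_out_edges ty ps \<inter> set es" and d2: "d2 \<in> sync_out_edges ty ps \<inter> set es" for d1 d2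
    proof (rule ccontr)
      assume "d1 \<noteq> d2"
      obtain p where p: "p \<in> set xs" "fst (snd p) = d1" "p \<in> set (sync_ins ty ps) \<times> set (sync_outs ty ps)"
        using outs[of d1] d1 by blast
      obtain q where q: "q \<in> set xs" "fst (snd q) = d2" "q \<in> set (sync_ins ty ps) \<times> set (sync_outs ty ps)"
        using outs[of d2] d2 by blast
      obtain zs where zs: "alt_cycle ?B flip (p # zs)" "length xs = Suc (length zs)" "set xs = insert p (set zs)"
        using alt_cycle_rotate_to[OF cyc p(1)] by metis
      have "q \<in> set zs" using q(1,2) p(2) zs(3) \<open>d1 \<noteq> d2\<close> by auto
      then obtain us ws where sp: "zs = us @ q # ws" by (meson split_list)
      \<comment> \<open>Given two crossings of the link, arriving as \<open>q\<close> and departing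
        as \<open>p\<close> closes the segment between them, which is shorter than the shortest
        cycle.\<close>
      have "(fst q, snd p) \<in> level_blue ty (SyncL ps)" using p(3) q(3) by (auto simp: Blue_def)
      then have "(fst q, snd p) \<in> ?B" using l by blast
      moreover have "alt_path ?B flip ((p # us) @ q # ws)" using zs(1) sp by (simp add: alt_cycle_def)
      then have "alt_path ?B flip (p # us)" "flip (snd (last (p # us))) = fst q"
        "visited_ports (p # us) \<inter> visited_ports (q # ws) = {}"
        unfolding alt_path_append by simp_all
      then have "alt_path ?B flip us" "us = [] \<or> flip (snd p) = fst (hd us)" "snd p \<notin> visited_ports us"
        "fst q \<notin> visited_ports us" "fst q \<noteq> snd p" "us \<noteq> [] \<or> flip (snd p) = fst q" "us = [] \<or> flip (snd (last us)) = fst q"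
        unfolding alt_path_Cons by auto
      ultimately have "alt_cycle ?B flip ((fst q, snd p) # us)"
        by (cases "us = []") (simp_all add: alt_cycle_def alt_path_Cons)
      then have "length xs \<le> Suc (length us)" using least by fastforce
      then show False using zs(2) sp by simp
    qed
    then show ?thesis by (simp add: card_le_Suc0_iff_eq)
  qed
  ultimately have "switching_path ty S vs es" unfolding switching_path_def by blast
  moreover have "es \<noteq> []" "hd vs = last vs" using ne by (auto simp: es_def vs_def hd_map)
  ultimately show False using acyc unfolding switching_acyclic_def by blast
qed

section \<open>Opening boxes\<close>

lemma all_links_simps [simp]:
  "all_links [] = []"
  "all_links (l # S) = sub_links l @ all_links S"
  "all_links (S1 @ S2) = all_links S1 @ all_links S2"
  by (auto simp: all_links_def)

lemma sub_links_BotL [simp]: "sub_links (BotL e ds S) = BotL e ds S # all_links S"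
  by (simp add: all_links_def)

declare sub_links.simps(1) [simp del]

lemma set_all_links: "set (all_links S) = (\<Union>l\<in>set S. set (sub_links l))"
  by (simp add: all_links_def)

lemma self_sub_links: "l \<in> set (sub_links l)"
  by (cases l) auto

lemma in_all_links: "l \<in> set S \<Longrightarrow> l \<in> set (all_links S)"
  using self_sub_links by (auto simp: set_all_links)

lemma box_in_all_links:
  assumes "BotL e ds S \<in> set (all_links S0)"
  shows "set (all_links S) \<subseteq> set (all_links S0)"
  using assms
proof (induction "length (all_links S0)" arbitrary: S0 rule: less_induct)
  case less
  obtain l where l: "l \<in> set S0" "BotL e ds S \<in> set (sub_links l)"
    using less(2) by (auto simp: set_all_links)
  have sub: "set (sub_links l) \<subseteq> set (all_links S0)" using l(1) by (auto simp: set_all_links)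
  show ?case
  proof (cases l)
    case (BotL e' ds' S')
    show ?thesis
    proof (cases "BotL e ds S = l")
      case True
      then show ?thesis using sub BotL by auto
    next
      case False
      then have "BotL e ds S \<in> set (all_links S')" using l(2) BotL by auto
      moreover have "length (all_links S') < length (all_links S0)"
        using l(1) BotL by (auto dest!: split_list)
      ultimately have "set (all_links S) \<subseteq> set (all_links S')" using less(1) by blast
      then show ?thesis using sub BotL by auto
    qed
  qed (use l in auto)
qed

lemma levels_box: "BotL e ds S \<in> set (all_links S0) \<Longrightarrow> levels S \<subseteq> levels S0"
  using box_in_all_links[of e ds S S0] by (auto simp: levels_def)

abbreviation deep_edges :: "'e link list \<Rightarrow> 'e set" where
  "deep_edges S \<equiv> level_concls (all_links S)"

lemma level_concls_simps [simp]:
  "level_concls [] = {}"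
  "level_concls (l # S) = set (concls l) \<union> level_concls S"
  "level_concls (S1 @ S2) = level_concls S1 \<union> level_concls S2"
  by (auto simp: level_concls_def)

lemma level_prems_simps [simp]:
  "level_prems [] = {}"
  "level_prems (l # S) = set (prems l) \<union> level_prems S"
  "level_prems (S1 @ S2) = level_prems S1 \<union> level_prems S2"
  by (auto simp: level_prems_def)

lemma level_concls_deep: "level_concls S \<subseteq> deep_edges S"
  using in_all_links unfolding level_concls_def by fastforce

lemma set_concat_concls: "set (concat (map concls L)) = level_concls L"
  by (simp add: level_concls_def)

text \<open>The conditions on a structure, stated for a bare list of links so that they pass to the
  content of a box, which is not a record of its own.\<close>

definition structured :: "('e \<Rightarrow> 'x formula) \<Rightarrow> 'e link list \<Rightarrow> bool" where
  "structured ty S \<longleftrightarrow> distinct (concat (map concls (all_links S))) \<and>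
     distinct (concat (map prems (all_links S))) \<and>
     (\<forall>S'\<in>levels S. level_prems S' \<subseteq> level_concls S') \<and>
     (\<forall>l\<in>set (all_links S). well_typed ty l)"

lemma structured_box:
  assumes "structured ty S" "BotL e ds S' \<in> set S"
  shows "structured ty S'"
proof -
  have b: "BotL e ds S' \<in> set (all_links S)" using assms(2) by (rule in_all_links)
  obtain S1 S2 where "S = S1 @ BotL e ds S' # S2" using assms(2) by (meson split_list)
  then show ?thesis
    using assms(1) levels_box[OF b] box_in_all_links[OF b] unfolding structured_def by auto
qed

lemma structured_level:
  assumes "structured ty S"
  shows "level_prems S \<subseteq> level_concls S" "distinct (concat (map concls S))" "distinct (concat (map prems S))"
    "\<And>l. l \<in> set S \<Longrightarrow> well_typed ty l"
proof -
  show "level_prems S \<subseteq> level_concls S" using assms by (auto simp: structured_def levels_def)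
  have *: "distinct (concat (map f (all_links S))) \<Longrightarrow> distinct (concat (map f S))" for f :: "'a link \<Rightarrow> 'a list"
  proof (induction S)
    case (Cons l S)
    have "set (f l) \<subseteq> set (concat (map f (sub_links l)))" using self_sub_links[of l] by auto
    moreover have "distinct (f l)"
      using Cons.prems self_sub_links[of l] by (auto simp: distinct_concat_iff)
    moreover have "set (concat (map f S)) \<subseteq> set (concat (map f (all_links S)))"
      using in_all_links[of _ S] by auto
    ultimately show ?case using Cons by auto
  qed simp
  show "distinct (concat (map concls S))" "distinct (concat (map prems S))"
    using * assms by (auto simp: structured_def)
  show "well_typed ty l" if "l \<in> set S" for l using assms in_all_links[OF that] by (auto simp: structured_def)
qed

lemma structured_split:
  assumes st: "structured ty S" and S: "S = S1 @ BotL e ds S' # S2"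
  shows "level_concls S \<inter> deep_edges S' = {}" "deep_edges S1 \<inter> deep_edges S' = {}" "deep_edges S2 \<inter> deep_edges S' = {}"
proof -
  have d: "deep_edges S1 \<inter> deep_edges S' = {}" "set (concls (BotL e ds S')) \<inter> deep_edges S' = {}"
    "deep_edges S2 \<inter> deep_edges S' = {}"
    using st unfolding structured_def S by (auto simp: set_concat_concls[symmetric] simp del: set_concat_concls)
  then show "deep_edges S1 \<inter> deep_edges S' = {}" "deep_edges S2 \<inter> deep_edges S' = {}" by blast+
  show "level_concls S \<inter> deep_edges S' = {}"
    unfolding S using d level_concls_deep[of S1] level_concls_deep[of S2] by auto
qed

section \<open>Ports belonging to a link and its content\<close>

fun inner :: "'e link \<Rightarrow> 'e set" where
  "inner (BotL e ds S) = deep_edges S"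
| "inner l = {}"

text \<open>Bounds the ports that opening \<open>l\<close> can produce. Both ends of every edge in
  the box are included, also the lower end of a conclusion of the content, which the border relay
  uses.\<close>

definition zone :: "'e link \<Rightarrow> 'e port set" where
  "zone l = link_ports l \<union> {p. fst p \<in> inner l}"

lemma inner_deep:
  assumes "l \<in> set S"
  shows "inner l \<subseteq> deep_edges S"
proof (cases l)
  case (BotL e ds S')
  then have "set (all_links S') \<subseteq> set (all_links S)"
    using box_in_all_links[of e ds S' S] in_all_links[OF assms] by simp
  then show ?thesis using BotL by (auto simp: level_concls_def)
qed simp_all

lemma link_ports_level:
  assumes "l \<in> set S" "level_prems S \<subseteq> level_concls S" "p \<in> link_ports l"
  shows "fst p \<in> level_concls S"
proof -
  have "fst p \<in> level_prems S \<union> level_concls S"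
    using assms(1,3) by (auto simp: link_ports_def level_prems_def level_concls_def)
  then show ?thesis using assms(2) by blast
qed

lemma zone_deep:
  assumes "l \<in> set S" "level_prems S \<subseteq> level_concls S" "p \<in> zone l"
  shows "fst p \<in> deep_edges S"
proof -
  from assms(3) have "p \<in> link_ports l \<or> fst p \<in> inner l" by (simp add: zone_def)
  then show ?thesis
    using link_ports_level[OF assms(1,2)] inner_deep[OF assms(1)] level_concls_deep[of S] by blast
qed

lemma conclusionsD: "e \<in> conclusions S \<Longrightarrow> e \<in> level_concls S"
  by (simp add: conclusions_def)

lemma conclusions_deep: "e \<in> conclusions S \<Longrightarrow> e \<in> deep_edges S"
  by (rule level_concls_deep[THEN subsetD, OF conclusionsD])

lemma box_border:
  assumes "well_typed ty (BotL e ds S)" "(f, g) \<in> set ds"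
  shows "f \<in> conclusions S"
  using assms by (force simp: image_iff)

lemma box_border_deep:
  assumes "well_typed ty (BotL e ds S)" "(f, g) \<in> set ds"
  shows "f \<in> deep_edges S"
  by (rule conclusions_deep[OF box_border[OF assms]])

lemma snd_in_concls: "(f, g) \<in> set ds \<Longrightarrow> g \<in> set (concls (BotL e ds S))"
  by force

text \<open>The number of links, counted through all depths, is the measure for inductions on the
  nesting of boxes.\<close>

lemma links_less: "BotL e ds S' \<in> set S \<Longrightarrow> length (all_links S') < length (all_links S)"
  by (auto dest!: split_list)

lemma all_ports_flats: "all_ports (flats U ty S) = concat (map (\<lambda>l. all_ports (flat U ty l)) S)"
  by (induction S) auto

lemma flat_ports:
  "structured ty S \<Longrightarrow> l \<in> set S \<Longrightarrow> set (all_ports (flat U ty l)) \<subseteq> zone l"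
proof (induction "length (all_links S)" arbitrary: S l rule: less_induct)
  case less
  note st = less(2) and l = less(3)
  show ?case
  proof (cases l)
    case (BotL e ds S')
    have st': "structured ty S'" using structured_box[OF st] l BotL by blast
    have wt: "well_typed ty (BotL e ds S')" using structured_level(4)[OF st l] BotL by simp
    have IH: "p \<in> zone l" if p: "p \<in> set (all_ports (flats U ty S'))" for p
    proof -
      obtain l' where l': "l' \<in> set S'" "p \<in> set (all_ports (flat U ty l'))"
        using p unfolding all_ports_flats by auto
      have "p \<in> zone l'" using less(1)[OF links_less[OF l[unfolded BotL]] st' l'(1)] l'(2) by blast
      then have "fst p \<in> deep_edges S'" by (rule zone_deep[OF l'(1) structured_level(1)[OF st']])
      then show ?thesis by (simp add: zone_def BotL)
    qed
    have border: "(g, True) \<in> zone l \<and> (f, False) \<in> zone l" if "(f, g) \<in> set ds" for f g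
    proof
      have "g \<in> set (concls l)" unfolding BotL by (rule snd_in_concls[OF that])
      then show "(g, True) \<in> zone l" unfolding zone_def by (simp add: link_ports_iff)
      have "f \<in> deep_edges S'" by (rule box_border_deep[OF wt that])
      then show "(f, False) \<in> zone l" by (simp add: zone_def BotL)
    qed
    have lock: "(e, True) \<in> zone l" by (simp add: zone_def link_ports_iff BotL)
    show ?thesis
      unfolding BotL flat.simps using IH border lock unfolding BotL by (auto split: if_splits)
  next
    case (SyncL ps)
    then show ?thesis using sync_ports[where ty = ty and ps = ps] by (auto simp: zone_def)
  qed (auto simp: zone_def link_ports_iff)
qed

lemma flats_ports_deep:
  assumes "structured ty S" "p \<in> set (all_ports (flats U ty S))"
  shows "fst p \<in> deep_edges S"
proof -
  obtain l where l: "l \<in> set S" "p \<in> set (all_ports (flat U ty l))"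
    using assms(2) unfolding all_ports_flats by auto
  then have "p \<in> zone l" using flat_ports[OF assms(1) l(1)] by blast
  then show ?thesis by (rule zone_deep[OF l(1) structured_level(1)[OF assms(1)]])
qed

lemma inner_level:
  assumes "structured ty S" "l \<in> set S"
  shows "inner l \<inter> level_concls S = {}"
proof (cases l)
  case (BotL e ds S')
  obtain S1 S2 where "S = S1 @ BotL e ds S' # S2" using assms(2) BotL by (meson split_list)
  from structured_split(1)[OF assms(1) this] show ?thesis using BotL by auto
qed simp_all

lemma zone_disjoint:
  assumes st: "structured ty S" and S: "S = S1 @ l # S2" and l2: "l2 \<in> set S2"
  shows "zone l \<inter> zone l2 = {}"
proof -
  have lS: "l \<in> set S" "l2 \<in> set S" using S l2 by auto
  have "set (concls l) \<inter> set (concls l2) = {}" "set (prems l) \<inter> set (prems l2) = {}"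
    using structured_level(2,3)[OF st] l2 unfolding S by auto
  then have 1: "link_ports l \<inter> link_ports l2 = {}" by (auto simp: link_ports_def)
  have lev: "fst p \<in> level_concls S" if "p \<in> link_ports l \<or> p \<in> link_ports l2" for p
    using link_ports_level[OF _ structured_level(1)[OF st]] lS that by blast
  have "inner l \<inter> inner l2 = {}"
  proof (cases l)
    case (BotL e ds S')
    then show ?thesis using structured_split(3)[OF st, of S1 e ds S' S2] S inner_deep[OF l2] by auto
  qed simp_all
  then show ?thesis
    using 1 lev inner_level[OF st lS(1)] inner_level[OF st lS(2)] unfolding zone_def by blast
qed

lemma zone_unique:
  assumes st: "structured ty S" and l: "l \<in> set S" "l' \<in> set S" and p: "p \<in> zone l" "p \<in> zone l'"
  shows "l = l'"
proof (rule ccontr)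
  assume "l \<noteq> l'"
  obtain T1 T2 where T: "S = T1 @ l # T2" using l(1) by (meson split_list)
  then have "l' \<in> set T1 \<or> l' \<in> set T2" using l(2) \<open>l \<noteq> l'\<close> by auto
  then have "zone l \<inter> zone l' = {}"
  proof
    assume "l' \<in> set T1"
    then obtain T3 T4 where "T1 = T3 @ l' # T4" by (meson split_list)
    then have "zone l' \<inter> zone l = {}"
      using zone_disjoint[OF st, of T3 l' "T4 @ l # T2" l] T by simp
    then show ?thesis by blast
  qed (rule zone_disjoint[OF st T])
  then show False using p by blast
qed

text \<open>Polarity decides which port of a pair is the input, but inputs and outputs together are
  always the lower ends of the premisses and the upper ends of the conclusions. Distinctness of the
  ports thus follows from that of the edges.\<close>

lemma mset_sync_ports:
  "mset (sync_ins ty ps @ sync_outs ty ps) = mset (map (\<lambda>e. (e, False)) (map fst ps) @ map (\<lambda>e. (e, True)) (map snd ps))"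
  by (induction ps) (auto simp: sync_ins_def sync_outs_def)

lemma distinct_flats:
  "structured ty S \<Longrightarrow> distinct (all_ports (flats U ty S))"
proof (induction "length (all_links S)" arbitrary: S rule: less_induct)
  case less
  note st = less(2)
  have single: "distinct (all_ports (flat U ty l))" if l: "l \<in> set S" for l
  proof -
    have dc: "distinct (concls l)" and dp: "distinct (prems l)"
      using structured_level(2,3)[OF st] l by (auto simp: distinct_concat_iff)
    show ?thesis
    proof (cases l)
      case (BotL e ds S')
      have st': "structured ty S'" using structured_box[OF st] l BotL by blast
      have wt: "well_typed ty (BotL e ds S')" using structured_level(4)[OF st l] BotL by simp
      have IH: "distinct (all_ports (flats U ty S'))"
        by (rule less(1)[OF links_less[OF l[unfolded BotL]] st'])
      have out: "(h, True) \<notin> set (all_ports (flats U ty S'))" if "h \<in> set (concls l)" for h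
      proof
        assume "(h, True) \<in> set (all_ports (flats U ty S'))"
        then have "h \<in> deep_edges S'" using flats_ports_deep[OF st'] by fastforce
        moreover have "h \<in> level_concls S" using l that by (auto simp: level_concls_def)
        ultimately show False using inner_level[OF st l] BotL by auto
      qed
      \<comment> \<open>No link of the content has its conclusion \<open>f\<close> as a premiss, so
        the lower end of \<open>f\<close> is free for the border relay.\<close>
      have "(f, False) \<notin> set (all_ports (flats U ty S'))" if "(f, g) \<in> set ds" for f g
      proof
        assume "(f, False) \<in> set (all_ports (flats U ty S'))"
        then obtain l' where l': "l' \<in> set S'" "(f, False) \<in> set (all_ports (flat U ty l'))"
          unfolding all_ports_flats by auto
        have "(f, False) \<in> zone l'" using flat_ports[OF st' l'(1)] l'(2) by blast
        moreover have f: "f \<in> conclusions S'" using box_border[OF wt that] .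
        then have "f \<notin> inner l'" using inner_level[OF st' l'(1)] conclusionsD[OF f] by blast
        ultimately have "f \<in> set (prems l')" by (simp add: zone_def link_ports_iff)
        then have "f \<in> level_prems S'" using l'(1) by (auto simp: level_prems_def)
        then show False using f by (simp add: conclusions_def)
      qed
      moreover have "(g, True) \<notin> set (all_ports (flats U ty S'))" if "(f, g) \<in> set ds" for f g
        using out snd_in_concls[OF that] BotL by blast
      moreover have "(e, True) \<notin> set (all_ports (flats U ty S'))" by (rule out) (use BotL in simp)
      moreover have "distinct (concat (map (\<lambda>(f, g). [(g, True), (f, False)]) ds))"
        "(e, True) \<notin> set (concat (map (\<lambda>(f, g). [(g, True), (f, False)]) ds))"
        "distinct (map (\<lambda>(f, g). (g, True)) ds)"
      proof -
        have d: "distinct (map snd ds)" "distinct (map fst ds)" "e \<notin> set (map snd ds)"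
          using dc wt BotL by auto
        then show "distinct (concat (map (\<lambda>(f, g). [(g, True), (f, False)]) ds))"
          by (induction ds) force+
        show "(e, True) \<notin> set (concat (map (\<lambda>(f, g). [(g, True), (f, False)]) ds))"
          using d(3) by force
        show "distinct (map (\<lambda>(f, g). (g, True)) ds)" using d(1) by (induction ds) force+
      qed
      moreover have "(e, True) \<notin> set (map (\<lambda>(f, g). (g, True)) ds)" using dc BotL by force
      moreover have "all_ports (map (\<lambda>(f, g). Relay (g, True) (f, False)) ds) = concat (map (\<lambda>(f, g). [(g, True), (f, False)]) ds)"
        by (induction ds) auto
      ultimately show ?thesis using IH unfolding BotL by auto
    next
      case (SyncL ps)
      have "distinct (map (\<lambda>e. (e, False)) (map fst ps) @ map (\<lambda>e. (e, True)) (map snd ps))"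
        using dc dp SyncL by (auto simp: distinct_map inj_on_def)
      then have "distinct (sync_ins ty ps @ sync_outs ty ps)"
        using mset_eq_imp_distinct_iff[OF mset_sync_ports] by blast
      then show ?thesis using SyncL by simp
    qed (use dc dp in auto)
  qed
  have "distinct (all_ports (flats U ty S2))" if "S = S1 @ S2" for S1 S2
    using that
  proof (induction S2 arbitrary: S1)
    case (Cons l S2)
    have "set (all_ports (flat U ty l)) \<inter> set (all_ports (flat U ty l2)) = {}" if "l2 \<in> set S2" for l2
      using zone_disjoint[OF st Cons.prems that] flat_ports[OF st, of l U] flat_ports[OF st, of l2 U] Cons.prems that
      by (auto 0 3)
    then have "set (all_ports (flat U ty l)) \<inter> set (all_ports (flats U ty S2)) = {}"
      unfolding all_ports_flats by auto
    moreover have "distinct (all_ports (flat U ty l))" using single Cons.prems by simp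
    moreover have "distinct (all_ports (flats U ty S2))" by (rule Cons.IH[of "S1 @ [l]"]) (simp add: Cons.prems)
    ultimately show ?case by simp
  qed simp
  then show ?case by simp
qed

lemma flat_typed:
  "structured ty S \<Longrightarrow> n \<in> set (flats U ty S) \<Longrightarrow> node_typed (port_type ty) n"
proof (induction "length (all_links S)" arbitrary: S n rule: less_induct)
  case less
  note st = less(2)
  obtain l where l: "l \<in> set S" "n \<in> set (flat U ty l)" using less(3) by auto
  have wt: "well_typed ty l" using structured_level(4)[OF st l(1)] .
  show ?case
  proof (cases l)
    case (BotL e ds S')
    have st': "structured ty S'" using structured_box[OF st] l BotL by blast
    have less': "length (all_links S') < length (all_links S)" by (rule links_less[OF l(1)[unfolded BotL]])
    have IH: "node_typed (port_type ty) n" if "n \<in> set (flats U ty S')" for n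
      by (rule less(1)[OF less' st' that])
    show ?thesis using l(2) wt IH unfolding BotL by (auto split: if_splits)
  qed (use l wt in auto)
qed

text \<open>Two nested inductions: over the nesting of boxes, and over the links of one level, which
  pass one by one from the level view \<open>lb\<close> to the opened view. With no link opened, the
  claim is switching acyclicity of the level. Opening a box uses the replacement of excursions: a
  cycle gives one with the box still closed or one inside its content.\<close>

lemma no_alt_cycle_flats:
  "structured ty S \<Longrightarrow> \<forall>S'\<in>levels S. switching_acyclic ty S' \<Longrightarrow>
     \<not> (\<exists>xs. alt_cycle (Blue (flats U ty S)) flip xs)"
proof (induction "length (all_links S)" arbitrary: S rule: less_induct)
  case less
  note st = less(2) and acyc = less(3)
  define lb where "lb S = (\<Union>l\<in>set S. level_blue ty l)" for S
  have lev: "level_prems S \<subseteq> level_concls S" by (rule structured_level(1)[OF st])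
  have Blue_append: "Blue (N1 @ N2) = Blue N1 \<union> Blue N2" for N1 N2 :: "'a port node list"
    by (auto simp: Blue_def)
  have main: "\<not> (\<exists>xs. alt_cycle (Blue (flats U ty S1) \<union> lb S2) flip xs)" if "S = S1 @ S2" for S1 S2
    using that
  proof (induction S1 arbitrary: S2 rule: rev_induct)
    case Nil
    have "\<not> (\<exists>xs. alt_cycle (\<Union>l\<in>set S. level_blue ty l) flip xs)"
    proof (rule no_alt_cycle_level)
      show "switching_acyclic ty S" using acyc by (auto simp: levels_def)
      show "distinct (prems l)" if "l \<in> set S" for l
        using structured_level(3)[OF st] that by (auto simp: distinct_concat_iff)
      show "well_typed ty l" if "l \<in> set S" for l using structured_level(4)[OF st that] .
      fix l l' e assume l: "l \<in> set S" "l' \<in> set S" "e \<in> link_ports l" "e \<in> link_ports l'"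
      show "l = l'" by (rule zone_unique[OF st l(1,2), of e]) (simp_all add: zone_def l(3,4))
    qed
    then show ?case using Nil by (simp add: lb_def Blue_def)
  next
    case (snoc l S1)
    have IH: "\<not> (\<exists>xs. alt_cycle (Blue (flats U ty S1) \<union> lb (l # S2)) flip xs)"
      by (rule snoc.IH) (simp add: snoc.prems)
    have l: "l \<in> set S" using snoc.prems by simp
    have eq: "Blue (flats U ty (S1 @ [l])) \<union> lb S2 = Blue (flats U ty S1) \<union> Blue (flat U ty l) \<union> lb S2"
      by (simp add: Blue_append)
    have lbl: "lb (l # S2) = level_blue ty l \<union> lb S2" by (simp add: lb_def)
    \<comment> \<open>Opening adds pairs only at unlocked boxes; every other link falls under this
      case.\<close>
    have subset: ?case if "Blue (flat U ty l) \<subseteq> level_blue ty l"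
    proof
      assume "\<exists>xs. alt_cycle (Blue (flats U ty (S1 @ [l])) \<union> lb S2) flip xs"
      then obtain xs where xs: "alt_cycle (Blue (flats U ty (S1 @ [l])) \<union> lb S2) flip xs" by blast
      then have "set xs \<subseteq> Blue (flats U ty S1) \<union> Blue (flat U ty l) \<union> lb S2"
        unfolding eq alt_cycle_def alt_path_def by blast
      then have "set xs \<subseteq> Blue (flats U ty S1) \<union> lb (l # S2)" using that lbl by blast
      then show False using alt_cycle_mono[OF xs] IH by blast
    qed
    show ?case
    proof (cases l)
      case (BotL e ds S')
      have "distinct (concls l)" using structured_level(2)[OF st] l by (auto simp: distinct_concat_iff)
      then have dc: "e \<notin> set (map snd ds)" using BotL by simp
      show ?thesis
      proof (cases "U e")
        case False
        show ?thesis
          by (rule subset) (use False dc in \<open>force simp: BotL Blue_def\<close>)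
      next
        case True
        define I where "I = {p :: 'a port. fst p \<in> deep_edges S'}"
        define G where "G = (\<lambda>h. (h, True)) ` set (e # map snd ds)"
        \<comment> \<open>Opening the box takes \<open>level_blue ty l\<close> away; it is put back
          here, since its pairs on \<open>G\<close> are the replacements for excursions into
          \<open>I\<close>.\<close>
        define B where "B = Blue (flats U ty (S1 @ [l])) \<union> lb S2 \<union> level_blue ty l"
        have st': "structured ty S'" using structured_box[OF st] l BotL by blast
        have wt: "well_typed ty (BotL e ds S')" using structured_level(4)[OF st l] BotL by simp
        have Sl: "S = S1 @ BotL e ds S' # S2" using snoc.prems BotL by simp
        note split = structured_split[OF st Sl]
        have outer: "p \<notin> I" if "fst p \<in> level_concls S" for p using that split(1) by (auto simp: I_def)
        have S1out: "x \<notin> I \<and> y \<notin> I" if xy: "(x, y) \<in> Blue (flats U ty S1)" for x y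
        proof -
          have "p \<notin> I" if p: "p \<in> set (all_ports (flats U ty S1))" for p
          proof -
            obtain l1 where l1: "l1 \<in> set S1" "p \<in> set (all_ports (flat U ty l1))"
              using p unfolding all_ports_flats by auto
            have l1S: "l1 \<in> set S" using l1(1) Sl by simp
            have "p \<in> zone l1" using flat_ports[OF st l1S] l1(2) by blast
            moreover have "inner l1 \<subseteq> deep_edges S1" by (rule inner_deep[OF l1(1)])
            ultimately show ?thesis
              using link_ports_level[OF l1S lev] outer split(2) unfolding zone_def I_def by blast
          qed
          then show ?thesis using Blue_ports[OF xy] by blast
        qed
        have lbout: "x \<notin> I \<and> y \<notin> I" if "(x, y) \<in> lb S2 \<union> level_blue ty l" for x y
        proof -
          obtain l2 where "l2 \<in> set S" "(x, y) \<in> level_blue ty l2"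
            using \<open>(x, y) \<in> lb S2 \<union> level_blue ty l\<close> l Sl unfolding lb_def by auto
          then show ?thesis
            using level_blue_ports[of x y ty l2] link_ports_level[OF _ lev] outer by blast
        qed
        have Bl: "Blue (flat U ty l) = (\<Union>(f, g)\<in>set ds. {((g, True), (f, False)), ((f, False), (g, True))}) \<union> Blue (flats U ty S')"
          using True BotL by (auto simp: Blue_def)
        have border: "(g, True) \<in> G \<and> (g, True) \<notin> I \<and> (f, False) \<in> I" if fg: "(f, g) \<in> set ds" for f g
        proof -
          have g: "g \<in> set (e # map snd ds)" using snd_in_concls[OF fg] by simp
          then have "g \<in> level_concls S" using Sl by auto
          then have "(g, True) \<notin> I" using outer[of "(g, True)"] by simp
          moreover have "f \<in> deep_edges S'" by (rule box_border_deep[OF wt fg])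
          moreover have "(g, True) \<in> G" using g unfolding G_def by blast
          ultimately show ?thesis by (simp add: I_def)
        qed
        have inside: "x \<in> I \<and> y \<in> I" if "(x, y) \<in> Blue (flats U ty S')" for x y
          using Blue_ports[OF that, THEN conjunct1, THEN flats_ports_deep[OF st']]
            Blue_ports[OF that, THEN conjunct2, THEN flats_ports_deep[OF st']] by (simp only: I_def mem_Collect_eq)
        have Bcases: "(x, y) \<in> Blue (flats U ty S1) \<union> lb (l # S2) \<and> x \<notin> I \<and> y \<notin> I \<or>
            (x, y) \<in> Blue (flats U ty S') \<and> x \<in> I \<and> y \<in> I \<or>
            x \<in> G \<and> x \<notin> I \<and> y \<in> I \<or> y \<in> G \<and> x \<in> I \<and> y \<notin> I" if "(x, y) \<in> B" for x y
        proof -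
          have "(x, y) \<in> Blue (flats U ty S1) \<or> (x, y) \<in> Blue (flat U ty l) \<or> (x, y) \<in> lb S2 \<union> level_blue ty l"
            using that unfolding B_def eq by blast
          then show ?thesis
          proof (elim disjE)
            assume "(x, y) \<in> Blue (flat U ty l)"
            then consider f g where "(f, g) \<in> set ds" "x = (g, True)" "y = (f, False)"
              | f g where "(f, g) \<in> set ds" "y = (g, True)" "x = (f, False)" | "(x, y) \<in> Blue (flats U ty S')"
              unfolding Bl by blast
            then show ?thesis using border inside by cases blast+
          next
            assume "(x, y) \<in> Blue (flats U ty S1)"
            then show ?thesis using S1out by blast
          next
            assume "(x, y) \<in> lb S2 \<union> level_blue ty l"
            then show ?thesis using lbout lbl by blast
          qed
        qed
        show ?thesis
        proof
          assume "\<exists>xs. alt_cycle (Blue (flats U ty (S1 @ [l])) \<union> lb S2) flip xs"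
          then obtain xs where xs: "alt_cycle (Blue (flats U ty (S1 @ [l])) \<union> lb S2) flip xs" by blast
          then have "set xs \<subseteq> B" unfolding alt_cycle_def alt_path_def B_def by blast
          then have cyc: "alt_cycle B flip xs" using alt_cycle_mono[OF xs] by blast
          have "\<exists>ys. alt_cycle (Blue (flats U ty S1) \<union> lb (l # S2)) flip ys \<or> alt_cycle (Blue (flats U ty S')) flip ys"
          proof (rule alt_cycle_substitute[OF cyc, where I = I and G = G])
            show "flip p \<in> I \<longleftrightarrow> p \<in> I" for p by (simp add: I_def)
            show "(x, y) \<in> Blue (flats U ty S1) \<union> lb (l # S2)" if "(x, y) \<in> B" "x \<notin> I" "y \<notin> I" for x y
              using Bcases[OF that(1)] that by blast
            show "(x, y) \<in> Blue (flats U ty S')" if "(x, y) \<in> B" "x \<in> I" "y \<in> I" for x y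
              using Bcases[OF that(1)] that by blast
            show "x \<in> G" if "(x, y) \<in> B" "x \<notin> I" "y \<in> I" for x y
              using Bcases[OF that(1)] that by blast
            show "y \<in> G" if "(x, y) \<in> B" "x \<in> I" "y \<notin> I" for x y
              using Bcases[OF that(1)] that by blast
            show "(x, y) \<in> B \<inter> (Blue (flats U ty S1) \<union> lb (l # S2))" if "x \<in> G" "y \<in> G" "x \<noteq> y" for x y
            proof -
              have "(x, y) \<in> level_blue ty l" using that unfolding BotL G_def by auto
              then show ?thesis unfolding B_def lbl by blast
            qed
            have "set (e # map snd ds) \<subseteq> level_concls S" using Sl by auto
            then show "G \<inter> I = {}" using outer unfolding G_def by auto
          qed
          moreover have "levels S' \<subseteq> levels S" by (rule levels_box[OF in_all_links[OF l[unfolded BotL]]])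
          then have "\<forall>S''\<in>levels S'. switching_acyclic ty S''" using acyc by blast
          then have "\<not> (\<exists>xs. alt_cycle (Blue (flats U ty S')) flip xs)"
            by (rule less(1)[OF links_less[OF l[unfolded BotL]] st'])
          ultimately show False using IH by blast
        qed
      qed
    qed (rule subset, simp)+
  qed
  show ?case using main[of S "[]"] by (simp add: lb_def)
qed

theorem acyclic_flats:
  assumes "structured ty S" "\<forall>S'\<in>levels S. switching_acyclic ty S'"
  shows "acyclic (steps flip (Pass (flats U ty S)))"
proof -
  have "wiring.net flip (port_type ty) (flats U ty S)"
    unfolding wiring.net_def[OF wiring_axioms]
    using distinct_flats[OF assms(1)] flat_typed[OF assms(1)] no_alt_cycle_flats[OF assms] by blast
  then show ?thesis by (rule acyclic_steps_net)
qed

section \<open>Token flow\<close>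

locale token_flow =
  fixes st :: "'a \<Rightarrow> 'a \<Rightarrow> bool" and Src :: "'a set"
  assumes st_fun: "st p q \<Longrightarrow> st p q' \<Longrightarrow> q = q'"
    and st_inj: "st p q \<Longrightarrow> st p' q \<Longrightarrow> p = p'"
    and st_source: "t \<in> Src \<Longrightarrow> \<not> st p t"
begin

definition on_track :: "('a \<Rightarrow> 'a option) \<Rightarrow> bool" where
  "on_track T \<longleftrightarrow> dom T \<subseteq> Src \<and> (\<forall>t q. T t = Some q \<longrightarrow> st\<^sup>*\<^sup>* t q)"

text \<open>The stretch of each orbit from the start of a token to its present place. It is a
  function of the state alone: a token can only have come along its orbit.\<close>

definition visited :: "('a \<Rightarrow> 'a option) \<Rightarrow> 'a set" where
  "visited T = {p. \<exists>t q. T t = Some q \<and> st\<^sup>*\<^sup>* t p \<and> st\<^sup>*\<^sup>* p q}"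

lemma on_trackD:
  assumes "on_track T" "T t = Some q"
  shows "t \<in> Src" "st\<^sup>*\<^sup>* t q"
  using assms by (auto simp: on_track_def)

lemma into_source: "st\<^sup>*\<^sup>* p t \<Longrightarrow> t \<in> Src \<Longrightarrow> p = t"
  by (metis rtranclp.cases st_source)

text \<open>Backward steps are unique and end at a source, so an orbit contains no second
  one.\<close>

lemma same_source:
  assumes "st\<^sup>*\<^sup>* t p" "st\<^sup>*\<^sup>* t' p" "t \<in> Src" "t' \<in> Src"
  shows "t = t'"
  using assms(1,2)
proof (induction rule: rtranclp_induct)
  case base
  then show ?case using into_source assms(3) by blast
next
  case (step y z)
  from step(4) show ?case
  proof (cases rule: rtranclp.cases)
    case rtrancl_refl
    then show ?thesis using step(2) st_source assms(4) by blast
  next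
    case (rtrancl_into_rtrancl b)
    then show ?thesis using step st_inj by blast
  qed
qed

text \<open>The only predecessor of a point on a loop lies on the loop too, so a loop met by the
  orbit would contain its source, which has no predecessor.\<close>

lemma no_loop:
  assumes "st\<^sup>*\<^sup>* t p" "t \<in> Src"
  shows "\<not> st\<^sup>+\<^sup>+ p p"
  using assms(1)
proof (induction rule: rtranclp_induct)
  case base
  then show ?case using st_source assms(2) by (metis tranclp.cases)
next
  case (step y z)
  show ?case
  proof
    assume "st\<^sup>+\<^sup>+ z z"
    then obtain x where x: "st\<^sup>*\<^sup>* z x" "st x z" by (metis rtranclp.rtrancl_refl tranclp.cases tranclp_into_rtranclp)
    then have "x = y" using st_inj step(2) by blast
    then have "st\<^sup>+\<^sup>+ y y" using x step(2) by (meson rtranclp_into_tranclp2)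
    then show False using step(3) by blast
  qed
qed

lemma antisym_orbit:
  assumes "st\<^sup>*\<^sup>* t p" "t \<in> Src" "st\<^sup>*\<^sup>* p q" "st\<^sup>*\<^sup>* q p"
  shows "p = q"
proof (rule ccontr)
  assume "p \<noteq> q"
  then have "st\<^sup>+\<^sup>+ p q" using assms(3) by (metis rtranclpD)
  then have "st\<^sup>+\<^sup>+ p p" using assms(4) by (rule tranclp_rtranclp_tranclp)
  then show False using no_loop[OF assms(1,2)] by blast
qed

lemma ran_visited: "on_track T \<Longrightarrow> ran T \<subseteq> visited T"
  unfolding visited_def ran_def on_track_def by blast

lemma dom_visited: "on_track T \<Longrightarrow> dom T \<subseteq> visited T"
  unfolding visited_def dom_def on_track_def by blast

lemma source_visited:
  assumes "on_track T" "t \<in> Src" "t \<in> visited T"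
  shows "t \<in> dom T"
proof -
  obtain t' q where "T t' = Some q" "st\<^sup>*\<^sup>* t' t" using assms(3) by (auto simp: visited_def)
  then show ?thesis using into_source assms(2) by blast
qed

lemma visited_next:
  assumes "on_track T" "p \<in> visited T" "p \<notin> ran T"
  obtains q where "st p q" "q \<in> visited T"
proof -
  obtain t q where tq: "T t = Some q" "st\<^sup>*\<^sup>* t p" "st\<^sup>*\<^sup>* p q" using assms(2) by (auto simp: visited_def)
  have "p \<noteq> q" using assms(3) tq(1) by (auto simp: ran_def)
  then obtain r where r: "st p r" "st\<^sup>*\<^sup>* r q" using tq(3) by (metis converse_rtranclpE)
  then have "st\<^sup>*\<^sup>* t r" using tq(2) by (meson rtranclp.rtrancl_into_rtrancl)
  then have "r \<in> visited T" using tq(1) r(2) by (auto simp: visited_def)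
  then show ?thesis using that r(1) by blast
qed

text \<open>If \<open>q\<close> had been visited, then by the very token that stands at
  \<open>p\<close>, as no two orbits meet. Its present place \<open>p\<close> would lie beyond
  \<open>q\<close>, which closes a loop. This freshness is what makes moves and crossings enlarge
  the visited set.\<close>

lemma current_next_unvisited:
  assumes "on_track T" "p \<in> ran T" "st p q"
  shows "q \<notin> visited T"
proof
  assume "q \<in> visited T"
  then obtain t' q' where t': "T t' = Some q'" "st\<^sup>*\<^sup>* t' q" "st\<^sup>*\<^sup>* q q'" by (auto simp: visited_def)
  obtain t where t: "T t = Some p" using assms(2) by (auto simp: ran_def)
  have "st\<^sup>*\<^sup>* t p" by (rule on_trackD(2)[OF assms(1) t])
  then have tq: "st\<^sup>*\<^sup>* t q" using assms(3) by (meson rtranclp.rtrancl_into_rtrancl)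
  then have "t = t'" using same_source t'(2) on_trackD(1)[OF assms(1)] t t'(1) by blast
  then have "q' = p" using t t'(1) by simp
  then have "st\<^sup>+\<^sup>+ p p" using assms(3) t'(3) by (meson rtranclp_into_tranclp2)
  then show False using no_loop[OF \<open>st\<^sup>*\<^sup>* t p\<close>] on_trackD(1)[OF assms(1) t] by blast
qed

text \<open>The place of a token is the last visited position of its orbit: each state brings every
  token at least as far as the other does, and orbits have no loops.\<close>

lemma visited_inject:
  assumes "on_track T" "on_track T'" "visited T = visited T'"
  shows "T = T'"
proof -
  have *: "\<exists>q'. T2 t = Some q' \<and> st\<^sup>*\<^sup>* q q'"
    if T1: "on_track T1" "T1 t = Some q" and T2: "on_track T2" "visited T1 \<subseteq> visited T2" for T1 T2 t q
  proof -
    have "q \<in> visited T2" using ran_visited[OF T1(1)] T1(2) T2(2) by (auto simp: ran_def)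
    then obtain t' q' where t': "T2 t' = Some q'" "st\<^sup>*\<^sup>* t' q" "st\<^sup>*\<^sup>* q q'" by (auto simp: visited_def)
    have "t' = t" using same_source t'(2) on_trackD[OF T1] on_trackD(1)[OF T2(1) t'(1)] by blast
    then show ?thesis using t' by blast
  qed
  show ?thesis
  proof
    fix t
    show "T t = T' t"
    proof (cases "T t")
      case None
      have "T' t = None"
      proof (rule ccontr)
        assume "T' t \<noteq> None"
        then obtain q where "T' t = Some q" by blast
        from *[OF assms(2) this assms(1)] assms(3) None show False by simp
      qed
      then show ?thesis using None by simp
    next
      case (Some q)
      obtain q' where q': "T' t = Some q'" "st\<^sup>*\<^sup>* q q'" using *[OF assms(1) Some assms(2)] assms(3) by blast
      obtain q'' where "T t = Some q''" "st\<^sup>*\<^sup>* q' q''" using *[OF assms(2) q'(1) assms(1)] assms(3) by blast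
      then have "st\<^sup>*\<^sup>* q' q" using Some by simp
      then have "q = q'" using antisym_orbit on_trackD[OF assms(1) Some] q'(2) by blast
      then show ?thesis using Some q'(1) by simp
    qed
  qed
qed

text \<open>Any number of tokens may advance by one step each, which covers a single move and the
  crossing of a sync link at once.\<close>

lemma visited_advance:
  assumes T: "on_track T" and dom: "dom T' = dom T"
    and adv: "\<And>t p q. T t = Some p \<Longrightarrow> T' t = Some q \<Longrightarrow> q = p \<or> st p q"
  shows "on_track T'" "visited T' = visited T \<union> {q. \<exists>t p. T t = Some p \<and> T' t = Some q \<and> st p q}"
proof -
  let ?New = "{q. \<exists>t p. T t = Some p \<and> T' t = Some q \<and> st p q}"
  have adv': "\<exists>q. T' t = Some q \<and> st\<^sup>*\<^sup>* p q" if Tt: "T t = Some p" for t p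
  proof -
    have "t \<in> dom T'" using Tt dom by auto
    then obtain q where "T' t = Some q" by auto
    then show ?thesis using adv[OF Tt] by blast
  qed
  have behind: "\<exists>p. T t = Some p \<and> (q = p \<or> st p q)" if Tt: "T' t = Some q" for t q
  proof -
    have "t \<in> dom T" using Tt dom by auto
    then obtain p where "T t = Some p" by auto
    then show ?thesis using adv[OF _ Tt] by blast
  qed
  show "on_track T'"
    unfolding on_track_def
  proof (intro conjI allI impI)
    show "dom T' \<subseteq> Src" using T dom by (simp add: on_track_def)
    fix t q assume "T' t = Some q"
    then obtain p where p: "T t = Some p" "q = p \<or> st p q" using behind by blast
    have "st\<^sup>*\<^sup>* t p" by (rule on_trackD(2)[OF T p(1)])
    then show "st\<^sup>*\<^sup>* t q" using p(2) by (meson rtranclp.rtrancl_into_rtrancl)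
  qed
  show "visited T' = visited T \<union> ?New"
  proof
    show "visited T' \<subseteq> visited T \<union> ?New"
    proof
      fix x assume "x \<in> visited T'"
      then obtain t q where tq: "T' t = Some q" "st\<^sup>*\<^sup>* t x" "st\<^sup>*\<^sup>* x q" by (auto simp: visited_def)
      obtain p where p: "T t = Some p" "q = p \<or> st p q" using behind[OF tq(1)] by blast
      from tq(3) show "x \<in> visited T \<union> ?New"
      proof (cases rule: rtranclp.cases)
        case rtrancl_refl
        show ?thesis
        proof (cases "q = p")
          case True
          then show ?thesis using rtrancl_refl p(1) ran_visited[OF T] by (auto simp: ran_def)
        next
          case False
          then show ?thesis using rtrancl_refl p tq(1) by blast
        qed
      next
        case (rtrancl_into_rtrancl y)
        have "st\<^sup>*\<^sup>* x p"
          using p(2) tq(3) rtrancl_into_rtrancl st_inj by blast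
        then show ?thesis using p(1) tq(2) by (auto simp: visited_def)
      qed
    qed
    have "visited T \<subseteq> visited T'"
    proof
      fix x assume "x \<in> visited T"
      then obtain t p where tp: "T t = Some p" "st\<^sup>*\<^sup>* t x" "st\<^sup>*\<^sup>* x p" by (auto simp: visited_def)
      obtain q where "T' t = Some q" "st\<^sup>*\<^sup>* p q" using adv'[OF tp(1)] by blast
      then show "x \<in> visited T'" using tp unfolding visited_def by (blast intro: rtranclp_trans)
    qed
    moreover have "?New \<subseteq> visited T'"
      using ran_visited[OF \<open>on_track T'\<close>] by (auto simp: ran_def)
    ultimately show "visited T \<union> ?New \<subseteq> visited T'" by blast
  qed
qed

lemma visited_create:
  assumes T: "on_track T" and s: "s \<in> Src" "s \<notin> dom T"
  shows "on_track (T(s \<mapsto> s))" "visited (T(s \<mapsto> s)) = insert s (visited T)"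
proof -
  show "on_track (T(s \<mapsto> s))" using assms by (auto simp: on_track_def)
  show "visited (T(s \<mapsto> s)) = insert s (visited T)"
  proof
    show "visited (T(s \<mapsto> s)) \<subseteq> insert s (visited T)"
      unfolding visited_def using into_source[OF _ s(1)] by (auto split: if_splits)
    show "insert s (visited T) \<subseteq> visited (T(s \<mapsto> s))"
      unfolding visited_def using s(2) by (auto 4 4 split: if_splits)
  qed
qed

end

section \<open>Steps through links\<close>

lemma distinct_concat_unique:
  "distinct (concat (map f xs)) \<Longrightarrow> l \<in> set xs \<Longrightarrow> l' \<in> set xs \<Longrightarrow> e \<in> set (f l) \<Longrightarrow> e \<in> set (f l') \<Longrightarrow> l = l'"
  by (induction xs) auto

lemma box_inner:
  assumes "BotL e ds S \<in> set (sub_links l)"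
  shows "deep_edges S \<subseteq> inner l"
proof (cases l)
  case (BotL e' ds' S')
  then show ?thesis
    using assms box_in_all_links[of e ds S S'] by (auto simp: level_concls_def)
qed (use assms in auto)

lemma box_not_top:
  assumes st: "structured ty S0" and b: "BotL e ds S \<in> set (all_links S0)"
  shows "level_concls S0 \<inter> deep_edges S = {}"
proof -
  obtain l where l: "l \<in> set S0" "BotL e ds S \<in> set (sub_links l)" using b by (auto simp: set_all_links)
  then show ?thesis using box_inner[OF l(2)] inner_level[OF st l(1)] by blast
qed

text \<open>Both boxes lie in the one top-level link whose content has \<open>f\<close> at some
  depth, and the argument descends into it. If one box is that link itself and the other is nested
  deeper, they cannot share \<open>f\<close>, as a level has no edge in common with the boxes inside
  it.\<close>

lemma box_unique:
  assumes "structured ty S0" "BotL e ds S \<in> set (all_links S0)" "BotL e' ds' S' \<in> set (all_links S0)"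
    "f \<in> level_concls S" "f \<in> level_concls S'"
  shows "BotL e ds S = BotL e' ds' S'"
  using assms
proof (induction "length (all_links S0)" arbitrary: S0 rule: less_induct)
  case less
  note st = less(2)
  obtain l where l: "l \<in> set S0" "BotL e ds S \<in> set (sub_links l)" using less(3) by (auto simp: set_all_links)
  obtain l' where l': "l' \<in> set S0" "BotL e' ds' S' \<in> set (sub_links l')" using less(4) by (auto simp: set_all_links)
  have f: "f \<in> deep_edges S" "f \<in> deep_edges S'"
    by (rule subsetD[OF level_concls_deep less(5)], rule subsetD[OF level_concls_deep less(6)])
  have "f \<in> inner l" "f \<in> inner l'"
    by (rule subsetD[OF box_inner[OF l(2)] f(1)], rule subsetD[OF box_inner[OF l'(2)] f(2)])
  then have "l' = l" using zone_unique[OF st l'(1) l(1), of "(f, True)"] by (simp add: zone_def)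
  note l' = l'[unfolded this]
  show ?case
  proof (cases l)
    case (BotL e0 ds0 S1)
    have st1: "structured ty S1" using structured_box[OF st l(1)[unfolded BotL]] .
    have cases: "BotL e ds S = l \<or> BotL e ds S \<in> set (all_links S1)" "BotL e' ds' S' = l \<or> BotL e' ds' S' \<in> set (all_links S1)"
      using l(2) l'(2) BotL by auto
    have no: False if "BotL e1 ds1 S2 = l" "BotL e2 ds2 S3 \<in> set (all_links S1)" "f \<in> level_concls S2" "f \<in> deep_edges S3"
      for e1 ds1 S2 e2 ds2 S3
      using box_not_top[OF st1 that(2)] that BotL by auto
    show ?thesis
    proof (cases "BotL e ds S \<in> set (all_links S1) \<and> BotL e' ds' S' \<in> set (all_links S1)")
      case True
      then show ?thesis using less(1)[OF links_less[OF l(1)[unfolded BotL]] st1] less(5,6) by blast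
    next
      case False
      then show ?thesis using cases no less(5,6) f by metis
    qed
  qed (use l l' in auto)
qed

lemma link_level:
  "l \<in> set (all_links S0) \<Longrightarrow> \<exists>S\<in>levels S0. l \<in> set S"
proof (induction "length (all_links S0)" arbitrary: S0 rule: less_induct)
  case less
  obtain l0 where l0: "l0 \<in> set S0" "l \<in> set (sub_links l0)" using less(2) by (auto simp: set_all_links)
  show ?case
  proof (cases "l = l0")
    case True
    then show ?thesis using l0(1) by (auto simp: levels_def)
  next
    case False
    then obtain e ds S1 where b: "l0 = BotL e ds S1" using l0(2) by (cases l0) auto
    then have "l \<in> set (all_links S1)" using l0(2) False by simp
    then obtain S where "S \<in> levels S1" "l \<in> set S" using less(1)[OF links_less[OF l0(1)[unfolded b]]] by blast
    then show ?thesis using levels_box[OF in_all_links[OF l0(1)[unfolded b]]] by blast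
  qed
qed

lemma level_unique:
  assumes st: "structured ty S0" and S: "S \<in> levels S0" "S' \<in> levels S0" and x: "x \<in> level_concls S" "x \<in> level_concls S'"
  shows "S = S'"
proof -
  have no: "x \<notin> level_concls S1" if "BotL e ds S1 \<in> set (all_links S0)" "x \<in> level_concls S0" for e ds S1
    using box_not_top[OF st that(1)] that(2) level_concls_deep[of S1] by blast
  have level: "T = S0 \<or> (\<exists>e ds. BotL e ds T \<in> set (all_links S0))" if "T \<in> levels S0" for T
    using that by (auto simp: levels_def)
  from level[OF S(1)] level[OF S(2)] show ?thesis
  proof (elim disjE exE)
    fix e ds e' ds' assume "BotL e ds S \<in> set (all_links S0)" "BotL e' ds' S' \<in> set (all_links S0)"
    from box_unique[OF st this x] show ?thesis by simp
  qed (use no x in blast)+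
qed

lemma conclusion_not_premise:
  assumes st: "structured ty S0" and S: "S \<in> levels S0" "x \<in> conclusions S" and l: "l \<in> set (all_links S0)"
  shows "x \<notin> set (prems l)"
proof
  assume xl: "x \<in> set (prems l)"
  obtain S' where S': "S' \<in> levels S0" "l \<in> set S'" using link_level[OF l] by blast
  have xp: "x \<in> level_prems S'" using S'(2) xl by (auto simp: level_prems_def)
  then have "x \<in> level_concls S'" using st S'(1) by (auto simp: structured_def)
  then have "S = S'" by (rule level_unique[OF st S(1) S'(1) conclusionsD[OF S(2)]])
  then show False using xp S(2) by (simp add: conclusions_def)
qed

text \<open>The places where tokens pass a link; a box borders the conclusions of its content from below.\<close>

definition pass_ports :: "'e link \<Rightarrow> 'e port set" where
  "pass_ports l = link_ports l \<union> (case l of BotL e ds S \<Rightarrow> (\<lambda>(f, g). (f, False)) ` set ds | _ \<Rightarrow> {})"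

lemma top_port: "(x, True) \<in> pass_ports l \<Longrightarrow> x \<in> set (concls l)"
  by (auto simp: pass_ports_def link_ports_iff split: link.splits)

lemma bottom_port:
  assumes "well_typed ty l" "(x, False) \<in> pass_ports l"
  shows "x \<in> set (prems l) \<or> (\<exists>e ds S. l = BotL e ds S \<and> x \<in> conclusions S)"
proof (cases l)
  case (BotL e ds S)
  then obtain g where "(x, g) \<in> set ds" using assms(2) by (auto simp: pass_ports_def link_ports_def)
  then have "x \<in> conclusions S" by (rule box_border[OF assms(1)[unfolded BotL]])
  then show ?thesis using BotL by blast
qed (use assms(2) in \<open>auto simp: pass_ports_def link_ports_iff\<close>)

lemma conclusion_not_passed:
  assumes st: "structured ty S0" and l: "l \<in> set (all_links S0)" and x: "x \<in> conclusions S0"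
  shows "(x, False) \<notin> pass_ports l"
proof
  assume p: "(x, False) \<in> pass_ports l"
  have "well_typed ty l" using st l by (auto simp: structured_def)
  moreover have "S0 \<in> levels S0" by (simp add: levels_def)
  ultimately obtain e ds S where b: "l = BotL e ds S" "x \<in> conclusions S"
    using bottom_port[OF _ p] conclusion_not_premise[OF st _ x l] by blast
  have "x \<in> deep_edges S" by (rule conclusions_deep[OF b(2)])
  moreover have "x \<in> level_concls S0" by (rule conclusionsD[OF x])
  ultimately show False using box_not_top[OF st l[unfolded b(1)]] by blast
qed

text \<open>The upper end of an edge belongs to the link it is a conclusion of. The lower end
  belongs to the link it is a premiss of or, for a conclusion of a content, to the border of that
  box; these alternatives exclude each other.\<close>

lemma pass_ports_unique:
  assumes st: "structured ty S0" and l: "l \<in> set (all_links S0)" "l' \<in> set (all_links S0)"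
    and p: "p \<in> pass_ports l" "p \<in> pass_ports l'"
  shows "l = l'"
proof -
  obtain x b where xb: "p = (x, b)" by (cases p)
  have d: "distinct (concat (map concls (all_links S0)))" "distinct (concat (map prems (all_links S0)))"
    using st by (auto simp: structured_def)
  show ?thesis
  proof (cases b)
    case True
    then have "x \<in> set (concls l)" "x \<in> set (concls l')" using top_port p xb by simp_all
    then show ?thesis by (rule distinct_concat_unique[OF d(1) l])
  next
    case False
    have box_level: "S \<in> levels S0" if "BotL e ds S \<in> set (all_links S0)" for e ds S
      using that by (auto simp: levels_def)
    have "well_typed ty l" "well_typed ty l'" using st l by (auto simp: structured_def)
    then have "x \<in> set (prems l) \<or> (\<exists>e ds S. l = BotL e ds S \<and> x \<in> conclusions S)"
      "x \<in> set (prems l') \<or> (\<exists>e ds S. l' = BotL e ds S \<and> x \<in> conclusions S)"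
      using bottom_port False p xb by simp_all
    then show ?thesis
    proof (elim disjE exE conjE)
      assume "x \<in> set (prems l)" "x \<in> set (prems l')"
      then show ?thesis by (rule distinct_concat_unique[OF d(2) l])
    next
      fix e ds S assume "x \<in> set (prems l)" "l' = BotL e ds S" "x \<in> conclusions S"
      then show ?thesis using conclusion_not_premise[OF st box_level _ l(1)] l(2) by blast
    next
      fix e ds S assume "x \<in> set (prems l')" "l = BotL e ds S" "x \<in> conclusions S"
      then show ?thesis using conclusion_not_premise[OF st box_level _ l(2)] l(1) by blast
    next
      fix e ds S e' ds' S'
      assume a: "l = BotL e ds S" "x \<in> conclusions S" "l' = BotL e' ds' S'" "x \<in> conclusions S'"
      show ?thesis
        using box_unique[OF st, of e ds S e' ds' S' x] l a conclusionsD[OF a(2)]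
          conclusionsD[OF a(4)] by simp
    qed
  qed
qed

section \<open>Addresses and polarities\<close>

lemma pos_address_simps [simp]:
  "pos_address (Tens A B) (Lft # m) = pos_address A m" "pos_address (Tens A B) (Rgt # m) = pos_address B m"
  "pos_address (Parr A B) (Lft # m) = pos_address A m" "pos_address (Parr A B) (Rgt # m) = pos_address B m"
  "pos_address One m = (m = [])" "\<not> pos_address Bot m"
  by (auto simp: pos_address_def; cases m; simp)+

lemma neg_address_simps [simp]:
  "neg_address (Tens A B) (Lft # m) = neg_address A m" "neg_address (Tens A B) (Rgt # m) = neg_address B m"
  "neg_address (Parr A B) (Lft # m) = neg_address A m" "neg_address (Parr A B) (Rgt # m) = neg_address B m"
  "neg_address Bot m = (m = [])" "\<not> neg_address One m"
  by (auto simp: neg_address_def; cases m; simp)+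

lemma address_Nil_compound [simp]:
  "\<not> pos_address (Tens A B) []" "\<not> pos_address (Parr A B) []"
  "\<not> neg_address (Tens A B) []" "\<not> neg_address (Parr A B) []"
  by (auto simp: pos_address_def neg_address_def)

lemma subformula_dual: "subformula (dual A) m = map_option dual (subformula A m)"
  by (induction A m rule: subformula.induct) (auto split: side.splits)

lemma dual_eq_simps:
  "dual B = One \<longleftrightarrow> B = Bot" "dual B = Bot \<longleftrightarrow> B = One"
  "dual B = Atom x \<longleftrightarrow> B = NegAtom x" "dual B = NegAtom x \<longleftrightarrow> B = Atom x"
  by (cases B; auto)+

lemma address_dual [simp]:
  "pos_address (dual A) m = neg_address A m" "neg_address (dual A) m = pos_address A m"
  by (auto simp: pos_address_def neg_address_def subformula_dual dual_eq_simps)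

lemma pos_not_neg: "pos_address A m \<Longrightarrow> \<not> neg_address A m"
  by (auto simp: pos_address_def neg_address_def)

lemma positive_no_neg: "positive A \<Longrightarrow> \<not> neg_address A m"
proof (induction A arbitrary: m)
  case (Tens A B)
  then show ?case
    by (cases m rule: list.exhaust; cases "hd m") auto
qed auto

lemma negative_no_pos: "negative A \<Longrightarrow> \<not> pos_address A m"
proof (induction A arbitrary: m)
  case (Parr A B)
  then show ?case
    by (cases m rule: list.exhaust; cases "hd m") auto
qed auto

lemma positive_ex_pos: "positive A \<Longrightarrow> \<exists>m. pos_address A m"
  by (induction A) (auto intro: exI[of _ "Lft # _"])

lemma negative_ex_neg: "negative A \<Longrightarrow> \<exists>m. neg_address A m"
  by (induction A) (auto intro: exI[of _ "Lft # _"])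

text \<open>The route of a token irrespective of the state: unlocking and synchronisation decide
  when a step may be taken, but not where it leads. Orbits are thus fixed in advance.\<close>

fun link_step :: "('e \<Rightarrow> 'x formula) \<Rightarrow> 'e link \<Rightarrow> 'e position \<Rightarrow> 'e position \<Rightarrow> bool" where
  "link_step ty (AxL a b) p q \<longleftrightarrow>
     (\<exists>m. neg_address (ty a) m \<and> p = At a m \<and> q = At b m \<or> neg_address (ty b) m \<and> p = At b m \<and> q = At a m)"
| "link_step ty (CutL a b) p q \<longleftrightarrow>
     (\<exists>m. pos_address (ty a) m \<and> p = At a m \<and> q = At b m \<or> pos_address (ty b) m \<and> p = At b m \<and> q = At a m)"
| "link_step ty (TensL a b c) p q \<longleftrightarrow>
     (\<exists>m. pos_address (ty a) m \<and> p = At a m \<and> q = At c (Lft # m) \<or> pos_address (ty b) m \<and> p = At b m \<and> q = At c (Rgt # m) \<or>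
          neg_address (ty a) m \<and> p = At c (Lft # m) \<and> q = At a m \<or> neg_address (ty b) m \<and> p = At c (Rgt # m) \<and> q = At b m)"
| "link_step ty (ParL a b c) p q \<longleftrightarrow>
     (\<exists>m. pos_address (ty a) m \<and> p = At a m \<and> q = At c (Lft # m) \<or> pos_address (ty b) m \<and> p = At b m \<and> q = At c (Rgt # m) \<or>
          neg_address (ty a) m \<and> p = At c (Lft # m) \<and> q = At a m \<or> neg_address (ty b) m \<and> p = At c (Rgt # m) \<and> q = At b m)"
| "link_step ty (OneL e) p q \<longleftrightarrow> False"
| "link_step ty (BotL e ds S) p q \<longleftrightarrow>
     p = At e [] \<and> q = Lock e 0 \<or>
     (\<exists>f g m. (f, g) \<in> set ds \<and> (neg_address (ty g) m \<and> p = At g m \<and> q = At f m \<or> pos_address (ty f) m \<and> p = At f m \<and> q = At g m))"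
| "link_step ty (SyncL ps) p q \<longleftrightarrow> (p, q) \<in> sync_cross ty ps"

text \<open>A token on a negative atom heads up, to the link whose conclusion the edge is, so it
  next meets the upper end; on a positive atom it next meets the lower end.\<close>

fun arrival :: "('e \<Rightarrow> 'x formula) \<Rightarrow> 'e position \<Rightarrow> 'e port" where
  "arrival ty (At e m) = (e, neg_address (ty e) m)"
| "arrival ty (Lock e i) = (e, True)"

text \<open>At an atom this is the end opposite to \<open>arrival\<close>, by which a token comes
  onto the edge. A lock position is reached on its own edge, at the upper end.\<close>

fun departure :: "('e \<Rightarrow> 'x formula) \<Rightarrow> 'e position \<Rightarrow> 'e port" where
  "departure ty (At e m) = (e, pos_address (ty e) m)"
| "departure ty (Lock e i) = (e, True)"

lemma sync_crossD:
  assumes "(p, q) \<in> sync_cross ty ps" "well_typed ty (SyncL ps)"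
  obtains a c m where "(a, c) \<in> set ps" "ty c = ty a" "positive (ty a)" "pos_address (ty a) m" "p = At a m" "q = At c m"
  | a c m where "(a, c) \<in> set ps" "ty c = ty a" "negative (ty a)" "neg_address (ty a) m" "p = At c m" "q = At a m"
  using assms unfolding sync_cross_def by auto

lemma step_ports:
  assumes "well_typed ty l" "link_step ty l p q"
  shows "arrival ty p \<in> pass_ports l" "departure ty q \<in> pass_ports l"
proof -
  have "arrival ty p \<in> pass_ports l \<and> departure ty q \<in> pass_ports l"
  proof (cases l)
    case (SyncL ps)
    have "(p, q) \<in> sync_cross ty ps" "well_typed ty (SyncL ps)" using assms SyncL by simp_all
    then show ?thesis
      by (rule sync_crossD) (auto simp: SyncL pass_ports_def link_ports_iff dest: pos_not_neg intro: rev_image_eqI)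
  next
    case (BotL e ds S)
    from assms(2) consider "p = At e []" "q = Lock e 0"
      | f g m where "(f, g) \<in> set ds" "neg_address (ty g) m" "p = At g m" "q = At f m"
      | f g m where "(f, g) \<in> set ds" "pos_address (ty f) m" "p = At f m" "q = At g m"
      unfolding BotL by auto
    then show ?thesis
    proof cases
      case 1
      then show ?thesis using assms(1) BotL by (simp add: pass_ports_def link_ports_iff)
    next
      case 2
      have "ty g = ty f" using assms(1) 2(1) BotL by auto
      moreover have "(g, True) \<in> pass_ports l" "(f, False) \<in> pass_ports l"
        using snd_in_concls[OF 2(1)] 2(1) unfolding BotL pass_ports_def by (auto simp: link_ports_iff intro: rev_image_eqI)
      moreover have "\<not> pos_address (ty f) m" using 2(2) \<open>ty g = ty f\<close> pos_not_neg by metis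
      ultimately show ?thesis using 2 by simp
    next
      case 3
      have "ty g = ty f" using assms(1) 3(1) BotL by auto
      moreover have "(g, True) \<in> pass_ports l" "(f, False) \<in> pass_ports l"
        using snd_in_concls[OF 3(1)] 3(1) unfolding BotL pass_ports_def by (auto simp: link_ports_iff intro: rev_image_eqI)
      moreover have "\<not> neg_address (ty f) m" using 3(2) pos_not_neg by metis
      ultimately show ?thesis using 3 by simp
    qed
  qed (use assms in \<open>auto simp: pass_ports_def link_ports_iff dest: pos_not_neg\<close>)
  then show "arrival ty p \<in> pass_ports l" "departure ty q \<in> pass_ports l" by auto
qed

text \<open>By typing, therefore, the conclusion of a tensor or par is neither of its
  premisses.\<close>

lemma formula_neq [simp]:
  "A \<noteq> Tens A B" "A \<noteq> Tens B A" "A \<noteq> Parr A B" "A \<noteq> Parr B A"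
  by (induction A arbitrary: B; auto)+

lemma distinct_map_fst: "distinct (map fst ps) \<Longrightarrow> (a, c) \<in> set ps \<Longrightarrow> (a, c') \<in> set ps \<Longrightarrow> c = c'"
  by (metis eq_key_imp_eq_value)

lemma distinct_map_snd: "distinct (map snd ps) \<Longrightarrow> (a, c) \<in> set ps \<Longrightarrow> (a', c) \<in> set ps \<Longrightarrow> a = a'"
  by (induction ps) (auto intro: rev_image_eqI)

lemma link_step_fun:
  assumes wt: "well_typed ty l" and d: "distinct (concls l)" "distinct (prems l)"
    and s: "link_step ty l p q" "link_step ty l p q'"
  shows "q = q'"
proof (cases l)
  case (SyncL ps)
  have wt': "well_typed ty (SyncL ps)" using wt SyncL by simp
  have d': "distinct (map fst ps)" "distinct (map snd ps)" using d SyncL by simp_all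
  have "(p, q) \<in> sync_cross ty ps" "(p, q') \<in> sync_cross ty ps" using s SyncL by simp_all
  from this(1) wt' this(2) show ?thesis
    by (elim sync_crossD[OF _ wt'])
      (auto dest: distinct_map_fst[OF d'(1)] distinct_map_snd[OF d'(2)] positive_not_negative)
next
  case (BotL e ds S)
  have d': "distinct (map fst ds)" "distinct (map snd ds)" "e \<notin> set (map snd ds)" using d wt BotL by auto
  have ne: "ty g = ty f" if "(f, g) \<in> set ds" for f g using that wt BotL by force
  have no_lock: "(f, e) \<notin> set ds" for f using d'(3) by force
  have tye: "ty e = Bot" using wt BotL by simp
  have "f \<noteq> e" if "(f, g) \<in> set ds" "pos_address (ty f) m" for f g m using that tye by auto
  then show ?thesis
    using s ne no_lock unfolding BotL
    by (auto dest: distinct_map_fst[OF d'(1)] distinct_map_snd[OF d'(2)] pos_not_neg)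
qed (use assms in \<open>auto dest: pos_not_neg\<close>)

lemma link_step_inj:
  assumes wt: "well_typed ty l" and d: "distinct (concls l)" "distinct (prems l)"
    and s: "link_step ty l p q" "link_step ty l p' q"
  shows "p = p'"
proof (cases l)
  case (SyncL ps)
  have wt': "well_typed ty (SyncL ps)" using wt SyncL by simp
  have d': "distinct (map fst ps)" "distinct (map snd ps)" using d SyncL by simp_all
  have "(p, q) \<in> sync_cross ty ps" "(p', q) \<in> sync_cross ty ps" using s SyncL by simp_all
  from this(1) wt' this(2) show ?thesis
    by (elim sync_crossD[OF _ wt'])
      (auto dest: distinct_map_fst[OF d'(1)] distinct_map_snd[OF d'(2)] positive_not_negative)
next
  case (BotL e ds S)
  have d': "distinct (map fst ds)" "distinct (map snd ds)" "e \<notin> set (map snd ds)" using d wt BotL by auto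
  have ne: "ty g = ty f" if "(f, g) \<in> set ds" for f g using that wt BotL by force+
  show ?thesis
    using s ne unfolding BotL
    by (auto dest: distinct_map_fst[OF d'(1)] distinct_map_snd[OF d'(2)] pos_not_neg)
qed (use assms in \<open>auto dest: pos_not_neg\<close>)

section \<open>Runs\<close>

definition flow_step :: "('e, 'x) smll \<Rightarrow> 'e position \<Rightarrow> 'e position \<Rightarrow> bool" where
  "flow_step R p q \<longleftrightarrow> (\<exists>l. has_link R l \<and> link_step (edge_type R) l p q)"

lemma move_link_step:
  "move R T p q \<Longrightarrow> \<exists>l. has_link R l \<and> link_step (edge_type R) l p q \<and> (\<forall>ps. l \<noteq> SyncL ps)"
  by (induction rule: move.induct; (elim disjE)?; (rule exI, rule conjI, assumption, auto))

lemma move_mono: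
  "move R T p q \<Longrightarrow> (\<And>e. unlocked T e \<Longrightarrow> unlocked T' e) \<Longrightarrow> move R T' p q"
  by (induction rule: move.induct) (blast intro: move.intros)+

lemma subformula_leaf:
  "(subformula One m = Some A) = (m = [] \<and> A = One)" "(subformula Bot m = Some A) = (m = [] \<and> A = Bot)"
  "(subformula (Atom x) m = Some A) = (m = [] \<and> A = Atom x)" "(subformula (NegAtom x) m = Some A) = (m = [] \<and> A = NegAtom x)"
  by (cases m; auto)+

lemma finite_addresses: "finite {m. subformula A m \<noteq> None}"
proof (induction A)
  have sub: "{m. subformula C m \<noteq> None} \<subseteq>
      insert [] (Cons Lft ` {m. subformula A m \<noteq> None} \<union> Cons Rgt ` {m. subformula B m \<noteq> None})"
    if "C = Tens A B \<or> C = Parr A B" for A B C :: "'x formula"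
  proof
    fix m assume "m \<in> {m. subformula C m \<noteq> None}"
    then show "m \<in> insert [] (Cons Lft ` {m. subformula A m \<noteq> None} \<union> Cons Rgt ` {m. subformula B m \<noteq> None})"
      using that by (cases m) (auto split: side.splits)
  qed
  case (Tens A B)
  then show ?case using sub[of "Tens A B" A B] finite_subset by blast
  case (Parr A B)
  then show ?case using sub[of "Parr A B" A B] finite_subset by blast
qed (simp_all add: subformula_leaf)

abbreviation atom_at :: "('e \<Rightarrow> 'x formula) \<Rightarrow> 'e \<Rightarrow> address \<Rightarrow> bool" where
  "atom_at ty e m \<equiv> pos_address (ty e) m \<or> neg_address (ty e) m"

text \<open>\<open>BOTBOX\<close> allows every counter, but a token entering a lock gets counter 0
  and stays there. Restricting to it keeps the set of valid positions finite.\<close>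

fun valid_position :: "('e, 'x) smll \<Rightarrow> 'e position \<Rightarrow> bool" where
  "valid_position R (At e m) \<longleftrightarrow>
     e \<in> deep_edges (links R) \<and> (atom_at (edge_type R) e m)"
| "valid_position R (Lock e i) \<longleftrightarrow> is_lock R e \<and> i = 0"

locale smll_machine =
  fixes R :: "('e, 'x) smll"
  assumes smll: "smll_structure R"
begin

abbreviation "ty \<equiv> edge_type R"

lemma structured: "structured ty (links R)"
  using smll unfolding smll_structure_def structured_def by blast

lemma link_facts:
  assumes "has_link R l"
  shows "well_typed ty l" "distinct (concls l)" "distinct (prems l)"
proof -
  show "well_typed ty l" using structured assms by (auto simp: structured_def)
  have "distinct (concat (map concls (all_links (links R))))" "distinct (concat (map prems (all_links (links R))))"
    using structured by (auto simp: structured_def)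
  then show "distinct (concls l)" "distinct (prems l)" using assms by (auto simp: distinct_concat_iff)
qed

lemma step_link_unique:
  assumes "has_link R l" "has_link R l'" "link_step ty l p q" "link_step ty l' p' q"
  shows "l = l'"
  by (rule pass_ports_unique[OF structured assms(1,2) step_ports(2)[OF link_facts(1)[OF assms(1)] assms(3)]
    step_ports(2)[OF link_facts(1)[OF assms(2)] assms(4)]])

text \<open>Steps are unique in both directions because a port belongs to one link. A source has no
  predecessor: an initial token would have to come from below a conclusion of the net, where there
  is no link, and a token on the edge of a one link would have to come out of a link without
  steps.\<close>

sublocale token_flow "flow_step R" "INIT R \<union> ONES R"
proof
  fix p q q' assume "flow_step R p q" "flow_step R p q'"
  then obtain l l' where l: "has_link R l" "link_step ty l p q" "has_link R l'" "link_step ty l' p q'"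
    unfolding flow_step_def by blast
  have "l = l'"
    by (rule pass_ports_unique[OF structured l(1,3) step_ports(1)[OF link_facts(1)[OF l(1)] l(2)]
      step_ports(1)[OF link_facts(1)[OF l(3)] l(4)]])
  then show "q = q'" using link_step_fun[OF link_facts[OF l(1)] l(2)] l(4) by blast
next
  fix p q p' assume "flow_step R p q" "flow_step R p' q"
  then obtain l l' where l: "has_link R l" "link_step ty l p q" "has_link R l'" "link_step ty l' p' q"
    unfolding flow_step_def by blast
  have "l = l'" by (rule step_link_unique[OF l(1,3,2,4)])
  then show "p = p'" using link_step_inj[OF link_facts[OF l(1)] l(2)] l(4) by blast
next
  fix t p assume t: "t \<in> INIT R \<union> ONES R"
  show "\<not> flow_step R p t"
  proof
    assume "flow_step R p t"
    then obtain l where l: "has_link R l" "link_step ty l p t" unfolding flow_step_def by blast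
    have dep: "departure ty t \<in> pass_ports l" by (rule step_ports(2)[OF link_facts(1)[OF l(1)] l(2)])
    from t show False
    proof
      assume "t \<in> INIT R"
      then obtain e m where e: "t = At e m" "e \<in> conclusions (links R)" "neg_address (ty e) m"
        by (auto simp: INIT_def)
      then have "\<not> pos_address (ty e) m" using pos_not_neg by metis
      then have "(e, False) \<in> pass_ports l" using dep e(1) by simp
      then show False using conclusion_not_passed[OF structured l(1) e(2)] by blast
    next
      assume "t \<in> ONES R"
      then obtain e where e: "t = At e []" "has_link R (OneL e)" by (auto simp: ONES_def)
      then have "(e, True) \<in> pass_ports l" using dep link_facts(1)[OF e(2)] by simp
      moreover have "(e, True) \<in> pass_ports (OneL e)" by (simp add: pass_ports_def link_ports_iff)
      ultimately have "l = OneL e" using pass_ports_unique[OF structured l(1) e(2)] by blast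
      then show False using l(2) by simp
    qed
  qed
qed

section \<open>Growth of the visited set\<close>

lemma no_self_step: "on_track T \<Longrightarrow> p \<in> ran T \<Longrightarrow> \<not> flow_step R p p"
  using current_next_unvisited ran_visited by blast

lemma Lock_no_step: "\<not> flow_step R (Lock e i) q"
proof
  assume "flow_step R (Lock e i) q"
  then obtain l where "link_step ty l (Lock e i) q" by (auto simp: flow_step_def)
  then show False by (cases l) (auto simp: sync_cross_def)
qed

lemma sync_flow_step: "has_link R (SyncL ps) \<Longrightarrow> (p, q) \<in> sync_cross ty ps \<Longrightarrow> flow_step R p q"
  unfolding flow_step_def by (intro exI[of _ "SyncL ps"]) simp

lemma move_flow_step: "move R T p q \<Longrightarrow> flow_step R p q"
  unfolding flow_step_def using move_link_step by blast

lemma move_not_sync: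
  assumes "move R T p q" "has_link R (SyncL ps)" "q \<in> Range (sync_cross ty ps)"
  shows False
proof -
  obtain l where l: "has_link R l" "link_step ty l p q" "\<forall>ps. l \<noteq> SyncL ps" using move_link_step[OF assms(1)] by blast
  obtain p' where "(p', q) \<in> sync_cross ty ps" using assms(3) by blast
  then have "link_step ty (SyncL ps) p' q" by simp
  from step_link_unique[OF l(1) assms(2) l(2) this] l(3) show False by blast
qed

lemma sync_disjoint:
  assumes "has_link R (SyncL ps)" "has_link R (SyncL ps')"
    "q \<in> Range (sync_cross ty ps)" "q \<in> Range (sync_cross ty ps')"
  shows "ps = ps'"
proof -
  obtain p p' where "link_step ty (SyncL ps) p q" "link_step ty (SyncL ps') p' q" using assms(3,4) by auto
  from step_link_unique[OF assms(1,2) this] show ?thesis by simp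
qed

text \<open>A sync link has an edge, and every positive or negative formula contains an atom. So
  crossing the link visits something new.\<close>

lemma sync_nonempty:
  assumes "has_link R (SyncL ps)"
  shows "sync_cross ty ps \<noteq> {}"
proof -
  have wt: "ps \<noteq> []" "\<forall>(a, c)\<in>set ps. ty c = ty a \<and> (positive (ty a) \<or> negative (ty a))"
    using link_facts(1)[OF assms] by auto
  obtain a c where ac: "(a, c) \<in> set ps" using wt(1) by (cases ps) auto
  then have "ty c = ty a" "positive (ty a) \<or> negative (ty a)" using wt(2) by auto
  then consider m where "positive (ty a)" "pos_address (ty a) m" | m where "negative (ty c)" "neg_address (ty c) m"
    using positive_ex_pos[of "ty a"] negative_ex_neg[of "ty a"] by metis
  then have "\<exists>m. (At a m, At c m) \<in> sync_cross ty ps \<or> (At c m, At a m) \<in> sync_cross ty ps"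
    by cases (use ac in \<open>auto simp: sync_cross_def\<close>)
  then show ?thesis by blast
qed

text \<open>The last clause is special to reachable states: in an arbitrary state some tokens could
  stand beyond a sync link while others have not reached it.\<close>

definition inv :: "'e state \<Rightarrow> bool" where
  "inv T \<longleftrightarrow> on_track T \<and> INIT R \<subseteq> dom T \<and>
     (\<forall>ps. has_link R (SyncL ps) \<longrightarrow>
        Range (sync_cross ty ps) \<inter> visited T = {} \<or> Range (sync_cross ty ps) \<subseteq> visited T)"

text \<open>Describes a transition by what it newly visits and by what enables it. The enabling
  conditions can be compared with a stuck state, in which the tokens may have moved on.\<close>

definition gain :: "'e state \<Rightarrow> 'e position set \<Rightarrow> bool" where
  "gain T N \<longleftrightarrow> (\<exists>t p q. T t = Some p \<and> move R T p q \<and> N = {q}) \<or>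
     (\<exists>e. has_link R (OneL e) \<and> active R T (OneL e) \<and> N = {At e []}) \<or>
     (\<exists>ps. has_link R (SyncL ps) \<and> Domain (sync_cross ty ps) \<subseteq> ran T \<and> N = Range (sync_cross ty ps))"

lemma transition_gain:
  assumes T: "on_track T" and tr: "transition R T T'"
  shows "on_track T' \<and> dom T \<subseteq> dom T' \<and>
    (\<exists>N. visited T' = visited T \<union> N \<and> N \<noteq> {} \<and> N \<inter> visited T = {} \<and> gain T N)"
proof -
  let ?New = "{q. \<exists>t p. T t = Some p \<and> T' t = Some q \<and> flow_step R p q}"
  show ?thesis
    using tr
  proof cases
    case (token t p q)
    have st: "flow_step R p q" by (rule move_flow_step[OF token(3)])
    have p: "p \<in> ran T" using token(2) by (auto simp: ran_def)
    have dom: "dom T' = dom T" using token(1,2) by auto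
    have adv: "q' = p' \<or> flow_step R p' q'" if "T t' = Some p'" "T' t' = Some q'" for t' p' q'
      using that token(1,2) st by (auto split: if_splits)
    \<comment> \<open>The other tokens keep their places, and staying is no step, so they contribute
      nothing.\<close>
    have "?New = {q}"
    proof
      show "{q} \<subseteq> ?New" using token(1,2) st by auto
      show "?New \<subseteq> {q}"
      proof
        fix q' assume "q' \<in> ?New"
        then obtain t' p' where h: "T t' = Some p'" "T' t' = Some q'" "flow_step R p' q'" by blast
        have "t' = t"
        proof (rule ccontr)
          assume "t' \<noteq> t"
          then have "q' = p'" using h token(1) by simp
          moreover have "p' \<in> ran T" using h(1) by (auto simp: ran_def)
          ultimately show False using no_self_step[OF T] h(3) by blast
        qed
        then show "q' \<in> {q}" using h(2) token(1) by simp
      qed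
    qed
    then have "visited T' = visited T \<union> {q}" using visited_advance(2)[OF T dom adv] by simp
    moreover have "q \<notin> visited T" by (rule current_next_unvisited[OF T p st])
    moreover have "gain T {q}" unfolding gain_def using token(2,3) by blast
    moreover have "on_track T'" by (rule visited_advance(1)[OF T dom adv])
    ultimately show ?thesis using dom by blast
  next
    case (one e)
    have s: "At e [] \<in> INIT R \<union> ONES R" using one(2) by (auto simp: ONES_def)
    have "visited T' = visited T \<union> {At e []}" using visited_create(2)[OF T s one(4)] one(1) by simp
    moreover have "At e [] \<notin> visited T" using source_visited[OF T s] one(4) by blast
    moreover have "gain T {At e []}" unfolding gain_def using one(2,3) by blast
    moreover have "on_track T'" using visited_create(1)[OF T s one(4)] one(1) by simp
    moreover have "dom T \<subseteq> dom T'" using one(1) by auto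
    ultimately show ?thesis by blast
  next
    case (sync ps)
    let ?C = "sync_cross ty ps"
    have rel: "rel_option (\<lambda>p q. (p, q) \<in> ?C \<or> p \<notin> Domain ?C \<and> q = p) (T t) (T' t)" for t using sync(3) by blast
    have dom: "dom T' = dom T"
    proof -
      have "T t = None \<longleftrightarrow> T' t = None" for t using rel[of t] by (cases "T t"; cases "T' t") auto
      then show ?thesis by (auto simp: dom_def)
    qed
    have rel': "(p, q) \<in> ?C \<or> p \<notin> Domain ?C \<and> q = p" if "T t = Some p" "T' t = Some q" for t p q
      using rel[of t] that by simp
    have adv: "q = p \<or> flow_step R p q" if "T t = Some p" "T' t = Some q" for t p q
      using rel'[OF that] sync_flow_step[OF sync(1)] by blast
    \<comment> \<open>A token that stays makes no step, and a token on an in-edge has just one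
      possible image, so each position of the range is reached.\<close>
    have "?New = Range ?C"
    proof
      show "?New \<subseteq> Range ?C"
      proof
        fix q assume "q \<in> ?New"
        then obtain t p where h: "T t = Some p" "T' t = Some q" "flow_step R p q" by blast
        have "q \<noteq> p" using no_self_step[OF T, of p] h(1,3) by (auto simp: ran_def)
        then show "q \<in> Range ?C" using rel'[OF h(1,2)] by blast
      qed
      show "Range ?C \<subseteq> ?New"
      proof
        fix q assume "q \<in> Range ?C"
        then obtain p where p: "(p, q) \<in> ?C" by blast
        then have "p \<in> ran T" using sync(2) by blast
        then obtain t where t: "T t = Some p" by (auto simp: ran_def)
        then have "t \<in> dom T'" using dom by auto
        then obtain q' where q': "T' t = Some q'" by auto
        have "(p, q') \<in> ?C" using rel'[OF t q'] p by blast
        then have "q' = q" using st_fun sync_flow_step[OF sync(1)] p by blast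
        then show "q \<in> ?New"
          using t q' sync_flow_step[OF sync(1) p] by blast
      qed
    qed
    then have "visited T' = visited T \<union> Range ?C" using visited_advance(2)[OF T dom adv] by simp
    moreover have "Range ?C \<inter> visited T = {}"
    proof -
      have "q \<notin> visited T" if "(p, q) \<in> ?C" for p q
        by (rule current_next_unvisited[OF T _ sync_flow_step[OF sync(1) that]]) (use that sync(2) in blast)
      then show ?thesis by blast
    qed
    moreover have "Range ?C \<noteq> {}" using sync_nonempty[OF sync(1)] by auto
    moreover have "gain T (Range ?C)" unfolding gain_def using sync(1,2) by blast
    moreover have "on_track T'" by (rule visited_advance(1)[OF T dom adv])
    ultimately show ?thesis using dom by blast
  qed
qed

text \<open>A position is stepped into by at most one link, so what a transition gains is disjoint
  from the range of a sync link unless it is that range.\<close>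

lemma inv_transition:
  assumes I: "inv T" and tr: "transition R T T'"
  shows "inv T'"
proof -
  have T: "on_track T" "INIT R \<subseteq> dom T" using I by (auto simp: inv_def)
  obtain N where N: "on_track T'" "dom T \<subseteq> dom T'" "visited T' = visited T \<union> N" "gain T N"
    using transition_gain[OF T(1) tr] by blast
  have "Range (sync_cross ty ps) \<inter> N = {} \<or> N = Range (sync_cross ty ps)" if ps: "has_link R (SyncL ps)" for ps
    using N(4) unfolding gain_def
  proof (elim disjE exE conjE)
    fix t p q assume "move R T p q" "N = {q}"
    then show ?thesis using move_not_sync ps by blast
  next
    fix e assume e: "has_link R (OneL e)" "N = {At e []}"
    then have "At e [] \<in> INIT R \<union> ONES R" by (auto simp: ONES_def)
    then have "At e [] \<notin> Range (sync_cross ty ps)" using st_source sync_flow_step[OF ps] by blast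
    then show ?thesis using e(2) by blast
  next
    fix ps' assume ps': "has_link R (SyncL ps')" "N = Range (sync_cross ty ps')"
    then show ?thesis using sync_disjoint[OF ps ps'(1)] by blast
  qed
  then have "Range (sync_cross ty ps) \<inter> visited T' = {} \<or> Range (sync_cross ty ps) \<subseteq> visited T'"
    if ps: "has_link R (SyncL ps)" for ps
    using I ps unfolding inv_def N(3) by blast
  then show ?thesis using N(1,2) T(2) unfolding inv_def by blast
qed

lemma visited_initial: "on_track (initial_state R)" "visited (initial_state R) = INIT R" "dom (initial_state R) = INIT R"
proof -
  show dom: "dom (initial_state R) = INIT R" by (auto simp: initial_state_def dom_def)
  show on: "on_track (initial_state R)" unfolding on_track_def dom by (auto simp: initial_state_def split: if_splits)
  show "visited (initial_state R) = INIT R"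
  proof
    show "visited (initial_state R) \<subseteq> INIT R"
      using into_source by (auto simp: visited_def initial_state_def split: if_splits)
    show "INIT R \<subseteq> visited (initial_state R)" using dom_visited[OF on] dom by simp
  qed
qed

lemma inv_initial: "inv (initial_state R)"
  unfolding inv_def visited_initial
proof (intro conjI allI impI disjI1)
  fix ps assume "has_link R (SyncL ps)"
  then show "Range (sync_cross ty ps) \<inter> INIT R = {}" using st_source sync_flow_step by blast
qed (simp_all add: visited_initial)

section \<open>Stuck states\<close>

abbreviation reachable :: "'e state \<Rightarrow> bool" where
  "reachable \<equiv> (transition R)\<^sup>*\<^sup>* (initial_state R)"

abbreviation stuck :: "'e state \<Rightarrow> bool" where
  "stuck F \<equiv> \<not> (\<exists>T. transition R F T)"

text \<open>A token at \<open>p\<close> could still move, so the one that visited \<open>p\<close>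
  has left it, and there was only one way to go.\<close>

lemma stuck_move:
  assumes F: "inv F" "stuck F" and m: "move R F p q" "p \<in> visited F"
  shows "q \<in> visited F"
proof -
  have on: "on_track F" using F(1) by (simp add: inv_def)
  have "p \<notin> ran F"
  proof
    assume "p \<in> ran F"
    then obtain t where "F t = Some p" by (auto simp: ran_def)
    then have "transition R F (F(t \<mapsto> q))" using m(1) by (rule transition.token)
    then show False using F(2) by blast
  qed
  then obtain r where "flow_step R p r" "r \<in> visited F" using visited_next[OF on m(2)] by blast
  then show ?thesis using st_fun move_flow_step[OF m(1)] by blast
qed

lemma stuck_one:
  assumes F: "inv F" "stuck F" and e: "has_link R (OneL e)" "active R F (OneL e)"
  shows "At e [] \<in> visited F"
proof -
  have on: "on_track F" using F(1) by (simp add: inv_def)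
  have "At e [] \<in> dom F"
  proof (rule ccontr)
    assume "At e [] \<notin> dom F"
    then have "transition R F (F(At e [] \<mapsto> At e []))" using e by (intro transition.one)
    then show False using F(2) by blast
  qed
  then show ?thesis using dom_visited[OF on] by blast
qed

text \<open>If no position of the range is visited, all tokens still wait on the in-edges and the
  link could be crossed. If some position is visited, all are, by the invariant.\<close>

lemma stuck_sync:
  assumes F: "inv F" "stuck F" and ps: "has_link R (SyncL ps)" "Domain (sync_cross ty ps) \<subseteq> visited F"
  shows "Range (sync_cross ty ps) \<subseteq> visited F"
proof (rule ccontr)
  let ?C = "sync_cross ty ps"
  assume "\<not> Range ?C \<subseteq> visited F"
  then have none: "Range ?C \<inter> visited F = {}" using F(1) ps(1) unfolding inv_def by blast
  have on: "on_track F" using F(1) by (simp add: inv_def)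
  have cur: "Domain ?C \<subseteq> ran F"
  proof
    fix p assume p: "p \<in> Domain ?C"
    show "p \<in> ran F"
    proof (rule ccontr)
      assume "p \<notin> ran F"
      then obtain r where r: "flow_step R p r" "r \<in> visited F" using visited_next[OF on] p ps(2) by blast
      obtain q where q: "(p, q) \<in> ?C" using p by blast
      then have "r = q" using st_fun r(1) sync_flow_step[OF ps(1)] by blast
      then show False using none r(2) q by blast
    qed
  qed
  define F' where "F' t = map_option (\<lambda>p. if p \<in> Domain ?C then SOME q. (p, q) \<in> ?C else p) (F t)" for t
  have "rel_option (\<lambda>p q. (p, q) \<in> ?C \<or> p \<notin> Domain ?C \<and> q = p) (F t) (F' t)" for t
  proof (cases "F t")
    case (Some p)
    have "(p, SOME q. (p, q) \<in> ?C) \<in> ?C" if "p \<in> Domain ?C" using that by (auto intro: someI)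
    then show ?thesis using Some by (auto simp: F'_def)
  qed (simp add: F'_def)
  then have "transition R F F'" using transition.sync[OF ps(1) cur] by blast
  then show False using F(2) by blast
qed

lemma stuck_dominates:
  assumes F: "inv F" "stuck F" and T: "inv T" "visited T \<subseteq> visited F" and tr: "transition R T T'"
  shows "visited T' \<subseteq> visited F"
proof -
  have onT: "on_track T" and onF: "on_track F" using T(1) F(1) by (auto simp: inv_def)
  obtain N where N: "visited T' = visited T \<union> N" "gain T N" using transition_gain[OF onT tr] by blast
  have ranT: "ran T \<subseteq> visited F" using ran_visited[OF onT] T(2) by blast
  \<comment> \<open>A lock position has no outgoing step, so once visited it stays occupied; this
    carries unlocking over to \<open>F\<close>.\<close>
  have unl: "unlocked F e" if u: "unlocked T e" for e
  proof -
    obtain i where "Lock e i \<in> ran T" using u by (auto simp: unlocked_def)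
    then have "Lock e i \<in> visited F" using ranT by blast
    then have "Lock e i \<in> ran F" using visited_next[OF onF] Lock_no_step by blast
    then show ?thesis by (auto simp: unlocked_def)
  qed
  have "N \<subseteq> visited F"
    using N(2) unfolding gain_def
  proof (elim disjE exE conjE)
    fix t p q assume h: "T t = Some p" "move R T p q" "N = {q}"
    have "move R F p q" using move_mono[OF h(2)] unl by blast
    moreover have "p \<in> visited F" using h(1) ranT by (auto simp: ran_def)
    ultimately show ?thesis using stuck_move[OF F] h(3) by blast
  next
    fix e assume h: "has_link R (OneL e)" "active R T (OneL e)" "N = {At e []}"
    have "active R F (OneL e)" using h(2) unl unfolding active_def by blast
    then show ?thesis using stuck_one[OF F h(1)] h(3) by blast
  next
    fix ps assume h: "has_link R (SyncL ps)" "Domain (sync_cross ty ps) \<subseteq> ran T" "N = Range (sync_cross ty ps)"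
    then show ?thesis using stuck_sync[OF F h(1)] ranT by blast
  qed
  then show ?thesis using N(1) T(2) by blast
qed

lemma inv_reachable: "reachable T \<Longrightarrow> inv T"
  by (induction rule: rtranclp_induct) (auto intro: inv_initial inv_transition)

lemma reachable_dominated:
  assumes F: "inv F" "stuck F" and "reachable T"
  shows "visited T \<subseteq> visited F"
  using assms(3)
proof (induction rule: rtranclp_induct)
  case base
  have "INIT R \<subseteq> visited F" using F(1) dom_visited unfolding inv_def by blast
  then show ?case by (simp add: visited_initial)
next
  case (step T T')
  then show ?case using stuck_dominates[OF F inv_reachable] by blast
qed

lemma stuck_unique:
  assumes "reachable F" "stuck F" "reachable F'" "stuck F'"
  shows "F = F'"
proof -
  note i = inv_reachable[OF assms(1)] inv_reachable[OF assms(3)]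
  have "visited F = visited F'"
    using reachable_dominated[OF i(1) assms(2,3)] reachable_dominated[OF i(2) assms(4,1)] by blast
  then show ?thesis using visited_inject i by (auto simp: inv_def)
qed

section \<open>Valid positions and termination\<close>

lemma prems_deep:
  assumes "has_link R l"
  shows "set (concls l) \<subseteq> deep_edges (links R)" "set (prems l) \<subseteq> deep_edges (links R)"
proof -
  show "set (concls l) \<subseteq> deep_edges (links R)" using assms by (auto simp: level_concls_def)
  obtain S where S: "S \<in> levels (links R)" "l \<in> set S" using link_level[OF assms] by blast
  have "set S \<subseteq> set (all_links (links R))"
  proof
    fix l' assume "l' \<in> set S"
    then have l': "l' \<in> set (all_links S)" by (rule in_all_links)
    from S(1) consider "S = links R" | e ds where "has_link R (BotL e ds S)" by (auto simp: levels_def)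
    then show "l' \<in> set (all_links (links R))"
    proof cases
      case 2
      from box_in_all_links[OF this] l' show ?thesis by blast
    qed (use l' in simp)
  qed
  then have "level_concls S \<subseteq> deep_edges (links R)" unfolding level_concls_def by blast
  moreover have "set (prems l) \<subseteq> level_prems S" using S(2) by (auto simp: level_prems_def)
  ultimately show "set (prems l) \<subseteq> deep_edges (links R)" using structured S(1) by (auto simp: structured_def)
qed

lemma pass_ports_deep:
  assumes "has_link R l" "(e, b) \<in> pass_ports l"
  shows "e \<in> deep_edges (links R)"
proof -
  have "e \<in> set (concls l) \<union> set (prems l) \<or> (\<exists>h ds S. l = BotL h ds S \<and> e \<in> deep_edges S)"
  proof (cases l)
    case (BotL h ds S)
    have wt: "well_typed ty (BotL h ds S)" using link_facts(1)[OF assms(1)] BotL by simp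
    show ?thesis
      using assms(2) box_border_deep[OF wt] BotL by (auto simp: pass_ports_def link_ports_def)
  qed (use assms(2) in \<open>auto simp: pass_ports_def link_ports_def\<close>)
  then show ?thesis
  proof (elim disjE exE conjE)
    assume "e \<in> set (concls l) \<union> set (prems l)"
    then show ?thesis using prems_deep[OF assms(1)] by blast
  next
    fix h ds S assume "l = BotL h ds S" "e \<in> deep_edges S"
    then show ?thesis using box_in_all_links[of h ds S "links R"] assms(1) by (auto simp: level_concls_def)
  qed
qed

lemma link_step_valid:
  assumes "has_link R l" "link_step ty l p q"
  shows "valid_position R q"
proof -
  have wt: "well_typed ty l" by (rule link_facts(1)[OF assms(1)])
  have dep: "departure ty q \<in> pass_ports l" by (rule step_ports(2)[OF wt assms(2)])
  show ?thesis
  proof (cases q)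
    case (At e m)
    have "e \<in> deep_edges (links R)" using pass_ports_deep[OF assms(1)] dep At by simp
    moreover have "atom_at ty e m"
    proof (cases l)
      case (SyncL ps)
      have "(p, q) \<in> sync_cross ty ps" "well_typed ty (SyncL ps)" using assms(2) wt SyncL by simp_all
      then show ?thesis by (rule sync_crossD) (auto simp: At)
    next
      case (BotL h ds S)
      then show ?thesis using assms(2) wt At by auto
    qed (use assms(2) wt At in auto)
    ultimately show ?thesis using At by simp
  next
    case (Lock e i)
    have "\<exists>ds S. l = BotL e ds S \<and> i = 0" using assms(2) Lock by (cases l) (auto simp: sync_cross_def)
    then show ?thesis using Lock assms(1) by (auto simp: is_lock_def)
  qed
qed

lemma visited_valid:
  assumes "on_track T" "p \<in> visited T"
  shows "valid_position R p"
proof -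
  obtain t q where t: "T t = Some q" "(flow_step R)\<^sup>*\<^sup>* t p" using assms(2) by (auto simp: visited_def)
  from t(2) show ?thesis
  proof (cases rule: rtranclp.cases)
    case rtrancl_refl
    have "p \<in> INIT R \<union> ONES R" using on_trackD(1)[OF assms(1) t(1)] rtrancl_refl by simp
    then show ?thesis
    proof
      assume "p \<in> INIT R"
      then obtain e m where e: "p = At e m" "e \<in> conclusions (links R)" "neg_address (ty e) m" by (auto simp: INIT_def)
      have "e \<in> deep_edges (links R)" by (rule conclusions_deep[OF e(2)])
      then show ?thesis using e(1,3) by simp
    next
      assume "p \<in> ONES R"
      then obtain e where e: "p = At e []" "has_link R (OneL e)" by (auto simp: ONES_def)
      then show ?thesis using link_facts(1)[OF e(2)] prems_deep(1)[OF e(2)] by simp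
    qed
  next
    case (rtrancl_into_rtrancl x)
    then show ?thesis using link_step_valid by (auto simp: flow_step_def)
  qed
qed

lemma finite_valid: "finite {p. valid_position R p}"
proof -
  have "finite (deep_edges (links R))" by (simp add: level_concls_def)
  moreover have "e \<in> deep_edges (links R)" if lock: "is_lock R e" for e
  proof -
    obtain ds S where "has_link R (BotL e ds S)" using lock by (auto simp: is_lock_def)
    from prems_deep(1)[OF this] show ?thesis by simp
  qed
  moreover have "subformula A m \<noteq> None" if "pos_address A m \<or> neg_address A m" for A :: "'x formula" and m
    using that by (auto simp: pos_address_def neg_address_def)
  ultimately have "{p. valid_position R p} \<subseteq>
      (\<Union>e\<in>deep_edges (links R). At e ` {m. subformula (ty e) m \<noteq> None}) \<union> (\<lambda>e. Lock e 0) ` deep_edges (links R)"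
  proof (intro subsetI)
    fix p assume h: "p \<in> {p. valid_position R p}" "\<And>e. is_lock R e \<Longrightarrow> e \<in> deep_edges (links R)"
      "\<And>A :: 'x formula. \<And>m. pos_address A m \<or> neg_address A m \<Longrightarrow> subformula A m \<noteq> None"
    show "p \<in> (\<Union>e\<in>deep_edges (links R). At e ` {m. subformula (ty e) m \<noteq> None}) \<union> (\<lambda>e. Lock e 0) ` deep_edges (links R)"
    proof (cases p)
      case (At e m)
      have "e \<in> deep_edges (links R)" "subformula (ty e) m \<noteq> None" using h(1) h(3)[where A = "ty e" and m = m] At by auto
      then show ?thesis unfolding At by blast
    next
      case (Lock e i)
      have "i = 0" "e \<in> deep_edges (links R)" using h(1) h(2)[where e = e] Lock by auto
      then show ?thesis unfolding Lock by blast
    qed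
  qed
  then show ?thesis
    by (rule finite_subset)
      (intro finite_UnI finite_UN_I finite_imageI finite_addresses \<open>finite (deep_edges (links R))\<close>)
qed

lemma visited_bound:
  assumes "inv T"
  shows "finite (visited T)" "card (visited T) \<le> card {p. valid_position R p}"
proof -
  have "visited T \<subseteq> {p. valid_position R p}" using assms visited_valid by (auto simp: inv_def)
  then show "finite (visited T)" "card (visited T) \<le> card {p. valid_position R p}"
    using finite_valid by (auto intro: finite_subset card_mono)
qed

lemma card_visited_less:
  assumes "inv T" "transition R T T'"
  shows "card (visited T) < card (visited T')"
proof -
  have "on_track T" using assms(1) by (simp add: inv_def)
  then have "visited T \<subset> visited T'" using transition_gain[OF _ assms(2)] by blast
  then show ?thesis using visited_bound(1)[OF inv_transition[OF assms]] by (rule psubset_card_mono[rotated])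
qed

text \<open>Each transition lowers the number of valid positions that are not yet visited.\<close>

lemma ex_stuck: "\<exists>F. reachable F \<and> stuck F"
proof -
  have "\<exists>F. (transition R)\<^sup>*\<^sup>* T F \<and> stuck F" if "inv T" for T
    using that
  proof (induction "card {p. valid_position R p} - card (visited T)" arbitrary: T rule: less_induct)
    case less
    show ?case
    proof (cases "stuck T")
      case False
      then obtain T' where T': "transition R T T'" by blast
      have "card (visited T) < card (visited T')" by (rule card_visited_less[OF less(2) T'])
      moreover have "card (visited T') \<le> card {p. valid_position R p}"
        by (rule visited_bound(2)[OF inv_transition[OF less(2) T']])
      ultimately have "card {p. valid_position R p} - card (visited T') < card {p. valid_position R p} - card (visited T)"
        by linarith
      then obtain F where "(transition R)\<^sup>*\<^sup>* T' F" "stuck F"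
        using less(1)[OF _ inv_transition[OF less(2) T']] by blast
      then show ?thesis using converse_rtranclp_into_rtranclp[of "transition R", OF T'] by blast
    qed blast
  qed
  then show ?thesis using inv_initial by blast
qed

text \<open>Each transition visits something new, so the index is bounded by the number of visited
  positions and hence by that of valid ones, which excludes infinite runs.\<close>

lemma run_prefix:
  assumes "run R n r" "enat i \<le> n"
  shows "reachable (r i) \<and> i \<le> card (visited (r i))"
  using assms(2)
proof (induction i)
  case 0
  then show ?case using assms(1) by (simp add: run_def)
next
  case (Suc i)
  then have i: "enat i < n" by (simp add: Suc_ile_eq)
  then have IH: "reachable (r i)" "i \<le> card (visited (r i))" using Suc.IH by auto
  have tr: "transition R (r i) (r (Suc i))" using assms(1) i by (simp add: run_def)
  have "card (visited (r i)) < card (visited (r (Suc i)))" by (rule card_visited_less[OF inv_reachable[OF IH(1)] tr])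
  then show ?case using IH tr by (auto intro: rtranclp.rtrancl_into_rtrancl)
qed

lemma run_terminates:
  assumes "run R n r"
  shows "\<exists>k. n = enat k \<and> reachable (r k) \<and> stuck (r k)"
proof (cases n)
  case (enat k)
  then show ?thesis using run_prefix[OF assms, of k] assms by (auto simp: run_def)
next
  case infinity
  let ?k = "Suc (card {p. valid_position R p})"
  have "reachable (r ?k)" "?k \<le> card (visited (r ?k))"
    using run_prefix[OF assms, of ?k] infinity by auto
  moreover have "card (visited (r ?k)) \<le> card {p. valid_position R p}"
    by (rule visited_bound(2)[OF inv_reachable[OF calculation(1)]])
  ultimately show ?thesis by simp
qed

text \<open>Without any run, a claim about all runs would hold of every state. The run obtained here
  is what pins the final state down.\<close>

lemma stuck_run:
  assumes "reachable F" "stuck F"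
  shows "\<exists>n r. run R n r"
proof -
  obtain k where "(transition R ^^ k) (initial_state R) F" using assms(1) by (auto simp: rtranclp_power)
  then obtain r where "r 0 = initial_state R" "r k = F" "\<forall>i<k. transition R (r i) (r (Suc i))"
    by (auto simp: relpowp_fun_conv)
  then have "run R (enat k) r" using assms(2) by (auto simp: run_def)
  then show ?thesis by blast
qed

end

section \<open>Progress\<close>

text \<open>These are the levels whose links become nodes of the opened structure.\<close>

inductive accessible :: "('e \<Rightarrow> bool) \<Rightarrow> 'e link list \<Rightarrow> 'e link list \<Rightarrow> bool"
  for U :: "'e \<Rightarrow> bool" and S0 :: "'e link list" where
  top: "accessible U S0 S0"
| box: "accessible U S0 S \<Longrightarrow> BotL e ds S' \<in> set S \<Longrightarrow> U e \<Longrightarrow> accessible U S0 S'"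

lemma accessible_facts:
  assumes "accessible U S0 S" "structured ty S0"
  shows "structured ty S \<and> set (all_links S) \<subseteq> set (all_links S0) \<and> set (flats U ty S) \<subseteq> set (flats U ty S0)"
  using assms(1)
proof (induction rule: accessible.induct)
  case top
  then show ?case using assms(2) by simp
next
  case (box S e ds S')
  have "set (all_links S') \<subseteq> set (all_links S)" by (rule box_in_all_links[OF in_all_links[OF box(2)]])
  moreover have "set (flats U ty S') \<subseteq> set (flat U ty (BotL e ds S'))" using box(3) by auto
  moreover have "set (flat U ty (BotL e ds S')) \<subseteq> set (flats U ty S)"
    using box(2) by (metis UN_upper set_concat set_map image_eqI Sup_upper)
  moreover have "structured ty S'" using structured_box[OF _ box(2)] box(4) by blast
  ultimately show ?case using box(4) by blast
qed

lemma sync_cross_ports: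
  assumes "(p, q) \<in> sync_cross ty ps" "well_typed ty (SyncL ps)"
  obtains e m e' m' where "p = At e m" "q = At e' m'"
    "(e, neg_address (ty e) m) \<in> set (sync_ins ty ps)" "(e', pos_address (ty e') m') \<in> set (sync_outs ty ps)"
    "atom_at ty e m" "e \<in> set (concls (SyncL ps)) \<union> set (prems (SyncL ps))"
  using assms
proof (rule sync_crossD)
  fix a c m assume h: "(a, c) \<in> set ps" "ty c = ty a" "positive (ty a)" "pos_address (ty a) m" "p = At a m" "q = At c m"
  have "(a, False) \<in> set (sync_ins ty ps)" "(c, True) \<in> set (sync_outs ty ps)"
    unfolding sync_ins_def sync_outs_def set_map using h(1,3) by (auto intro!: rev_image_eqI[OF h(1)])
  moreover have "\<not> neg_address (ty a) m" by (rule pos_not_neg[OF h(4)])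
  moreover have "a \<in> set (prems (SyncL ps))" using h(1) by force
  ultimately show thesis using h that[of a m c m] by simp
next
  fix a c m assume h: "(a, c) \<in> set ps" "ty c = ty a" "negative (ty a)" "neg_address (ty a) m" "p = At c m" "q = At a m"
  have np: "\<not> positive (ty a)" using positive_not_negative h(3) by blast
  have "(c, True) \<in> set (sync_ins ty ps)" "(a, False) \<in> set (sync_outs ty ps)"
    unfolding sync_ins_def sync_outs_def set_map using np by (auto intro!: rev_image_eqI[OF h(1)])
  moreover have "\<not> pos_address (ty a) m" using pos_not_neg h(4) by metis
  moreover have "c \<in> set (concls (SyncL ps))" using h(1) by force
  ultimately show thesis using h that[of c m a m] by simp
qed

fun token_at :: "('e \<Rightarrow> 'x formula) \<Rightarrow> 'e position \<Rightarrow> 'e port \<times> address" where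
  "token_at ty (At e m) = ((e, neg_address (ty e) m), m)"
| "token_at ty (Lock e i) = ((e, True), [])"

lemma pass_Relay: "pass (Relay r s) (r, m) (s, m)" "pass (Relay r s) (s, m) (r, m)"
  by auto

lemma pass_Bin:
  "pass (Bin k c a b) (a, m) (c, Lft # m)" "pass (Bin k c a b) (b, m) (c, Rgt # m)"
  "pass (Bin k c a b) (c, Lft # m) (a, m)" "pass (Bin k c a b) (c, Rgt # m) (b, m)"
  by auto

locale stuck_machine = smll_machine R for R :: "('e, 'x) smll" +
  fixes F :: "'e state"
  assumes inv: "inv F" and stuck: "stuck F"
    and acyc: "\<forall>S\<in>levels (links R). switching_acyclic (edge_type R) S"
begin

declare pass.simps(1,2) [simp del]
declare pass_Relay [simp] pass_Bin [simp]

abbreviation "acc \<equiv> accessible (unlocked F) (links R)"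

text \<open>Only accessible levels count: the inside of a locked box has no counterpart in the
  opened structure.\<close>

definition pending :: "'e position set" where
  "pending = {p. \<exists>e m S. p = At e m \<and> acc S \<and> e \<in> level_concls S \<and>
     (atom_at ty e m) \<and> p \<notin> visited F}"

text \<open>\<open>q\<close> depends on \<open>p\<close>: the node that \<open>p\<close> meets next
  may send something on to \<open>q\<close>. At sync nodes and locked boxes this is coarser than
  token flow.\<close>

definition waits :: "'e position \<Rightarrow> 'e position \<Rightarrow> bool" where
  "waits p q \<longleftrightarrow> (token_at ty p, token_at ty q) \<in> steps flip (Pass (flats (unlocked F) ty (links R)))"

section \<open>Causes of pending positions\<close>

lemma on_track: "on_track F"
  using inv by (simp add: inv_def)

lemma acc_structured: "acc S \<Longrightarrow> structured ty S"
  using accessible_facts[OF _ structured] by blast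

lemma acc_link: "acc S \<Longrightarrow> l \<in> set S \<Longrightarrow> has_link R l"
  using accessible_facts[OF _ structured] in_all_links by blast

lemma acc_edge:
  assumes "acc S" "l \<in> set S" "e \<in> set (concls l) \<union> set (prems l)"
  shows "e \<in> level_concls S"
  using structured_level(1)[OF acc_structured[OF assms(1)]] assms(2,3)
  by (auto simp: level_concls_def level_prems_def)

lemma pendingI:
  assumes "acc S" "e \<in> level_concls S" "atom_at ty e m" "At e m \<notin> visited F"
  shows "At e m \<in> pending"
  using assms unfolding pending_def by blast

lemma waitsI:
  assumes "acc S" "l \<in> set S" "n \<in> set (flat (unlocked F) ty l)"
    and "pass n ((e', neg_address (ty e') m'), m') ((e, pos_address (ty e) m), m)"
    and "atom_at ty e m"
  shows "waits (At e' m') (At e m)"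
proof -
  have "n \<in> set (flats (unlocked F) ty S)" using assms(2,3) by auto
  then have "n \<in> set (flats (unlocked F) ty (links R))" using accessible_facts[OF assms(1) structured] by blast
  then have "Pass (flats (unlocked F) ty (links R)) ((e', neg_address (ty e') m'), m') ((e, pos_address (ty e) m), m)"
    unfolding Pass_def using assms(4) by blast
  \<comment> \<open>A position comes onto its edge by one end and leaves by the other, so the
    departure port of the passage is wired to the arrival port of \<open>At e m\<close>.\<close>
  moreover have "flip (e, neg_address (ty e) m) = (e, pos_address (ty e) m)"
    using assms(5) pos_not_neg[of "ty e" m] by auto
  ultimately show ?thesis
    unfolding waits_def token_at.simps steps_iff[of flip, OF flip_simps(3)] by simp
qed

lemma unlocked_if_visited:
  assumes "has_link R (BotL e ds S)" "At e [] \<in> visited F"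
  shows "unlocked F e"
proof -
  have "Lock e 0 \<in> visited F" by (rule stuck_move[OF inv stuck move.lock[OF assms(1)] assms(2)])
  then have "Lock e 0 \<in> ran F" using visited_next[OF on_track] Lock_no_step by blast
  then show ?thesis by (auto simp: unlocked_def)
qed

text \<open>The crossing is blocked by some unvisited in-position, which need not be the one that is
  mapped to \<open>At e m\<close>; hence the node of a sync link relates all inputs to all
  outputs.\<close>

lemma sync_pending:
  assumes S: "acc S" and l: "SyncL ps \<in> set S" and q: "At e m \<in> Range (sync_cross ty ps)" "At e m \<notin> visited F"
    and v: "atom_at ty e m"
  shows "\<exists>p\<in>pending. waits p (At e m)"
proof -
  have link: "has_link R (SyncL ps)" by (rule acc_link[OF S l])
  have wt: "well_typed ty (SyncL ps)" by (rule link_facts(1)[OF link])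
  have "\<not> Domain (sync_cross ty ps) \<subseteq> visited F" using stuck_sync[OF inv stuck link] q by blast
  then obtain p q' where p: "(p, q') \<in> sync_cross ty ps" "p \<notin> visited F" by blast
  obtain e1 m1 where 1: "p = At e1 m1" "(e1, neg_address (ty e1) m1) \<in> set (sync_ins ty ps)"
    "atom_at ty e1 m1" "e1 \<in> set (concls (SyncL ps)) \<union> set (prems (SyncL ps))"
    by (rule sync_cross_ports[OF p(1) wt])
  obtain p0 where p0: "(p0, At e m) \<in> sync_cross ty ps" using q(1) by blast
  have 2: "(e, pos_address (ty e) m) \<in> set (sync_outs ty ps)"
    by (rule sync_cross_ports[OF p0 wt]) simp
  have "At e1 m1 \<in> pending" using pendingI[OF S acc_edge[OF S l 1(4)] 1(3)] p(2) 1(1) by simp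
  moreover have "waits (At e1 m1) (At e m)"
    by (rule waitsI[OF S l, of "Sync (sync_ins ty ps) (sync_outs ty ps)"]) (simp_all add: 1(2) 2 v)
  ultimately show ?thesis by blast
qed

lemma pending_via_move:
  assumes S: "acc S" "e' \<in> level_concls S" and v: "atom_at ty e' m'"
    and m: "move R F (At e' m') (At e m)" "At e m \<notin> visited F" and w: "waits (At e' m') (At e m)"
  shows "\<exists>p\<in>pending. waits p (At e m)"
proof -
  have "At e' m' \<notin> visited F" using stuck_move[OF inv stuck m(1)] m(2) by blast
  then show ?thesis using pendingI[OF S v] w by blast
qed

lemma bin_node:
  assumes "l = TensL a b c \<or> l = ParL a b c"
  obtains k where "Bin k (c, True) (a, False) (b, False) \<in> set (flat (unlocked F) ty l)"
  using assms by (elim disjE) auto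

lemma bin_conclusion_pending:
  assumes S: "acc S" and l: "l \<in> set S" "l = TensL a b c \<or> l = ParL a b c"
    and v: "pos_address (ty c) m" and un: "At c m \<notin> visited F"
  shows "\<exists>p\<in>pending. waits p (At c m)"
proof -
  have link: "has_link R l" by (rule acc_link[OF S l(1)])
  obtain k where k: "Bin k (c, True) (a, False) (b, False) \<in> set (flat (unlocked F) ty l)" by (rule bin_node[OF l(2)])
  have edge: "a \<in> level_concls S" "b \<in> level_concls S" using acc_edge[OF S l(1)] l(2) by auto
  have "ty c = Tens (ty a) (ty b) \<or> ty c = Parr (ty a) (ty b)" using link_facts(1)[OF link] l(2) by auto
  then consider m' where "m = Lft # m'" "pos_address (ty a) m'" | m' where "m = Rgt # m'" "pos_address (ty b) m'"
    using v by (cases m rule: list.exhaust; cases "hd m") auto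
  then show ?thesis
  proof cases
    case 1
    have "\<not> neg_address (ty a) m'" by (rule pos_not_neg[OF 1(2)])
    moreover have "move R F (At a m') (At c m)" unfolding 1(1) using link l(2) 1(2) by (intro move.down_left) auto
    ultimately show ?thesis
      by (intro pending_via_move[OF S _ _ _ un, of a m']) (use edge 1 v waitsI[OF S l(1) k, of a m' c m] in simp_all)
  next
    case 2
    have "\<not> neg_address (ty b) m'" by (rule pos_not_neg[OF 2(2)])
    moreover have "move R F (At b m') (At c m)" unfolding 2(1) using link l(2) 2(2) by (intro move.down_right) auto
    ultimately show ?thesis
      by (intro pending_via_move[OF S _ _ _ un, of b m']) (use edge 2 v waitsI[OF S l(1) k, of b m' c m] in simp_all)
  qed
qed

lemma bin_premise_pending:
  assumes S: "acc S" and l: "l \<in> set S" "l = TensL a b c \<or> l = ParL a b c" and e: "e = a \<or> e = b"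
    and v: "neg_address (ty e) m" and un: "At e m \<notin> visited F"
  shows "\<exists>p\<in>pending. waits p (At e m)"
proof -
  have link: "has_link R l" by (rule acc_link[OF S l(1)])
  obtain k where k: "Bin k (c, True) (a, False) (b, False) \<in> set (flat (unlocked F) ty l)" by (rule bin_node[OF l(2)])
  have edge: "c \<in> level_concls S" using acc_edge[OF S l(1)] l(2) by auto
  have np: "\<not> pos_address (ty e) m" using v pos_not_neg by metis
  have tc: "ty c = Tens (ty a) (ty b) \<or> ty c = Parr (ty a) (ty b)" using link_facts(1)[OF link] l(2) by auto
  from e show ?thesis
  proof
    assume ea: "e = a"
    have "move R F (At c (Lft # m)) (At e m)" unfolding ea using link l(2) v ea by (intro move.up_left) auto
    moreover have "neg_address (ty c) (Lft # m)" using tc v ea by auto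
    ultimately show ?thesis
      by (intro pending_via_move[OF S _ _ _ un, of c "Lft # m"])
        (use edge ea np v waitsI[OF S l(1) k, of c "Lft # m" e m] in simp_all)
  next
    assume eb: "e = b"
    have "move R F (At c (Rgt # m)) (At e m)" unfolding eb using link l(2) v eb by (intro move.up_right) auto
    moreover have "neg_address (ty c) (Rgt # m)" using tc v eb by auto
    ultimately show ?thesis
      by (intro pending_via_move[OF S _ _ _ un, of c "Rgt # m"])
        (use edge eb np v waitsI[OF S l(1) k, of c "Rgt # m" e m] in simp_all)
  qed
qed

text \<open>Tokens come down, so the cause is sought at the link of which \<open>e\<close> is a
  conclusion. An axiom, tensor, par or open border offers a predecessor that must be unvisited, or
  its token would have moved on. A sync link offers one of its in-positions and a locked box its
  lock. A one link cannot occur: being accessible it is active, and its position is visited.\<close>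

lemma pos_pending:
  assumes S: "acc S" "e \<in> level_concls S" and v: "pos_address (ty e) m" and un: "At e m \<notin> visited F"
  shows "\<exists>p\<in>pending. waits p (At e m)"
proof -
  obtain l where l: "l \<in> set S" "e \<in> set (concls l)" using S(2) by (auto simp: level_concls_def)
  have link: "has_link R l" by (rule acc_link[OF S(1) l(1)])
  have wt: "well_typed ty l" by (rule link_facts(1)[OF link])
  have nn: "\<not> neg_address (ty e) m" by (rule pos_not_neg[OF v])
  note w = waitsI[OF S(1) l(1)] and edge = acc_edge[OF S(1) l(1)]
  note via = pending_via_move[OF S(1) _ _ _ un]
  show ?thesis
  proof (cases l)
    case (AxL a b)
    then consider "e = a" | "e = b" using l(2) by auto
    then show ?thesis
    proof cases
      case 1
      have n: "neg_address (ty b) m" "\<not> pos_address (ty b) m" using wt AxL v nn 1 by auto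
      have "move R F (At b m) (At e m)" using link n(1) unfolding AxL 1 by (rule move.ax2)
      then show ?thesis
        by (rule via[rotated 2]) (use edge[of b] n v nn w[of "Relay (a, True) (b, True)" b m e m] AxL 1 in simp_all)
    next
      case 2
      have n: "neg_address (ty a) m" "\<not> pos_address (ty a) m" using wt AxL v nn 2 by auto
      have "move R F (At a m) (At e m)" using link n(1) unfolding AxL 2 by (rule move.ax1)
      then show ?thesis
        by (rule via[rotated 2]) (use edge[of a] n v nn w[of "Relay (a, True) (b, True)" a m e m] AxL 2 in simp_all)
    qed
  next
    case (CutL a b)
    then show ?thesis using l(2) by simp
  next
    case (TensL a b c)
    then show ?thesis using bin_conclusion_pending[OF S(1) l(1), of a b c m] l(2) v un by simp
  next
    case (ParL a b c)
    then show ?thesis using bin_conclusion_pending[OF S(1) l(1), of a b c m] l(2) v un by simp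
  next
    case (OneL h)
    have "active R F l"
      using S(1)
    proof cases
      case top
      then show ?thesis using l(1) by (simp add: active_def)
    next
      case (box S1 h' ds)
      have "has_link R (BotL h' ds S)" by (rule acc_link[OF box(1,2)])
      then show ?thesis using box(3) l(1) unfolding active_def by blast
    qed
    then have "At h [] \<in> visited F" using stuck_one[OF inv stuck] link OneL by blast
    moreover have "e = h" "m = []" using l(2) wt v OneL by auto
    ultimately show ?thesis using un by simp
  next
    case (BotL h ds S')
    have "e \<noteq> h" using wt BotL v by auto
    then obtain f where f: "(f, e) \<in> set ds" using l(2) BotL by auto
    have tf: "ty e = ty f" using wt BotL f by auto
    show ?thesis
    proof (cases "unlocked F h")
      case True
      have S': "acc S'" using S(1) l(1)[unfolded BotL] True by (rule accessible.box)
      have fS: "f \<in> level_concls S'"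
        by (rule conclusionsD[OF box_border[OF wt[unfolded BotL] f]])
      have "move R F (At f m) (At e m)" by (rule move.leave[OF link[unfolded BotL] f]) (use v tf in simp)
      moreover have "Relay (e, True) (f, False) \<in> set (flat (unlocked F) ty l)" using True f BotL by force
      then have "waits (At f m) (At e m)" by (rule w) (use v nn tf in simp_all)
      ultimately show ?thesis using pending_via_move[OF S' fS, of m e m] v tf un by simp
    next
      case False
      \<comment> \<open>The content of a locked box is not inspected. The blame goes to the token
        missing at the lock, as provided for by the node of a locked box in
        \<open>flat\<close>.\<close>
      have "At h [] \<notin> visited F" using unlocked_if_visited[OF link[unfolded BotL]] False by blast
      moreover have "ty h = Bot" using wt BotL by simp
      ultimately have "At h [] \<in> pending" using pendingI[OF S(1) edge[of h], of "[]"] BotL by simp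
      moreover have "waits (At h []) (At e m)"
        by (rule w[of "Sync [(h, True)] (map (\<lambda>(f, g). (g, True)) ds)"])
          (use False BotL \<open>ty h = Bot\<close> v f in \<open>auto intro: rev_image_eqI\<close>)
      ultimately show ?thesis by blast
    qed
  next
    case (SyncL ps)
    obtain a where a: "(a, e) \<in> set ps" using l(2) SyncL by auto
    have "ty e = ty a" "positive (ty a) \<or> negative (ty a)" using wt SyncL a by auto
    then have "positive (ty a)" using v negative_no_pos by metis
    then have "(At a m, At e m) \<in> sync_cross ty ps" using a v \<open>ty e = ty a\<close> by (auto simp: sync_cross_def)
    then show ?thesis using sync_pending[OF S(1) l(1)[unfolded SyncL] _ un] v by blast
  qed
qed

text \<open>Tokens come up from the link with premiss \<open>e\<close> or through the border of an
  unlocked box. At a conclusion of the net there is no such cause, but its negative positions are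
  initial and thus visited.\<close>

lemma neg_pending:
  assumes S: "acc S" "e \<in> level_concls S" and v: "neg_address (ty e) m" and un: "At e m \<notin> visited F"
  shows "\<exists>p\<in>pending. waits p (At e m)"
proof -
  have np: "\<not> pos_address (ty e) m" using v pos_not_neg by metis
  note via = pending_via_move[OF _ _ _ _ un]
  show ?thesis
  proof (cases "e \<in> level_prems S")
    case True
    then obtain l where l: "l \<in> set S" "e \<in> set (prems l)" by (auto simp: level_prems_def)
    have link: "has_link R l" by (rule acc_link[OF S(1) l(1)])
    have wt: "well_typed ty l" by (rule link_facts(1)[OF link])
    note w = waitsI[OF S(1) l(1)] and edge = acc_edge[OF S(1) l(1)]
    note via = via[OF S(1)]
    show ?thesis
    proof (cases l)
      case (CutL a b)
      then consider "e = a" | "e = b" using l(2) by auto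
      then show ?thesis
      proof cases
        case 1
        have n: "pos_address (ty b) m" "\<not> neg_address (ty b) m" using wt CutL v np 1 by auto
        have "move R F (At b m) (At e m)" using link n(1) unfolding CutL 1 by (rule move.cut2)
        then show ?thesis
          by (rule via[rotated 2]) (use edge[of b] n v np w[of "Relay (a, False) (b, False)" b m e m] CutL 1 in simp_all)
      next
        case 2
        have n: "pos_address (ty a) m" "\<not> neg_address (ty a) m" using wt CutL v np 2 by auto
        have "move R F (At a m) (At e m)" using link n(1) unfolding CutL 2 by (rule move.cut1)
        then show ?thesis
          by (rule via[rotated 2]) (use edge[of a] n v np w[of "Relay (a, False) (b, False)" a m e m] CutL 2 in simp_all)
      qed
    next
      case (TensL a b c)
      then show ?thesis using bin_premise_pending[OF S(1) l(1) _ _ v un, of a b c] l(2) by auto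
    next
      case (ParL a b c)
      then show ?thesis using bin_premise_pending[OF S(1) l(1) _ _ v un, of a b c] l(2) by auto
    next
      case (SyncL ps)
      obtain c where c: "(e, c) \<in> set ps" using l(2) SyncL by auto
      have tc: "ty c = ty e" "positive (ty e) \<or> negative (ty e)" using wt SyncL c by auto
      then have "negative (ty e)" using v positive_no_neg by metis
      then have "(At c m, At e m) \<in> sync_cross ty ps" using c v tc(1) by (auto simp: sync_cross_def)
      then show ?thesis using sync_pending[OF S(1) l(1)[unfolded SyncL] _ un] v by blast
    qed (use l(2) in simp_all)
  next
    case False
    then have concl: "e \<in> conclusions S" using S(2) by (simp add: conclusions_def)
    from S(1) show ?thesis
    proof cases
      case top
      then have "At e m \<in> INIT R" using concl v by (auto simp: INIT_def)
      then have "At e m \<in> visited F" using inv dom_visited[OF on_track] by (auto simp: inv_def)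
      then show ?thesis using un by simp
    next
      case (box S1 h ds)
      have link: "has_link R (BotL h ds S)" by (rule acc_link[OF box(1,2)])
      have wt: "well_typed ty (BotL h ds S)" by (rule link_facts(1)[OF link])
      have "e \<in> set (map fst ds)" using concl wt by simp
      then obtain g where g: "(e, g) \<in> set ds" by auto
      have tg: "ty g = ty e" using wt g by auto
      have gS: "g \<in> level_concls S1" by (rule acc_edge[OF box(1,2)]) (use snd_in_concls[OF g] in blast)
      have "move R F (At g m) (At e m)" by (rule move.enter[OF link g box(3)]) (use v tg in simp)
      moreover have "Relay (g, True) (e, False) \<in> set (flat (unlocked F) ty (BotL h ds S))" using box(3) g by force
      then have "waits (At g m) (At e m)" by (rule waitsI[OF box(1,2)]) (use v np tg in simp_all)
      ultimately show ?thesis using via[OF box(1) gS, of m] v tg by simp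
    qed
  qed
qed

text \<open>The pending positions are finitely many and each waits for a pending one, whereas an
  acyclic relation on a finite set is well-founded.\<close>

lemma no_pending: "pending = {}"
proof (rule ccontr)
  assume ne: "pending \<noteq> {}"
  let ?N = "flats (unlocked F) ty (links R)"
  have step: "\<exists>q\<in>pending. waits q p" if "p \<in> pending" for p
    using that pos_pending neg_pending unfolding pending_def by fast
  have "pending \<subseteq> {p. valid_position R p}"
  proof
    fix p assume "p \<in> pending"
    then obtain e m S where h: "p = At e m" "acc S" "e \<in> level_concls S" "atom_at ty e m"
      unfolding pending_def by blast
    obtain l where l: "l \<in> set S" "e \<in> set (concls l)" using h(3) by (auto simp: level_concls_def)
    have "e \<in> deep_edges (links R)" using prems_deep(1)[OF acc_link[OF h(2) l(1)]] l(2) by blast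
    then show "p \<in> {p. valid_position R p}" using h(1,4) by simp
  qed
  then have fin: "finite (token_at ty ` pending)" using finite_valid finite_subset by blast
  define r where "r = steps flip (Pass ?N) \<inter> (token_at ty ` pending \<times> token_at ty ` pending)"
  have "acyclic (steps flip (Pass ?N))" by (rule acyclic_flats[OF structured acyc])
  then have "acyclic r" unfolding r_def by (rule acyclic_subset) simp
  moreover have "finite r" unfolding r_def using fin by simp
  ultimately have "wf r" by (simp add: finite_acyclic_wf)
  moreover obtain p0 where "p0 \<in> pending" using ne by blast
  then have "token_at ty p0 \<in> token_at ty ` pending" by blast
  ultimately obtain z where z: "z \<in> token_at ty ` pending" "\<And>y. (y, z) \<in> r \<Longrightarrow> y \<notin> token_at ty ` pending"
    by (rule wfE_min) blast
  obtain p where p: "p \<in> pending" "z = token_at ty p" using z(1) by blast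
  obtain q where q: "q \<in> pending" "waits q p" using step[OF p(1)] by blast
  then have "(token_at ty q, z) \<in> r" unfolding r_def waits_def p(2) using p(1) by blast
  then show False using z(2) q(1) by blast
qed

text \<open>With nothing pending, the lock of each accessible box has been visited and the box is
  unlocked, so accessibility spreads to all depths.\<close>

lemma all_accessible:
  assumes "has_link R l"
  shows "\<exists>S. acc S \<and> l \<in> set S"
proof -
  have "\<exists>S'. acc S' \<and> l \<in> set S'" if "acc S" "l \<in> set (all_links S)" for S
    using that
  proof (induction "length (all_links S)" arbitrary: S rule: less_induct)
    case less
    obtain l0 where l0: "l0 \<in> set S" "l \<in> set (sub_links l0)" using less(3) by (auto simp: set_all_links)
    show ?case
    proof (cases "l = l0")
      case True
      then show ?thesis using less(2) l0(1) by blast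
    next
      case False
      then obtain e ds S1 where b: "l0 = BotL e ds S1" using l0(2) by (cases l0) auto
      have l: "l \<in> set (all_links S1)" using l0(2) False b by simp
      have link: "has_link R (BotL e ds S1)" using acc_link[OF less(2) l0(1)] b by simp
      have "ty e = Bot" using link_facts(1)[OF link] by simp
      moreover have "e \<in> level_concls S" by (rule acc_edge[OF less(2) l0(1)]) (simp add: b)
      ultimately have "At e [] \<in> visited F" using pendingI[OF less(2), of e "[]"] no_pending by auto
      then have "unlocked F e" by (rule unlocked_if_visited[OF link])
      then have "acc S1" using less(2) l0(1)[unfolded b] by (blast intro: accessible.box)
      then show ?thesis using less(1)[OF links_less[OF l0(1)[unfolded b]] _ l] by blast
    qed
  qed
  then show ?thesis using accessible.top assms by blast
qed

section \<open>Finality of the stuck state\<close>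

lemma all_visited:
  assumes "valid_position R (At e m)"
  shows "At e m \<in> visited F"
proof (rule ccontr)
  assume un: "At e m \<notin> visited F"
  have "e \<in> deep_edges (links R)" using assms by simp
  then obtain l where l: "has_link R l" "e \<in> set (concls l)" by (auto simp: level_concls_def)
  obtain S where S: "acc S" "l \<in> set S" using all_accessible[OF l(1)] by blast
  have "e \<in> level_concls S" using l(2) S(2) by (auto simp: level_concls_def)
  then have "At e m \<in> pending" using pendingI[OF S(1)] assms un by simp
  then show False using no_pending by simp
qed

lemma all_unlocked:
  assumes "has_link R (BotL e ds S)"
  shows "unlocked F e"
proof -
  have "ty e = Bot" using link_facts(1)[OF assms] by simp
  then have "valid_position R (At e [])" using prems_deep(1)[OF assms] by simp
  then show ?thesis by (rule unlocked_if_visited[OF assms all_visited])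
qed

lemma current_no_step:
  assumes "At e m \<in> ran F"
  shows "\<not> flow_step R (At e m) q"
proof
  assume q: "flow_step R (At e m) q"
  then have un: "q \<notin> visited F" by (rule current_next_unvisited[OF on_track assms])
  obtain l where l: "has_link R l" "link_step ty l (At e m) q" using q by (auto simp: flow_step_def)
  have v: "valid_position R q" by (rule link_step_valid[OF l])
  show False
  proof (cases q)
    case (At e' m')
    then show False using all_visited v un by simp
  next
    case (Lock e' i)
    then obtain ds S where b: "has_link R (BotL e' ds S)" and i: "i = 0" using v by (auto simp: is_lock_def)
    \<comment> \<open>The box was unlocked by some lock position, and only counter 0 is valid, so
      that position is \<open>q\<close>.\<close>
    obtain k where "Lock e' k \<in> ran F" using all_unlocked[OF b] by (auto simp: unlocked_def)
    then have k: "Lock e' k \<in> visited F" using ran_visited[OF on_track] by blast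
    then have "k = 0" using visited_valid[OF on_track] by fastforce
    then show False using un k Lock i by simp
  qed
qed

text \<open>A negative atom always has a step up through the link above, and a positive one has a
  step down unless its edge is a conclusion of the net. Sync links are no exception, as
  \<open>flow_step\<close> does not wait for other tokens.\<close>

lemma current_final:
  assumes ran: "At e m \<in> ran F"
  shows "At e m \<in> FIN R"
proof -
  have "valid_position R (At e m)" using ran ran_visited[OF on_track] visited_valid[OF on_track] by blast
  then have e: "e \<in> deep_edges (links R)" "atom_at ty e m" by auto
  then obtain l where l: "has_link R l" "e \<in> set (concls l)" by (auto simp: level_concls_def)
  have wt: "well_typed ty l" by (rule link_facts(1)[OF l(1)])
  have stop: "\<not> link_step ty l' (At e m) q" if "has_link R l'" for l' q
    using current_no_step[OF ran] that by (auto simp: flow_step_def)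
  have split: "(\<exists>m'. m = Lft # m' \<and> neg_address A m') \<or> (\<exists>m'. m = Rgt # m' \<and> neg_address B m')"
    if "neg_address (Tens A B) m \<or> neg_address (Parr A B) m" for A B
    using that by (cases m rule: list.exhaust; cases "hd m") auto
  have "\<not> neg_address (ty e) m"
  proof
    assume n: "neg_address (ty e) m"
    note stop = stop[OF l(1)]
    show False
    proof (cases l)
      case (AxL a b)
      then show False using l(2) n stop[of "At a m"] stop[of "At b m"] by auto
    next
      case (CutL a b)
      then show False using l(2) by simp
    next
      case (TensL a b c)
      then have "e = c" "ty c = Tens (ty a) (ty b)" using l(2) wt by auto
      then show False using n split[of "ty a" "ty b"] stop unfolding TensL by auto
    next
      case (ParL a b c)
      then have "e = c" "ty c = Parr (ty a) (ty b)" using l(2) wt by auto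
      then show False using n split[of "ty a" "ty b"] stop unfolding ParL by auto
    next
      case (OneL h)
      then show False using l(2) wt n by simp
    next
      case (BotL h ds S)
      show False
      proof (cases "e = h")
        case True
        then have "m = []" using n wt BotL by simp
        then show False using stop[of "Lock h 0"] True BotL by simp
      next
        case False
        then obtain f where "(f, e) \<in> set ds" using l(2) BotL by auto
        then have "link_step ty l (At e m) (At f m)" using n BotL by auto
        then show False using stop by blast
      qed
    next
      case (SyncL ps)
      then obtain a where a: "(a, e) \<in> set ps" using l(2) by auto
      then have "ty e = ty a" "positive (ty a) \<or> negative (ty a)" using wt SyncL by auto
      then have "negative (ty e)" using n positive_no_neg by metis
      then have "link_step ty l (At e m) (At a m)" using a n SyncL by (auto simp: sync_cross_def)
      then show False using stop by blast
    qed
  qed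
  then have p: "pos_address (ty e) m" using e(2) by blast
  obtain S where S: "acc S" "l \<in> set S" using all_accessible[OF l(1)] by blast
  have eS: "e \<in> level_concls S" using l(2) S(2) by (auto simp: level_concls_def)
  have not_prem: "e \<notin> level_prems S"
  proof
    assume "e \<in> level_prems S"
    then obtain l' where l': "l' \<in> set S" "e \<in> set (prems l')" by (auto simp: level_prems_def)
    have link: "has_link R l'" by (rule acc_link[OF S(1) l'(1)])
    have wt: "well_typed ty l'" by (rule link_facts(1)[OF link])
    note stop = stop[OF link]
    show False
    proof (cases l')
      case (CutL a b)
      then show False using l'(2) p stop[of "At a m"] stop[of "At b m"] by auto
    next
      case (TensL a b c)
      then show False using l'(2) p stop[of "At c (Lft # m)"] stop[of "At c (Rgt # m)"] by auto
    next
      case (ParL a b c)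
      then show False using l'(2) p stop[of "At c (Lft # m)"] stop[of "At c (Rgt # m)"] by auto
    next
      case (SyncL ps)
      then obtain c where c: "(e, c) \<in> set ps" using l'(2) by auto
      then have "positive (ty e) \<or> negative (ty e)" using wt SyncL by auto
      then have "positive (ty e)" using p negative_no_pos by metis
      then have "link_step ty l' (At e m) (At c m)" using c p SyncL by (auto simp: sync_cross_def)
      then show False using stop by blast
    qed (use l'(2) in simp_all)
  qed
  then have concl: "e \<in> conclusions S" using eS by (simp add: conclusions_def)
  from S(1) show ?thesis
  proof cases
    case top
    then show ?thesis using concl p by (auto simp: FIN_def)
  next
    case (box S1 h ds)
    have link: "has_link R (BotL h ds S)" by (rule acc_link[OF box(1,2)])
    have "e \<in> set (map fst ds)" using concl link_facts(1)[OF link] by simp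
    then obtain g where "(e, g) \<in> set ds" by auto
    then have "link_step ty (BotL h ds S) (At e m) (At g m)" using p by auto
    then show ?thesis using stop[OF link] by blast
  qed
qed

lemma FIN_no_step:
  assumes "p \<in> FIN R"
  shows "\<not> flow_step R p q"
proof
  assume "flow_step R p q"
  then obtain l where l: "has_link R l" "link_step ty l p q" by (auto simp: flow_step_def)
  obtain e m where e: "p = At e m" "e \<in> conclusions (links R)" "pos_address (ty e) m"
    using assms by (auto simp: FIN_def)
  have "arrival ty p \<in> pass_ports l" by (rule step_ports(1)[OF link_facts(1)[OF l(1)] l(2)])
  then have "(e, False) \<in> pass_ports l" using e(1) pos_not_neg[OF e(3)] by simp
  then show False using conclusion_not_passed[OF structured l(1) e(2)] by blast
qed

lemma final: "final_state R F"
proof -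
  have valid: "valid_position R p" if "p \<in> ran F" for p
    using that ran_visited[OF on_track] visited_valid[OF on_track] by blast
  have "ran F \<subseteq> FIN R \<union> BOTBOX R"
  proof
    fix p assume p: "p \<in> ran F"
    show "p \<in> FIN R \<union> BOTBOX R"
    proof (cases p)
      case (At e m)
      then show ?thesis using current_final p by simp
    next
      case (Lock e i)
      then show ?thesis using valid[OF p] by (auto simp: BOTBOX_def)
    qed
  qed
  \<comment> \<open>Final positions have been visited and have no outgoing step, so a token still
    stands on each.\<close>
  moreover have "FIN R \<subseteq> ran F"
  proof
    fix p assume p: "p \<in> FIN R"
    obtain e m where e: "p = At e m" "e \<in> conclusions (links R)" "pos_address (ty e) m"
      using p by (auto simp: FIN_def)
    have "e \<in> deep_edges (links R)" by (rule conclusions_deep[OF e(2)])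
    then have "p \<in> visited F" using all_visited e by simp
    then show "p \<in> ran F" using visited_next[OF on_track] FIN_no_step[OF p] by blast
  qed
  ultimately have "ran F = FIN R \<union> (ran F \<inter> BOTBOX R)" by blast
  moreover have "ran F \<inter> BOTBOX R \<subseteq> BOTBOX R" by blast
  moreover have "is_state R F"
    unfolding is_state_def
  proof
    have "INIT R \<subseteq> dom F" "dom F \<subseteq> INIT R \<union> ONES R" using inv unfolding inv_def on_track_def by blast+
    then have "dom F = INIT R \<union> (dom F \<inter> ONES R)" by blast
    then show "\<exists>K\<subseteq>ONES R. dom F = INIT R \<union> K" by blast
    show "ran F \<subseteq> POS R"
    proof
      fix p assume p: "p \<in> ran F"
      show "p \<in> POS R" using valid[OF p] by (cases p) (auto simp: POS_def BOTBOX_def)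
    qed
  qed
  ultimately show ?thesis unfolding final_state_def by blast
qed

end

theorem mainTheorem11:
  fixes R :: "('e, 'x) smll"
  assumes "smll_net R"
  shows "\<exists>!F. final_state R F \<and> (\<forall>n r. run R n r \<longrightarrow> terminates_on n r F)"
proof -
  have acyc: "\<forall>S\<in>levels (links R). switching_acyclic (edge_type R) S"
    using assms by (simp add: smll_net_def)
  interpret smll_machine R
    using assms by unfold_locales (simp add: smll_net_def)
  obtain F where F: "reachable F" "stuck F" using ex_stuck by blast
  interpret stuck_machine R F
    by unfold_locales (use inv_reachable[OF F(1)] F(2) acyc in auto)
  have runs: "terminates_on n r F" if "run R n r" for n r
    using run_terminates[OF that] stuck_unique[OF F] unfolding terminates_on_def by blast
  obtain n r where nr: "run R n r" using stuck_run[OF F] by blast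
  show ?thesis
  proof (rule ex1I[of _ F])
    show "final_state R F \<and> (\<forall>n r. run R n r \<longrightarrow> terminates_on n r F)" using final runs by blast
    fix F' assume "final_state R F' \<and> (\<forall>n r. run R n r \<longrightarrow> terminates_on n r F')"
    then have "terminates_on n r F'" using nr by blast
    then show "F' = F" using runs[OF nr] unfolding terminates_on_def by auto
  qed
qed

end
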